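(* Fix $\mathbb{K}\in\{\mathbb{R},\mathbb{C}\}$, a positive integer $q$, and a dimension $d$ with $d\ge q+2$ if $\mathbb{K}=\mathbb{R}$, and $d\ge\frac{q+2}{2}$ if $\mathbb{K}=\mathbb{C}$. Then for all sufficiently large $n$, the space of equal norm Parseval frames with $n$ vectors in $\mathbb{K}^d$ is $q$-connected.
   Context: The space of equal norm Parseval frames with $n$ vectors in $\mathbb{K}^d$ is the set of matrices $F=[f_1\ \cdots\ f_n]\in\mathbb{K}^{d\times n}$ with $FF^*=\mathbb{I}_d$ (where $F^*$ is the (conjugate) transpose) and all columns of the same norm, equivalently $\|f_i\|^2=d/n$ for all $i$, with the subspace topology. In this paper, a space is called $q$-connected if its $q$-th homotopy group $\pi_q$ is trivial. *)

theory Defs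
  imports
    "HOL-Analysis.Analysis"
    "HOL-Algebra.Elementary_Groups"
    "Jordan_Normal_Form.Schur_Decomposition"
begin

section \<open>Homotopy groups\<close>

definition cube :: "nat \<Rightarrow> (nat \<Rightarrow> real) topology" where
  "cube q = product_topology (\<lambda>_. top_of_set {0..1}) {..<q}"

definition cube_boundary :: "nat \<Rightarrow> (nat \<Rightarrow> real) set" where
  "cube_boundary q = {t \<in> topspace (cube q). \<exists>i<q. t i = 0 \<or> t i = 1}"

definition cube_maps :: "nat \<Rightarrow> 'a topology \<Rightarrow> 'a \<Rightarrow> ((nat \<Rightarrow> real) \<Rightarrow> 'a) set" where
  "cube_maps q X x = {f. continuous_map (cube q) X f \<and> (\<forall>t\<in>cube_boundary q. f t = x)}"

text \<open>Homotopy relative to the boundary of the cube.  Functions that agree on the cube are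
  related, so their values outside the cube are irrelevant.\<close>

definition cube_homotopic ::
  "nat \<Rightarrow> 'a topology \<Rightarrow> 'a \<Rightarrow> (((nat \<Rightarrow> real) \<Rightarrow> 'a) \<times> ((nat \<Rightarrow> real) \<Rightarrow> 'a)) set" where
  "cube_homotopic q X x = {(f, g). f \<in> cube_maps q X x \<and> g \<in> cube_maps q X x \<and>
     homotopic_with (\<lambda>h. \<forall>t\<in>cube_boundary q. h t = x) (cube q) X f g}"

definition cube_concat ::
  "((nat \<Rightarrow> real) \<Rightarrow> 'a) \<Rightarrow> ((nat \<Rightarrow> real) \<Rightarrow> 'a) \<Rightarrow> (nat \<Rightarrow> real) \<Rightarrow> 'a" where
  "cube_concat f g t =
     (if t 0 \<le> 1/2 then f (t(0 := 2 * t 0)) else g (t(0 := 2 * t 0 - 1)))"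

text \<open>Intended for \<open>q \<ge> 1\<close> and \<open>x \<in> topspace X\<close>.  Concatenation respects homotopy, so the
  image taken in the product of two classes is again a single class.\<close>

definition homotopy_group ::
  "nat \<Rightarrow> 'a topology \<Rightarrow> 'a \<Rightarrow> ((nat \<Rightarrow> real) \<Rightarrow> 'a) set monoid" where
  "homotopy_group q X x =
     \<lparr>carrier = cube_maps q X x // cube_homotopic q X x,
      monoid.mult = (\<lambda>A B. cube_homotopic q X x `` {cube_concat f g | f g. f \<in> A \<and> g \<in> B}),
      one = cube_homotopic q X x `` {\<lambda>_. x}\<rparr>"

text \<open>This concerns the single group \<open>\<pi>\<^sub>q\<close>, at every base point; nothing is
  required of the other homotopy groups.\<close>

definition q_connected :: "nat \<Rightarrow> 'a topology \<Rightarrow> bool" where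
  "q_connected q X \<longleftrightarrow> (\<forall>x\<in>topspace X. trivial_group (homotopy_group q X x))"


section \<open>Equal norm Parseval frames\<close>

text \<open>The usual topology on \<open>m \<times> n\<close> matrices: the entrywise one.\<close>

definition mat_topology :: "nat \<Rightarrow> nat \<Rightarrow> 'a::topological_space mat topology" where
  "mat_topology m n =
     pullback_topology (carrier_mat m n)
       (\<lambda>A. restrict (\<lambda>p. A $$ p) ({..<m} \<times> {..<n}))
       (product_topology (\<lambda>_. euclidean) ({..<m} \<times> {..<n}))"

definition col_norm :: "'a::real_normed_vector mat \<Rightarrow> nat \<Rightarrow> real" where
  "col_norm F j = L2_set (\<lambda>i. norm (F $$ (i, j))) {..<dim_row F}"

definition enp_frames :: "nat \<Rightarrow> nat \<Rightarrow> 'a::{conjugatable_field, real_normed_field} mat set" where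
  "enp_frames d n = {F \<in> carrier_mat d n. F * mat_adjoint F = 1\<^sub>m d \<and>
     (\<forall>j<n. \<forall>k<n. col_norm F j = col_norm F k)}"

definition enp_frame_space ::
  "nat \<Rightarrow> nat \<Rightarrow> 'a::{conjugatable_field, real_normed_field} mat topology" where
  "enp_frame_space d n = subtopology (mat_topology d n) (enp_frames d n)"

end

theory Submission
  imports Defs
begin

text \<open>
  After rescaling, an equal norm Parseval frame is a tuple of \<open>n\<close> unit vectors \<open>v\<^sub>i\<close> of \<open>K\<^sup>d\<close> with
  \<open>\<Sum>\<^sub>i v\<^sub>i v\<^sub>i\<^sup>* = (n/d) I\<close>; such a tuple is called tight below.  A map of the \<open>q\<close>-cube into
  the tight tuples that is constant on the boundary has to be contracted through tight tuples.

  Without tightness this is easy: the tuples of unit vectors form a product of spheres of real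
  dimension \<open>DIM('a) * d - 1 \<ge> q + 1\<close>, so there is a null homotopy through unit tuples
  (\<open>sphere_null_homotopy\<close>).  It is a map of the \<open>(q + 1)\<close>-cube that is tight on the boundary, but
  whose values inside are unknown.

  The way back to tight tuples is radial isotropic position.  Call a tuple stable if every
  hyperplane contains fewer than \<open>n/d\<close> of its vectors.  For a stable tuple \<open>v\<close> of unit vectors there
  is a positive definite \<open>P\<close> such that the vectors \<open>P v\<^sub>i / |P v\<^sub>i|\<close> form a tight tuple
  (\<open>tight_scaling_exists\<close>): a maximiser of \<open>|det g|\<^sup>n / (\<Prod>\<^sub>i |g v\<^sub>i|)\<^sup>d\<close> provides it, and stability is
  what makes the maximum exist.  The resulting tuple is unique (\<open>tight_action_unique\<close>), so by
  compactness it depends continuously on stable \<open>v\<close> (\<open>tight_action_sequence\<close>).  Tight tuples need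
  not be stable, for instance \<open>n/d\<close> copies of an orthonormal basis are not, and near such tuples the
  matrices \<open>P\<close>, scaled to norm one, may tend to a singular matrix, which ends the compactness
  argument.  Instead, \<open>tight_action_estimate\<close> bounds the square of the distance by which
  the rescaling moves a vector \<open>v\<^sub>i\<close> by twice the entrywise distance of \<open>\<Sum>\<^sub>i v\<^sub>i v\<^sub>i\<^sup>*\<close> from \<open>(n/d) I\<close>.
  So there is a retraction \<open>tighten\<close>, continuous on the union of the stable and the tight tuples,
  which fixes the tight ones (\<open>tighten_continuous\<close>).

  It remains to make the null homotopy stable inside the \<open>(q + 1)\<close>-cube without changing it on the
  boundary (\<open>stable_extension\<close>).  It is replaced by an interpolation on grids that become finer
  towards the boundary, with generically perturbed values at the nodes.  At most \<open>2 (q + 2)\<close> nodes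
  are active at an interior point, so a linear functional on \<open>K\<^sup>d\<close> restricts to the interpolated
  vectors through at most \<open>2 (q + 2) d\<close> coefficients, and genericity forces it to be nonzero on all
  but fewer than that many vectors.  Hence the interpolated tuple is stable once \<open>n \<ge> 2 d\<^sup>2 (q + 2)\<close>;
  this is where \<open>n\<close> has to be large.  Applying \<open>tighten\<close> to the result gives the null homotopy.
\<close>

section \<open>Real and complex scalars\<close>

text \<open>Since \<open>DIM('a)\<close> is the real dimension of the field, both hypotheses on the dimension read \<open>q + 2 \<le> DIM('a) * d\<close>.\<close>
class rc_scalar = conjugatable_field + real_normed_field + euclidean_space +
  assumes conj_mult_self_scaleR: "conjugate z * z = (norm z)\<^sup>2 *\<^sub>R 1"

instance real :: rc_scalar
  by standard (simp add: power2_eq_square)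

instance complex :: rc_scalar
proof
  show "conjugate z * z = (norm z)\<^sup>2 *\<^sub>R 1" for z :: complex
    unfolding conjugate_complex_def scaleR_conv_of_real complex_norm_square by (simp only: mult.commute mult_1_left)
qed

lemma conj_mult_self: "conjugate z * z = of_real ((norm z)\<^sup>2)" for z :: "'a::rc_scalar"
  by (simp add: conj_mult_self_scaleR of_real_def)

lemma mult_conj_self: "z * conjugate z = of_real ((norm z)\<^sup>2)" for z :: "'a::rc_scalar"
  by (metis conj_mult_self mult.commute)

lemma conj_zero [simp]: "conjugate (0::'a::rc_scalar) = 0"
  by simp

lemma conj_one [simp]: "conjugate (1::'a::rc_scalar) = 1"
  using conj_mult_self[of "1::'a"] by simp

lemma norm_conj [simp]: "norm (conjugate z) = norm z" for z :: "'a::rc_scalar"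
proof (cases "z = 0")
  case False
  have "norm (conjugate z) * norm z = norm z * norm z"
    by (metis conj_mult_self norm_mult norm_of_real abs_norm_cancel power2_eq_square)
  then show ?thesis using False by simp
qed simp

lemma inner_conj: "of_real (2 * inner z w) = z * conjugate w + w * conjugate z" for z w :: "'a::rc_scalar"
proof -
  have "of_real ((norm (z + w))\<^sup>2) = (z + w) * conjugate (z + w)"
    by (simp only: mult_conj_self)
  also have "\<dots> = z * conjugate z + w * conjugate w + (z * conjugate w + w * conjugate z)"
    by (simp add: conjugate_dist_add algebra_simps)
  also have "z * conjugate z + w * conjugate w = of_real ((norm z)\<^sup>2 + (norm w)\<^sup>2)"
    by (simp add: mult_conj_self)
  finally have "of_real ((norm (z + w))\<^sup>2) - of_real ((norm z)\<^sup>2 + (norm w)\<^sup>2) =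
      z * conjugate w + w * conjugate z" by simp
  moreover have "(norm (z + w))\<^sup>2 - ((norm z)\<^sup>2 + (norm w)\<^sup>2) = 2 * inner z w"
    by (simp add: power2_norm_eq_inner inner_add inner_commute)
  ultimately show ?thesis by (metis of_real_diff)
qed

lemma conj_scaleR: "conjugate (r *\<^sub>R z) = r *\<^sub>R conjugate z" for z :: "'a::rc_scalar"
proof (cases "r = 0")
  case False
  have "conjugate (of_real r :: 'a) * of_real r = of_real r * of_real r"
    by (subst conj_mult_self) (simp add: power2_eq_square)
  then have "conjugate (of_real r :: 'a) = of_real r" using False by simp
  then show ?thesis by (simp add: scaleR_conv_of_real conjugate_dist_mul)
qed simp

lemma conj_of_real [simp]: "conjugate (of_real r :: 'a::rc_scalar) = of_real r"
  by (simp add: of_real_def conj_scaleR)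

lemma conj_sum: "conjugate (sum f S) = (\<Sum>x\<in>S. conjugate (f x :: 'a::rc_scalar))"
  by (induction S rule: infinite_finite_induct) (simp_all add: conjugate_dist_add)

lemma conj_linear: "bounded_linear (conjugate :: 'a::rc_scalar \<Rightarrow> 'a)"
  by (rule bounded_linear_intro[of _ 1]) (simp_all add: conjugate_dist_add conj_scaleR)

lemmas tendsto_conj [tendsto_intros] = bounded_linear.tendsto[OF conj_linear]
lemmas continuous_on_conj [continuous_intros] = bounded_linear.continuous_on[OF conj_linear]

lemma inner_mult_left_conj: "inner (w * z) y = inner z (conjugate w * y)" for z y w :: "'a::rc_scalar"
proof -
  have "(of_real (2 * inner (w * z) y) :: 'a) = of_real (2 * inner z (conjugate w * y))"
    unfolding inner_conj by (simp add: conjugate_dist_mul algebra_simps)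
  then show ?thesis using of_real_eq_iff by fastforce
qed

lemma inner_of_real_left: "inner (of_real r * z) y = r * inner z y" for z y :: "'a::rc_scalar"
  by (metis inner_scaleR_left scaleR_conv_of_real)

section \<open>Matrices, determinants and adjugates\<close>

text \<open>Vectors and matrices are functions on indices: convergence is then entrywise, and indices from
  \<open>d\<close> on are ignored.\<close>
definition app :: "nat \<Rightarrow> (nat \<Rightarrow> nat \<Rightarrow> 'a) \<Rightarrow> (nat \<Rightarrow> 'a) \<Rightarrow> nat \<Rightarrow> 'a::comm_ring_1" where
  "app d g x a = (\<Sum>b<d. g a b * x b)"

definition mmul :: "nat \<Rightarrow> (nat \<Rightarrow> nat \<Rightarrow> 'a) \<Rightarrow> (nat \<Rightarrow> nat \<Rightarrow> 'a) \<Rightarrow> nat \<Rightarrow> nat \<Rightarrow> 'a::comm_ring_1" where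
  "mmul d g h a b = (\<Sum>c<d. g a c * h c b)"

definition dt :: "nat \<Rightarrow> (nat \<Rightarrow> nat \<Rightarrow> 'a) \<Rightarrow> 'a::comm_ring_1" where
  "dt d g = det (mat d d (\<lambda>(a, b). g a b))"

definition adjugate :: "nat \<Rightarrow> (nat \<Rightarrow> nat \<Rightarrow> 'a) \<Rightarrow> nat \<Rightarrow> nat \<Rightarrow> 'a::comm_ring_1" where
  "adjugate d g a b = adj_mat (mat d d (\<lambda>(a, b). g a b)) $$ (a, b)"

abbreviation idm :: "nat \<Rightarrow> nat \<Rightarrow> 'a::comm_ring_1" where
  "idm \<equiv> (\<lambda>a b. if a = b then 1 else 0)"

lemma mat_mmul: "mat d d (\<lambda>(a, b). mmul d g h a b) = mat d d (\<lambda>(a, b). g a b) * mat d d (\<lambda>(a, b). h a b)"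
  by (rule eq_matI) (auto simp: mmul_def scalar_prod_def lessThan_atLeast0)

lemma dt_mmul: "dt d (mmul d g h) = dt d g * dt d h"
  unfolding dt_def mat_mmul by (rule det_mult) auto

lemma app_mmul: "app d (mmul d g h) x a = app d g (app d h x) a"
  unfolding app_def mmul_def sum_distrib_left sum_distrib_right
  by (subst sum.swap) (simp add: mult.assoc)

lemma adjugate_mult:
  assumes "a < d" "b < d"
  shows "mmul d g (adjugate d g) a b = (if a = b then dt d g else 0)"
    and "mmul d (adjugate d g) g a b = (if a = b then dt d g else 0)"
proof -
  let ?G = "mat d d (\<lambda>(a, b). g a b)"
  have G: "?G \<in> carrier_mat d d" by simp
  note adj = adj_mat[OF G]
  have c: "adj_mat ?G \<in> carrier_mat d d" by (rule adj(1))
  have "mmul d g (adjugate d g) a b = (?G * adj_mat ?G) $$ (a, b)"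
    using c assms by (auto simp: mmul_def adjugate_def scalar_prod_def lessThan_atLeast0)
  then show "mmul d g (adjugate d g) a b = (if a = b then dt d g else 0)"
    unfolding adj(2) using assms by (simp add: dt_def)
  have "mmul d (adjugate d g) g a b = (adj_mat ?G * ?G) $$ (a, b)"
    using c assms by (auto simp: mmul_def adjugate_def scalar_prod_def lessThan_atLeast0)
  then show "mmul d (adjugate d g) g a b = (if a = b then dt d g else 0)"
    unfolding adj(3) using assms by (simp add: dt_def)
qed

lemma app_idm: "a < d \<Longrightarrow> (\<Sum>b<d. (if a = b then c else 0) * x b) = c * x a" for c :: "'a::comm_ring_1" and d :: nat
  by (subst sum.mono_neutral_right[of _ "{a}"]) auto

lemma app_adjugate: "a < d \<Longrightarrow> app d (adjugate d g) (app d g x) a = dt d g * x a"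
  unfolding app_mmul[symmetric] by (simp add: app_def adjugate_mult app_idm)

lemma app_adjugate_right: "a < d \<Longrightarrow> app d g (app d (adjugate d g) x) a = dt d g * x a"
  unfolding app_mmul[symmetric] by (simp add: app_def adjugate_mult app_idm)

lemma dt_zero_kernel:
  fixes g :: "nat \<Rightarrow> nat \<Rightarrow> 'a::field"
  assumes "dt d g = 0"
  obtains x where "\<exists>a<d. x a \<noteq> 0" "\<And>a. a < d \<Longrightarrow> app d g x a = 0"
proof -
  let ?G = "mat d d (\<lambda>(a, b). g a b)"
  obtain v where v: "v \<in> carrier_vec d" "v \<noteq> 0\<^sub>v d" "?G *\<^sub>v v = 0\<^sub>v d"
    using assms det_0_iff_vec_prod_zero[of ?G d] unfolding dt_def by auto
  have 1: "\<exists>a<d. vec_index v a \<noteq> 0"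
    using v by (metis carrier_vecD eq_vecI index_zero_vec(1) zero_carrier_vec)
  have 2: "app d g (\<lambda>a. vec_index v a) a = 0" if "a < d" for a
  proof -
    have "app d g (\<lambda>a. vec_index v a) a = (?G *\<^sub>v v) $ a"
      using that v(1) by (simp add: app_def mult_mat_vec_def scalar_prod_def lessThan_atLeast0)
    then show ?thesis using v(3) that by simp
  qed
  show ?thesis using that 1 2 by blast
qed

lemma dt_inverse:
  fixes g :: "nat \<Rightarrow> nat \<Rightarrow> 'a::field"
  assumes "dt d g \<noteq> 0"
  obtains k where "\<And>x a. a < d \<Longrightarrow> app d k (app d g x) a = x a"
    "\<And>x a. a < d \<Longrightarrow> app d g (app d k x) a = x a"
proof -
  define k where "k = (\<lambda>a b. adjugate d g a b / dt d g)"
  have e: "app d k x a = app d (adjugate d g) x a / dt d g" for x a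
    by (simp add: app_def k_def sum_divide_distrib)
  have 1: "app d k (app d g x) a = x a" if "a < d" for x a
    using app_adjugate[OF that, of g x] assms by (simp add: e)
  have "app d g (app d k x) a = app d g (app d (adjugate d g) x) a / dt d g" for x a
    unfolding app_def k_def by (simp add: sum_distrib_left sum_divide_distrib sum_distrib_right mult_ac)
  then have 2: "app d g (app d k x) a = x a" if "a < d" for x a
    using app_adjugate_right[OF that, of g x] assms by simp
  show ?thesis using that 1 2 by blast
qed

lemma tendsto_dt:
  fixes g :: "'b \<Rightarrow> nat \<Rightarrow> nat \<Rightarrow> 'a::real_normed_field"
  assumes "\<And>a b. a < d \<Longrightarrow> b < d \<Longrightarrow> ((\<lambda>m. g m a b) \<longlongrightarrow> g' a b) F"
  shows "((\<lambda>m. dt d (g m)) \<longlongrightarrow> dt d g') F"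
proof -
  have e: "dt d h = (\<Sum>p\<in>{p. p permutes {0..<d}}. signof p * (\<Prod>i=0..<d. h i (p i)))" for h :: "nat \<Rightarrow> nat \<Rightarrow> 'a"
    unfolding dt_def
    by (subst det_def'[of _ d]) (auto intro!: sum.cong prod.cong simp: permutes_in_image)
  have "((\<lambda>m. \<Prod>i=0..<d. g m i (p i)) \<longlongrightarrow> (\<Prod>i=0..<d. g' i (p i))) F" if "p permutes {0..<d}" for p
    using that assms by (intro tendsto_prod) (auto simp: permutes_in_image)
  then show ?thesis unfolding e by (intro tendsto_sum tendsto_mult tendsto_const) auto
qed

lemma tendsto_adjugate:
  fixes g :: "'b \<Rightarrow> nat \<Rightarrow> nat \<Rightarrow> 'a::real_normed_field"
  assumes "\<And>a b. a < d \<Longrightarrow> b < d \<Longrightarrow> ((\<lambda>m. g m a b) \<longlongrightarrow> g' a b) F" and ab: "a < d" "b < d"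
  shows "((\<lambda>m. adjugate d (g m) a b) \<longlongrightarrow> adjugate d g' a b) F"
proof -
  define r where "r = (\<lambda>i. if i < b then i else Suc i)"
  define s where "s = (\<lambda>j. if j < a then j else Suc j)"
  have e: "adjugate d h a b = (-1) ^ (b + a) * dt (d - 1) (\<lambda>i j. h (r i) (s j))" for h :: "nat \<Rightarrow> nat \<Rightarrow> 'a"
  proof -
    have "mat_delete (mat d d (\<lambda>(a, b). h a b)) b a = mat (d - 1) (d - 1) (\<lambda>(i, j). h (r i) (s j))"
      using ab by (intro eq_matI) (auto simp: mat_delete_def r_def s_def)
    then show ?thesis using ab by (simp add: adjugate_def adj_mat_def cofactor_def dt_def)
  qed
  show ?thesis unfolding e
    by (intro tendsto_intros tendsto_dt assms) (use ab in \<open>auto simp: r_def s_def\<close>)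
qed

section \<open>Inner products and positive semidefinite matrices\<close>

text \<open>\<open>ip\<close> is the real inner product, used for quadratic forms and first order conditions; \<open>hp\<close> is
  the scalar valued one, whose kernels are the hyperplanes over the field.\<close>
definition ip :: "nat \<Rightarrow> (nat \<Rightarrow> 'a::real_inner) \<Rightarrow> (nat \<Rightarrow> 'a) \<Rightarrow> real" where
  "ip d x y = (\<Sum>a<d. inner (x a) (y a))"

definition nsq :: "nat \<Rightarrow> (nat \<Rightarrow> 'a::real_normed_vector) \<Rightarrow> real" where
  "nsq d x = (\<Sum>a<d. (norm (x a))\<^sup>2)"

definition hp :: "nat \<Rightarrow> (nat \<Rightarrow> 'a) \<Rightarrow> (nat \<Rightarrow> 'a) \<Rightarrow> 'a::rc_scalar" where
  "hp d x y = (\<Sum>a<d. x a * conjugate (y a))"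

lemma ip_self: "ip d x x = nsq d x"
  by (simp add: ip_def nsq_def power2_norm_eq_inner)

lemma nsq_nonneg [simp]: "nsq d x \<ge> 0"
  by (simp add: nsq_def sum_nonneg)

lemma nsq_eq_0_iff: "nsq d x = 0 \<longleftrightarrow> (\<forall>a<d. x a = 0)"
  by (auto simp: nsq_def sum_nonneg_eq_0_iff)

lemma nsq_pos_iff: "nsq d x > 0 \<longleftrightarrow> (\<exists>a<d. x a \<noteq> 0)"
  using nsq_eq_0_iff[of d x] nsq_nonneg[of d x] by (auto simp: less_le)

lemma ip_commute: "ip d x y = ip d y x"
  by (simp add: ip_def inner_commute)

lemma ip_add_left: "ip d (\<lambda>a. x a + y a) z = ip d x z + ip d y z"
  by (simp add: ip_def inner_add_left sum.distrib)

lemma ip_add_right: "ip d z (\<lambda>a. x a + y a) = ip d z x + ip d z y"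
  by (simp add: ip_def inner_add_right sum.distrib)

lemma ip_diff_left: "ip d (\<lambda>a. x a - y a) z = ip d x z - ip d y z"
  by (simp add: ip_def inner_diff_left sum_subtractf)

lemma ip_diff_right: "ip d z (\<lambda>a. x a - y a) = ip d z x - ip d z y"
  by (simp add: ip_def inner_diff_right sum_subtractf)

lemma ip_scale_left: "ip d (\<lambda>a. r *\<^sub>R x a) z = r * ip d x z"
  by (simp add: ip_def sum_distrib_left)

lemma ip_scale_right: "ip d z (\<lambda>a. r *\<^sub>R x a) = r * ip d z x"
  by (simp add: ip_def sum_distrib_left)

lemmas ip_linear = ip_add_left ip_add_right ip_diff_left ip_diff_right ip_scale_left ip_scale_right

lemma ip_cong: "(\<And>a. a < d \<Longrightarrow> x a = x' a) \<Longrightarrow> (\<And>a. a < d \<Longrightarrow> y a = y' a) \<Longrightarrow> ip d x y = ip d x' y'"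
  by (simp add: ip_def)

lemma nsq_cong: "(\<And>a. a < d \<Longrightarrow> x a = x' a) \<Longrightarrow> nsq d x = nsq d x'"
  by (simp add: nsq_def)

lemma nsq_scale: "nsq d (\<lambda>a. r *\<^sub>R x a) = r\<^sup>2 * nsq d x"
  by (simp add: nsq_def power_mult_distrib sum_distrib_left)

lemma nsq_mult: "nsq d (\<lambda>a. c * x a) = (norm c)\<^sup>2 * nsq d x" for x :: "nat \<Rightarrow> 'a::rc_scalar"
  by (simp add: nsq_def norm_mult power_mult_distrib sum_distrib_left)

lemma app_add: "app d g (\<lambda>a. x a + y a) = (\<lambda>a. app d g x a + app d g y a)"
  by (simp add: fun_eq_iff app_def distrib_left sum.distrib)

lemma app_diff: "app d g (\<lambda>a. x a - y a) = (\<lambda>a. app d g x a - app d g y a)"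
  by (simp add: fun_eq_iff app_def right_diff_distrib sum_subtractf)

lemma app_scale: "app d g (\<lambda>a. r *\<^sub>R x a) = (\<lambda>a. r *\<^sub>R app d g x a)"
  for g :: "nat \<Rightarrow> nat \<Rightarrow> 'a::rc_scalar"
  by (simp add: fun_eq_iff app_def scaleR_sum_right)

lemma app_mult: "app d g (\<lambda>a. c * x a) = (\<lambda>a. c * app d g x a)"
  by (simp add: fun_eq_iff app_def sum_distrib_left mult_ac)

lemma app_cong: "(\<And>a. a < d \<Longrightarrow> x a = x' a) \<Longrightarrow> app d g x = app d g x'"
  by (simp add: app_def fun_eq_iff)

text \<open>The discriminant of a nonnegative quadratic polynomial; if \<open>C = 0\<close>, a nonzero linear term would
  make the polynomial negative somewhere.\<close>
lemma semi_Cauchy_Schwarz: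
  fixes A B C :: real
  assumes "\<And>t. A + 2 * t * B + t\<^sup>2 * C \<ge> 0" "C \<ge> 0"
  shows "B\<^sup>2 \<le> A * C"
proof (cases "C = 0")
  case False
  have "A + 2 * (- B / C) * B + (- B / C)\<^sup>2 * C \<ge> 0" by (rule assms(1))
  then have "A - B\<^sup>2 / C \<ge> 0" using False by (simp add: power2_eq_square field_simps)
  then show ?thesis using False assms(2) by (simp add: field_simps)
next
  case True
  have "B = 0"
  proof (rule ccontr)
    assume "B \<noteq> 0"
    have "A + 2 * (- (A + 1) / (2 * B)) * B + (- (A + 1) / (2 * B))\<^sup>2 * C \<ge> 0" by (rule assms(1))
    then show False using True \<open>B \<noteq> 0\<close> by (simp add: field_simps)
  qed
  then show ?thesis using True by simp
qed

definition selfadj :: "nat \<Rightarrow> (nat \<Rightarrow> nat \<Rightarrow> 'a::rc_scalar) \<Rightarrow> bool" where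
  "selfadj d P \<longleftrightarrow> (\<forall>a<d. \<forall>b<d. P a b = conjugate (P b a))"

definition psd :: "nat \<Rightarrow> (nat \<Rightarrow> nat \<Rightarrow> 'a::rc_scalar) \<Rightarrow> bool" where
  "psd d P \<longleftrightarrow> selfadj d P \<and> (\<forall>x. ip d (app d P x) x \<ge> 0)"

lemma hp_app_adj: "hp d (app d g x) y = hp d x (app d (\<lambda>a b. conjugate (g b a)) y)"
proof -
  have "hp d (app d g x) y = (\<Sum>a<d. \<Sum>b<d. g a b * x b * conjugate (y a))"
    by (simp add: hp_def app_def sum_distrib_right)
  also have "\<dots> = (\<Sum>b<d. \<Sum>a<d. g a b * x b * conjugate (y a))" by (rule sum.swap)
  also have "\<dots> = hp d x (app d (\<lambda>a b. conjugate (g b a)) y)"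
    by (simp add: hp_def app_def conj_sum conjugate_dist_mul sum_distrib_left mult_ac)
  finally show ?thesis .
qed

lemma ip_hp: "of_real (2 * ip d x y) = hp d x y + conjugate (hp d x y)" for x :: "nat \<Rightarrow> 'a::rc_scalar"
proof -
  have "of_real (2 * ip d x y) = (\<Sum>a<d. of_real (2 * inner (x a) (y a)) :: 'a)"
    by (simp add: ip_def sum_distrib_left)
  also have "\<dots> = hp d x y + conjugate (hp d x y)"
    unfolding inner_conj by (simp add: hp_def conj_sum conjugate_dist_mul sum.distrib mult_ac)
  finally show ?thesis .
qed

lemma ip_eq_of_hp: "hp d x y = hp d x' y' \<Longrightarrow> ip d x y = ip d x' y'" for x :: "nat \<Rightarrow> 'a::rc_scalar"
proof -
  assume "hp d x y = hp d x' y'"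
  then have "(of_real (2 * ip d x y) :: 'a) = of_real (2 * ip d x' y')" by (simp only: ip_hp)
  then show ?thesis using of_real_eq_iff by fastforce
qed

lemma hp_self: "hp d x x = of_real (nsq d x)"
  by (simp add: hp_def nsq_def mult_conj_self)

lemma hp_selfadj: "selfadj d P \<Longrightarrow> hp d (app d P x) y = hp d x (app d P y)"
proof -
  assume P: "selfadj d P"
  have "app d (\<lambda>a b. conjugate (P b a)) y a = app d P y a" if "a < d" for a
    unfolding app_def
  proof (rule sum.cong[OF refl])
    fix b assume "b \<in> {..<d}"
    then have "P a b = conjugate (P b a)" using P that unfolding selfadj_def by blast
    then show "conjugate (P b a) * y b = P a b * y b" by (simp only:)
  qed
  then show ?thesis unfolding hp_app_adj unfolding hp_def by (intro sum.cong refl) (simp only: lessThan_iff)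
qed

lemma ip_selfadj: "selfadj d P \<Longrightarrow> ip d (app d P x) y = ip d x (app d P y)"
  by (rule ip_eq_of_hp) (rule hp_selfadj)

lemma ip_Cauchy_Schwarz: "(ip d x y)\<^sup>2 \<le> nsq d x * nsq d y"
proof (rule semi_Cauchy_Schwarz)
  fix t
  have "nsq d (\<lambda>a. x a + t *\<^sub>R y a) = nsq d x + 2 * t * ip d x y + t\<^sup>2 * nsq d y"
    unfolding ip_self[symmetric] ip_linear by (simp add: ip_commute[of d y x] power2_eq_square algebra_simps)
  then show "nsq d x + 2 * t * ip d x y + t\<^sup>2 * nsq d y \<ge> 0"
    using nsq_nonneg[of d "\<lambda>a. x a + t *\<^sub>R y a"] by simp
qed simp

lemma psd_Cauchy_Schwarz:
  assumes "psd d P"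
  shows "(ip d (app d P x) y)\<^sup>2 \<le> ip d (app d P x) x * ip d (app d P y) y"
proof (rule semi_Cauchy_Schwarz)
  fix t
  have s: "ip d (app d P y) x = ip d (app d P x) y"
    using assms ip_selfadj[of d P y x] ip_commute[of d y "app d P x"] by (simp add: psd_def)
  have "ip d (app d P (\<lambda>a. x a + t *\<^sub>R y a)) (\<lambda>a. x a + t *\<^sub>R y a) =
     ip d (app d P x) x + 2 * t * ip d (app d P x) y + t\<^sup>2 * ip d (app d P y) y"
    unfolding app_add app_scale ip_linear by (simp add: s power2_eq_square algebra_simps)
  moreover have "ip d (app d P (\<lambda>a. x a + t *\<^sub>R y a)) (\<lambda>a. x a + t *\<^sub>R y a) \<ge> 0"
    using assms unfolding psd_def by blast
  ultimately show "ip d (app d P x) x + 2 * t * ip d (app d P x) y + t\<^sup>2 * ip d (app d P y) y \<ge> 0"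
    by simp
qed (use assms in \<open>simp add: psd_def\<close>)

text \<open>Cauchy-Schwarz for the form of \<open>P\<close>: an isotropic vector is orthogonal to everything.\<close>
lemma psd_kernel:
  assumes "psd d P" "ip d (app d P x) x = 0" "a < d"
  shows "app d P x a = 0"
proof -
  have "(ip d (app d P x) (app d P x))\<^sup>2 \<le> 0"
    using psd_Cauchy_Schwarz[OF assms(1), of x "app d P x"] unfolding assms(2) mult_zero_left .
  then have "nsq d (app d P x) = 0" unfolding ip_self power2_less_eq_zero_iff .
  then show ?thesis using assms(3) unfolding nsq_eq_0_iff by blast
qed

lemma norm_hp_le: "(norm (hp d x y))\<^sup>2 \<le> nsq d x * nsq d y"
proof (cases "hp d x y = 0")
  case False
  define c where "c = conjugate (hp d x y)"
  have 1: "hp d (\<lambda>a. c * x a) y = of_real ((norm (hp d x y))\<^sup>2)"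
    unfolding conj_mult_self[symmetric] c_def[symmetric] by (simp add: hp_def sum_distrib_left mult.assoc)
  have "(of_real (2 * ip d (\<lambda>a. c * x a) y) :: 'a) = of_real (2 * (norm (hp d x y))\<^sup>2)"
    unfolding ip_hp 1 conj_of_real of_real_add[symmetric] by (simp only: mult_2)
  then have "ip d (\<lambda>a. c * x a) y = (norm (hp d x y))\<^sup>2"
    unfolding of_real_eq_iff by simp
  then have "((norm (hp d x y))\<^sup>2)\<^sup>2 \<le> (norm c)\<^sup>2 * nsq d x * nsq d y"
    using ip_Cauchy_Schwarz[of d "\<lambda>a. c * x a" y] by (simp add: nsq_mult)
  then have "(norm (hp d x y))\<^sup>2 * (norm (hp d x y))\<^sup>2 \<le> (norm (hp d x y))\<^sup>2 * (nsq d x * nsq d y)"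
    by (simp add: c_def power2_eq_square mult_ac)
  moreover have "(norm (hp d x y))\<^sup>2 > 0" using False by simp
  ultimately show ?thesis by (rule mult_left_le_imp_le)
qed (simp add: zero_le_mult_iff)

section \<open>Tight and stable tuples\<close>

definition gram :: "nat \<Rightarrow> (nat \<Rightarrow> nat \<Rightarrow> 'a) \<Rightarrow> nat \<Rightarrow> nat \<Rightarrow> 'a::rc_scalar" where
  "gram n v a b = (\<Sum>i<n. v i a * conjugate (v i b))"

definition tight :: "nat \<Rightarrow> nat \<Rightarrow> (nat \<Rightarrow> nat \<Rightarrow> 'a::rc_scalar) \<Rightarrow> bool" where
  "tight d n v \<longleftrightarrow> (\<forall>a<d. \<forall>b<d. gram n v a b = (if a = b then of_real (real n / real d) else 0))"

text \<open>A nonzero \<open>f\<close> stands for the hyperplane orthogonal to it, which may contain fewer than \<open>n/d\<close>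
  of the vectors.\<close>
definition stable :: "nat \<Rightarrow> nat \<Rightarrow> (nat \<Rightarrow> nat \<Rightarrow> 'a::rc_scalar) \<Rightarrow> bool" where
  "stable d n v \<longleftrightarrow> (\<forall>f. (\<exists>a<d. f a \<noteq> 0) \<longrightarrow> d * card {i. i < n \<and> hp d f (v i) = 0} < n)"

definition normalised :: "nat \<Rightarrow> (nat \<Rightarrow> 'a) \<Rightarrow> nat \<Rightarrow> 'a::real_normed_vector" where
  "normalised d x = (\<lambda>a. (1 / sqrt (nsq d x)) *\<^sub>R x a)"

lemma nsq_normalised: "nsq d x \<noteq> 0 \<Longrightarrow> nsq d (normalised d x) = 1"
  using nsq_nonneg[of d x] by (simp add: normalised_def nsq_scale power_divide)

lemma sum_norm_hp_gram: "of_real (\<Sum>i<n. (norm (hp d f (v i)))\<^sup>2) = (\<Sum>a<d. \<Sum>b<d. f a * conjugate (f b) * gram n v b a)"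
proof -
  define T where "T = (\<lambda>i a b. f a * conjugate (f b) * (v i b * conjugate (v i a)))"
  have p: "f a * conjugate (v i a) * (conjugate (f b) * v i b) = T i a b" for i a b
    unfolding T_def by (simp only: mult_ac)
  have e: "of_real ((norm (hp d f (v i)))\<^sup>2) = (\<Sum>a<d. \<Sum>b<d. T i a b)" for i
    unfolding mult_conj_self[symmetric] hp_def conj_sum conjugate_dist_mul conjugate_id sum_product p ..
  have "of_real (\<Sum>i<n. (norm (hp d f (v i)))\<^sup>2) = (\<Sum>i<n. \<Sum>a<d. \<Sum>b<d. T i a b)"
    unfolding of_real_sum e ..
  also have "\<dots> = (\<Sum>a<d. \<Sum>i<n. \<Sum>b<d. T i a b)"
    by (rule sum.swap)
  also have "\<dots> = (\<Sum>a<d. \<Sum>b<d. \<Sum>i<n. T i a b)"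
    by (rule sum.cong[OF refl], rule sum.swap)
  also have "\<dots> = (\<Sum>a<d. \<Sum>b<d. f a * conjugate (f b) * gram n v b a)"
    by (simp only: gram_def sum_distrib_left T_def)
  finally show ?thesis .
qed

lemma tightD: "tight d n v \<Longrightarrow> a < d \<Longrightarrow> b < d \<Longrightarrow> gram n v a b = (if a = b then of_real (real n / real d) else 0)"
  unfolding tight_def by (elim allE impE) assumption+

lemma stableD: "stable d n v \<Longrightarrow> \<exists>a<d. f a \<noteq> 0 \<Longrightarrow> d * card {i. i < n \<and> hp d f (v i) = 0} < n"
  unfolding stable_def by (erule allE[of _ f]) (erule (1) mp)

text \<open>The form in which tightness enters the uniqueness proof and the exclusion of singular limits.\<close>
lemma tight_frame_identity:
  assumes "tight d n v"
  shows "(\<Sum>i<n. (norm (hp d f (v i)))\<^sup>2) = real n / real d * nsq d f"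
proof -
  have "f a * conjugate (f b) * gram n v b a = (if b = a then f a * conjugate (f b) * of_real (real n / real d) else 0)"
    if "a < d" "b < d" for a b
  proof -
    have "gram n v b a = (if b = a then of_real (real n / real d) else 0)"
      by (rule tightD[OF assms that(2) that(1)])
    then show ?thesis by (cases "b = a") (simp_all only: if_True if_False mult_zero_right refl)
  qed
  then have 2: "(\<Sum>a<d. \<Sum>b<d. f a * conjugate (f b) * gram n v b a) =
    (\<Sum>a<d. \<Sum>b<d. if b = a then f a * conjugate (f b) * of_real (real n / real d) else 0)"
    by (intro sum.cong refl) auto
  have 3: "(\<Sum>a<d. \<Sum>b<d. if b = a then f a * conjugate (f b) * of_real (real n / real d) else 0) =
    of_real (real n / real d * nsq d f)"
    by (simp add: mult_conj_self nsq_def sum_distrib_left mult.commute)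
  show ?thesis
    using sum_norm_hp_gram[of d f v n] unfolding 2 3 of_real_eq_iff .
qed

section \<open>How far a tight rescaling moves the vectors\<close>

definition pd :: "nat \<Rightarrow> (nat \<Rightarrow> nat \<Rightarrow> 'a::rc_scalar) \<Rightarrow> bool" where
  "pd d P \<longleftrightarrow> psd d P \<and> dt d P \<noteq> 0"

definition act :: "nat \<Rightarrow> (nat \<Rightarrow> nat \<Rightarrow> 'a::rc_scalar) \<Rightarrow> (nat \<Rightarrow> nat \<Rightarrow> 'a) \<Rightarrow> nat \<Rightarrow> nat \<Rightarrow> 'a" where
  "act d P v i = normalised d (app d P (v i))"

lemma log_convex_step:
  fixes x y p q :: real
  assumes "x\<^sup>2 \<le> p * y" "y\<^sup>2 \<le> x * q" "p \<ge> 0" "q \<ge> 0" "x \<ge> 0" "y \<ge> 0"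
  shows "x * y \<le> p * q"
proof (cases "x * y = 0")
  case True
  then show ?thesis using assms(3,4) mult_nonneg_nonneg[of p q] by linarith
next
  case False
  have "x\<^sup>2 * y\<^sup>2 \<le> (p * y) * (x * q)" using assms by (intro mult_mono) auto
  then have "(x * y) * (x * y) \<le> (x * y) * (p * q)" by (simp add: power2_eq_square mult_ac)
  moreover have "x * y > 0" using False assms by (simp add: less_le)
  ultimately show ?thesis by (rule mult_left_le_imp_le)
qed

text \<open>The numbers \<open>a\<^sub>j\<close> stand for the moments \<open>\<langle>P\<^sup>j y, y\<rangle>\<close> of a positive semidefinite \<open>P\<close>, and
  the hypotheses for the Cauchy-Schwarz inequalities between them.  After expansion the claim splits
  into \<open>a\<^sub>2 a\<^sub>3 \<le> a\<^sub>1 a\<^sub>4\<close>, \<open>a\<^sub>2\<^sup>2 \<le> a\<^sub>0 a\<^sub>4\<close> and \<open>a\<^sub>1 a\<^sub>2 \<le> a\<^sub>0 a\<^sub>3\<close>.\<close>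
lemma moment_inequality:
  fixes a0 a1 a2 a3 a4 s :: real
  assumes "a0 \<ge> 0" "a1 \<ge> 0" "a2 \<ge> 0" "a3 \<ge> 0" "a4 \<ge> 0" "s \<ge> 0"
    and 1: "a1\<^sup>2 \<le> a0 * a2" and 2: "a2\<^sup>2 \<le> a1 * a3" and 3: "a3\<^sup>2 \<le> a2 * a4" and 4: "a2\<^sup>2 \<le> a0 * a4"
  shows "(a3 + s * a2) * (a2 + 2 * s * a1 + s\<^sup>2 * a0) \<le> (a4 + 2 * s * a3 + s\<^sup>2 * a2) * (a1 + s * a0)"
proof -
  have "a2 * a3 \<le> a1 * a4" using 2 3 assms by (intro log_convex_step) auto
  moreover have "a1 * a2 \<le> a0 * a3" using 1 2 assms by (intro log_convex_step) auto
  then have "s\<^sup>2 * (a1 * a2) \<le> s\<^sup>2 * (a0 * a3)" by (intro mult_left_mono) auto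
  moreover have "s * (a2\<^sup>2) \<le> s * (a0 * a4)" using 4 assms by (intro mult_left_mono) auto
  moreover have "(a4 + 2 * s * a3 + s\<^sup>2 * a2) * (a1 + s * a0) - (a3 + s * a2) * (a2 + 2 * s * a1 + s\<^sup>2 * a0) =
     (a1 * a4 - a2 * a3) + (s * (a0 * a4) - s * a2\<^sup>2) + (s\<^sup>2 * (a0 * a3) - s\<^sup>2 * (a1 * a2))"
    by (simp add: algebra_simps power2_eq_square)
  ultimately show ?thesis by linarith
qed

text \<open>Let \<open>k = (P + s)\<inverse>\<close>, so that \<open>y = k v\<close>.  For \<open>|v| = 1\<close> and \<open>u = P v / |P v|\<close> this says
  \<open>\<langle>u, k u\<rangle> \<le> \<langle>v, k v\<rangle>\<close>: applying \<open>P\<close> turns a vector towards the large eigenvalues of \<open>P\<close>, where \<open>k\<close>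
  is small.  Phrased with \<open>y\<close>, no inverse occurs and both sides are polynomials in the moments of \<open>y\<close>.\<close>
lemma resolvent_monotone:
  assumes P: "psd d P" and s: "s \<ge> 0"
  defines "v \<equiv> \<lambda>y a. app d P y a + s *\<^sub>R y a"
  shows "ip d (app d P (v y)) (app d P y) * nsq d (v y) \<le> nsq d (app d P (v y)) * ip d (v y) y"
proof -
  define y1 where "y1 = app d P y"
  define y2 where "y2 = app d P y1"
  have sa: "selfadj d P" using P by (simp add: psd_def)
  have i20: "ip d y2 y = nsq d y1"
    using ip_selfadj[OF sa, of y1 y] by (simp add: y2_def y1_def ip_self)
  define a0 a1 a2 a3 a4 where "a0 = nsq d y" "a1 = ip d y1 y" "a2 = nsq d y1" "a3 = ip d y2 y1" "a4 = nsq d y2"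
  note as = this
  have Pv: "app d P (v y) = (\<lambda>a. y2 a + s *\<^sub>R y1 a)"
    by (simp add: v_def app_add app_scale y1_def y2_def)
  have v: "v y = (\<lambda>a. y1 a + s *\<^sub>R y a)" by (simp add: v_def y1_def)
  have nonneg: "a0 \<ge> 0" "a1 \<ge> 0" "a2 \<ge> 0" "a3 \<ge> 0" "a4 \<ge> 0"
    using P unfolding as y1_def y2_def psd_def by auto
  have "a1\<^sup>2 \<le> a0 * a2" using ip_Cauchy_Schwarz[of d y1 y] by (simp add: as mult.commute)
  moreover have "a2\<^sup>2 \<le> a1 * a3" using psd_Cauchy_Schwarz[OF P, of y y1] by (simp add: as y1_def[symmetric] y2_def[symmetric] ip_self)
  moreover have "a3\<^sup>2 \<le> a2 * a4" using ip_Cauchy_Schwarz[of d y2 y1] by (simp add: as mult.commute)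
  moreover have "a2\<^sup>2 \<le> a0 * a4" using ip_Cauchy_Schwarz[of d y2 y] by (simp add: as i20 mult.commute)
  ultimately have "(a3 + s * a2) * (a2 + 2 * s * a1 + s\<^sup>2 * a0) \<le> (a4 + 2 * s * a3 + s\<^sup>2 * a2) * (a1 + s * a0)"
    using nonneg s by (intro moment_inequality)
  moreover have "ip d (app d P (v y)) (app d P y) = a3 + s * a2"
    unfolding Pv y1_def[symmetric] ip_linear as ip_self[symmetric] ..
  moreover have "nsq d (v y) = a2 + 2 * s * a1 + s\<^sup>2 * a0"
    unfolding v ip_self[symmetric] ip_linear as ip_commute[of d y y1] by (simp add: power2_eq_square algebra_simps)
  moreover have "nsq d (app d P (v y)) = a4 + 2 * s * a3 + s\<^sup>2 * a2"
    unfolding Pv ip_self[symmetric] ip_linear as ip_commute[of d y1 y2] by (simp add: power2_eq_square algebra_simps)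
  moreover have "ip d (v y) y = a1 + s * a0"
    unfolding v ip_linear as ip_self[symmetric] ..
  ultimately show ?thesis by (simp only:)
qed

text \<open>In the same notation, with the special value \<open>s = |P v|\<close>, the loss
  \<open>\<langle>v, k v\<rangle> - \<langle>u, k u\<rangle>\<close> is exactly \<open>|u - v|\<^sup>2 / (2 s)\<close>.\<close>
lemma resolvent_defect:
  assumes P: "psd d P" and s: "s > 0" and v: "v = (\<lambda>a. app d P y a + s *\<^sub>R y a)"
    and 1: "nsq d v = 1" and s2: "nsq d (app d P v) = s\<^sup>2"
  shows "nsq d (\<lambda>a. (1 / s) *\<^sub>R app d P v a - v a) = 2 * s * (ip d v y - ip d (app d P v) (app d P y) / s\<^sup>2)"
proof -
  define y1 where "y1 = app d P y"
  have sa: "selfadj d P" using P by (simp add: psd_def)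
  have v': "v = (\<lambda>a. y1 a + s *\<^sub>R y a)" by (simp add: v y1_def)
  have "ip d (app d P v) v = ip d (app d P v) y1 + s * ip d (app d P v) y"
    by (subst (2) v') (simp add: ip_linear)
  also have "ip d (app d P v) y = ip d v y1" by (simp add: ip_selfadj[OF sa] y1_def)
  finally have A: "ip d (app d P v) v = ip d (app d P v) y1 + s * ip d v y1" .
  have B: "1 = ip d v y1 + s * ip d v y"
    using 1 unfolding ip_self[symmetric] by (subst (asm) (2) v') (simp add: ip_linear)
  have "nsq d (\<lambda>a. (1 / s) *\<^sub>R app d P v a - v a) =
      (1/s)\<^sup>2 * nsq d (app d P v) - 2 * (1 / s) * ip d (app d P v) v + nsq d v"
    unfolding ip_self[symmetric] ip_linear ip_commute[of d v "app d P v"]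
    by (simp add: power2_eq_square algebra_simps)
  also have "\<dots> = 2 - 2 * (1 / s) * ip d (app d P v) v"
    using s by (simp add: s2 1 power_divide)
  also have "\<dots> = 2 * s * (ip d v y - ip d (app d P v) y1 / s\<^sup>2)"
  proof -
    have C: "ip d v y1 = 1 - s * ip d v y" using B by simp
    show ?thesis unfolding A C using s by (simp add: field_simps power2_eq_square)
  qed
  finally show ?thesis by (simp add: y1_def)
qed

text \<open>The trace of \<open>k\<close> against the Gram matrix, which only depends on the tuple through \<open>gram\<close>.\<close>
lemma sum_ip_app_gram: "(\<Sum>j<n. ip d (w j) (app d k (w j))) = (\<Sum>a<d. \<Sum>b<d. inner (k a b) (gram n w a b))"
proof -
  have e: "inner (w j a) (k a b * w j b) = inner (k a b) (w j a * conjugate (w j b))" for j a b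
    by (metis inner_commute inner_mult_left_conj mult.commute)
  have "(\<Sum>j<n. ip d (w j) (app d k (w j))) = (\<Sum>j<n. \<Sum>a<d. \<Sum>b<d. inner (k a b) (w j a * conjugate (w j b)))"
    by (simp add: ip_def app_def inner_sum_right e)
  also have "\<dots> = (\<Sum>a<d. \<Sum>j<n. \<Sum>b<d. inner (k a b) (w j a * conjugate (w j b)))"
    by (rule sum.swap)
  also have "\<dots> = (\<Sum>a<d. \<Sum>b<d. \<Sum>j<n. inner (k a b) (w j a * conjugate (w j b)))"
    by (rule sum.cong[OF refl], rule sum.swap)
  also have "\<dots> = (\<Sum>a<d. \<Sum>b<d. inner (k a b) (gram n w a b))"
    by (simp only: gram_def inner_sum_right)
  finally show ?thesis .
qed

definition defect :: "nat \<Rightarrow> nat \<Rightarrow> (nat \<Rightarrow> nat \<Rightarrow> 'a::rc_scalar) \<Rightarrow> real" where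
  "defect d n v = (\<Sum>a<d. \<Sum>b<d. norm (gram n v a b - (if a = b then of_real (real n / real d) else 0)))"

lemma nsq_pos_app_pd:
  fixes P :: "nat \<Rightarrow> nat \<Rightarrow> 'a::rc_scalar"
  assumes "dt d P \<noteq> 0" "nsq d x > 0"
  shows "nsq d (app d P x) > 0"
proof (rule ccontr)
  assume "\<not> nsq d (app d P x) > 0"
  then have z: "\<forall>a<d. app d P x a = 0" unfolding nsq_pos_iff by blast
  obtain k where k: "\<And>x a. a < d \<Longrightarrow> app d k (app d P x) a = x a" using dt_inverse[OF assms(1)] by metis
  have "x a = 0" if "a < d" for a
  proof -
    have "app d k (app d P x) a = 0" unfolding app_def[of d k] by (rule sum.neutral) (simp add: z)
    then show ?thesis using k[OF that, of x] by simp
  qed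
  then show False using assms(2) nsq_pos_iff[of d x] by blast
qed

text \<open>Put \<open>u\<^sub>j = P v\<^sub>j / |P v\<^sub>j|\<close>, \<open>s = |P v\<^sub>i|\<close> and \<open>k = (P + s)\<inverse>\<close>.  By \<open>resolvent_defect\<close>,
  \<open>|u\<^sub>i - v\<^sub>i|\<^sup>2\<close> is \<open>2 s\<close> times the \<open>i\<close>-th term of the sum over \<open>j\<close> of \<open>\<langle>v\<^sub>j, k v\<^sub>j\<rangle> - \<langle>u\<^sub>j, k u\<^sub>j\<rangle>\<close>, and by
  \<open>resolvent_monotone\<close> all terms are nonnegative, so the whole sum may be taken.  It is the trace of
  \<open>k\<close> against the difference of the Gram matrices, and that of \<open>u\<close> is \<open>(n/d) I\<close>.  Finally
  \<open>s |k| \<le> 1\<close>, so no constant depending on \<open>P\<close> is left.\<close>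
lemma tight_action_estimate:
  fixes P :: "nat \<Rightarrow> nat \<Rightarrow> 'a::rc_scalar"
  assumes P: "pd d P" and unit: "\<And>i. i < n \<Longrightarrow> nsq d (v i) = 1"
    and t: "tight d n (act d P v)" and i: "i < n"
  shows "nsq d (\<lambda>a. act d P v i a - v i a) \<le> 2 * defect d n v"
proof -
  have P': "psd d P" "dt d P \<noteq> 0" using P by (auto simp: pd_def)
  have pos: "nsq d (app d P (v j)) > 0" if "j < n" for j
    using nsq_pos_app_pd[OF P'(2)] unit[OF that] by simp
  define s where "s = sqrt (nsq d (app d P (v i)))"
  have s: "s > 0" "s\<^sup>2 = nsq d (app d P (v i))" using pos[OF i] by (auto simp: s_def)
  \<comment> \<open>The inverse of \<open>M = P + s\<close> is the \<open>k\<close> of the argument, and \<open>y j = k v\<^sub>j\<close>.\<close>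
  define M where "M = (\<lambda>a b. P a b + (if a = b then of_real s else 0))"
  have appM: "app d M x a = app d P x a + s *\<^sub>R x a" if "a < d" for x a
    unfolding app_def M_def distrib_right sum.distrib using app_idm[OF that, of "of_real s" x]
    by (simp add: scaleR_conv_of_real)
  have Mlow: "nsq d (app d M x) \<ge> s\<^sup>2 * nsq d x" for x
  proof -
    have "nsq d (app d M x) = nsq d (\<lambda>a. app d P x a + s *\<^sub>R x a)" by (rule nsq_cong) (rule appM)
    also have "\<dots> = nsq d (app d P x) + 2 * s * ip d (app d P x) x + s\<^sup>2 * nsq d x"
      unfolding ip_self[symmetric] ip_linear ip_commute[of d x "app d P x"] by (simp add: power2_eq_square algebra_simps)
    finally show ?thesis using P'(1) s(1) unfolding psd_def by simp
  qed
  have "dt d M \<noteq> 0"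
  proof
    assume "dt d M = 0"
    from dt_zero_kernel[OF this] obtain x where x: "\<exists>a<d. x a \<noteq> 0" "\<And>a. a < d \<Longrightarrow> app d M x a = 0" by metis
    have "nsq d (app d M x) = 0" using x(2) by (simp add: nsq_eq_0_iff)
    then have "s\<^sup>2 * nsq d x \<le> 0" using Mlow[of x] by simp
    moreover have "nsq d x > 0" using x(1) nsq_pos_iff by blast
    ultimately show False using s(1) by (simp add: mult_le_0_iff)
  qed
  from dt_inverse[OF this] obtain k where
    k: "\<And>x a. a < d \<Longrightarrow> app d k (app d M x) a = x a" "\<And>x a. a < d \<Longrightarrow> app d M (app d k x) a = x a" by metis
  define y where "y = (\<lambda>j. app d k (v j))"
  define w where "w = (\<lambda>j a. app d P (y j) a + s *\<^sub>R y j a)"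
  have wv: "w j a = v j a" if "a < d" for j a
    using k(2)[OF that, of "v j"] appM[OF that, of "y j"] by (simp add: w_def y_def)
  have Pw: "app d P (w j) = app d P (v j)" for j by (rule app_cong) (rule wv)
  have ky: "app d k (app d P (v j)) a = app d P (y j) a" if "a < d" for j a
  proof -
    have "app d P (v j) b = app d M (app d P (y j)) b" if "b < d" for b
      unfolding Pw[symmetric] appM[OF that] w_def app_add app_scale ..
    then have "app d k (app d P (v j)) = app d k (app d M (app d P (y j)))" by (rule app_cong)
    then show ?thesis using k(1)[OF that, of "app d P (y j)"] by simp
  qed
  define u where "u = act d P v"
  have u: "u j = (\<lambda>a. (1 / sqrt (nsq d (app d P (v j)))) *\<^sub>R app d P (v j) a)" for j
    by (simp add: u_def act_def normalised_def)
  have uku: "ip d (u j) (app d k (u j)) = ip d (app d P (v j)) (app d P (y j)) / nsq d (app d P (v j))" if "j < n" for j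
  proof -
    have "ip d (app d P (v j)) (app d k (app d P (v j))) = ip d (app d P (v j)) (app d P (y j))"
      by (rule ip_cong) (simp_all add: ky)
    then show ?thesis using pos[OF that] unfolding u app_scale ip_linear by simp
  qed
  have mono: "ip d (u j) (app d k (u j)) \<le> ip d (v j) (app d k (v j))" if "j < n" for j
  proof -
    have "ip d (app d P (w j)) (app d P (y j)) * nsq d (w j) \<le> nsq d (app d P (w j)) * ip d (w j) (y j)"
      unfolding w_def using resolvent_monotone[OF P'(1) less_imp_le[OF s(1)]] .
    moreover have "nsq d (w j) = 1" using nsq_cong[of d "w j" "v j"] wv unit[OF that] by simp
    moreover have "ip d (w j) (y j) = ip d (v j) (y j)" by (rule ip_cong) (simp_all add: wv)
    ultimately show ?thesis using pos[OF that] unfolding uku[OF that] Pw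
      by (simp add: y_def field_simps)
  qed
  have main: "nsq d (\<lambda>a. u i a - v i a) = 2 * s * (ip d (v i) (app d k (v i)) - ip d (u i) (app d k (u i)))"
  proof -
    have "nsq d (\<lambda>a. (1 / s) *\<^sub>R app d P (w i) a - w i a) = 2 * s * (ip d (w i) (y i) - ip d (app d P (w i)) (app d P (y i)) / s\<^sup>2)"
    proof (rule resolvent_defect[OF P'(1) s(1)])
      show "nsq d (w i) = 1" using nsq_cong[of d "w i" "v i"] wv unit[OF i] by simp
      show "nsq d (app d P (w i)) = s\<^sup>2" by (simp add: Pw s(2))
    qed (simp add: w_def)
    moreover have "nsq d (\<lambda>a. (1 / s) *\<^sub>R app d P (w i) a - w i a) = nsq d (\<lambda>a. u i a - v i a)"
      by (rule nsq_cong) (simp add: Pw wv u s_def)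
    moreover have "ip d (w i) (y i) = ip d (v i) (y i)" by (rule ip_cong) (simp_all add: wv)
    ultimately show ?thesis by (simp add: uku[OF i] Pw s(2) y_def)
  qed
  have kbound: "s * norm (k a b) \<le> 1" if ab: "a < d" "b < d" for a b
  proof -
    define e where "e = (\<lambda>c. if c = b then 1 else 0 :: 'a)"
    have ke: "app d k e c = k c b" for c
      unfolding app_def e_def using that by (simp add: if_distrib cong: if_cong)
    have "nsq d (app d M (app d k e)) = nsq d e" by (rule nsq_cong) (rule k(2))
    also have "\<dots> = (\<Sum>c<d. if c = b then 1 else 0)"
      unfolding nsq_def e_def by (intro sum.cong refl) simp
    also have "\<dots> = 1" using ab by simp
    finally have "s\<^sup>2 * nsq d (app d k e) \<le> 1" using Mlow[of "app d k e"] by simp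
    moreover have "(norm (app d k e a))\<^sup>2 \<le> nsq d (app d k e)"
      unfolding nsq_def using ab by (intro member_le_sum) auto
    then have "s\<^sup>2 * (norm (k a b))\<^sup>2 \<le> s\<^sup>2 * nsq d (app d k e)"
      unfolding ke by (intro mult_left_mono) auto
    ultimately have "(s * norm (k a b))\<^sup>2 \<le> 1" by (simp add: power_mult_distrib)
    then show ?thesis by (simp add: power2_le_iff_abs_le abs_square_le_1 abs_le_iff)
  qed
  have "ip d (v i) (app d k (v i)) - ip d (u i) (app d k (u i)) \<le> (\<Sum>j<n. ip d (v j) (app d k (v j)) - ip d (u j) (app d k (u j)))"
    using i mono by (intro member_le_sum) auto
  also have "\<dots> = (\<Sum>a<d. \<Sum>b<d. inner (k a b) (gram n v a b - gram n u a b))"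
    by (simp only: sum_subtractf sum_ip_app_gram inner_diff_right)
  finally have 2: "ip d (v i) (app d k (v i)) - ip d (u i) (app d k (u i)) \<le>
    (\<Sum>a<d. \<Sum>b<d. inner (k a b) (gram n v a b - gram n u a b))" .
  have "s * (\<Sum>a<d. \<Sum>b<d. inner (k a b) (gram n v a b - gram n u a b)) \<le> defect d n v"
    unfolding defect_def sum_distrib_left
  proof (intro sum_mono)
    fix a b assume ab: "a \<in> {..<d}" "b \<in> {..<d}"
    define E where "E = gram n v a b - (if a = b then of_real (real n / real d) else 0)"
    have g: "gram n v a b - gram n u a b = E" using tightD[OF t, of a b] ab by (simp only: u_def E_def lessThan_iff)
    have "s * inner (k a b) E \<le> s * (norm (k a b) * norm E)"
      using s(1) norm_cauchy_schwarz by (intro mult_left_mono) auto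
    also have "\<dots> = (s * norm (k a b)) * norm E" by simp
    also have "\<dots> \<le> 1 * norm E" using kbound ab by (intro mult_right_mono) auto
    finally show "s * inner (k a b) (gram n v a b - gram n u a b) \<le>
       norm (gram n v a b - (if a = b then of_real (real n / real d) else 0))"
      unfolding g by (simp only: E_def mult_1)
  qed
  moreover have "s * (ip d (v i) (app d k (v i)) - ip d (u i) (app d k (u i))) \<le>
     s * (\<Sum>a<d. \<Sum>b<d. inner (k a b) (gram n v a b - gram n u a b))"
    using 2 s(1) by (intro mult_left_mono) auto
  ultimately show ?thesis using main unfolding u_def by simp
qed

section \<open>Maxima by sequential compactness\<close>

lemma bounded_sequence_subsequence:
  fixes x :: "nat \<Rightarrow> 'i \<Rightarrow> 'a::euclidean_space"
  assumes "finite I" "\<And>m i. i \<in> I \<Longrightarrow> norm (x m i) \<le> B"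
  obtains l r where "strict_mono (r :: nat \<Rightarrow> nat)" "\<And>i. i \<in> I \<Longrightarrow> (\<lambda>m. x (r m) i) \<longlonglongrightarrow> l i"
proof -
  have "\<exists>l r. strict_mono (r :: nat \<Rightarrow> nat) \<and> (\<forall>i\<in>I. (\<lambda>m. x (r m) i) \<longlonglongrightarrow> l i)"
    using assms
  proof (induction I)
    case empty
    then show ?case by (intro exI[of _ undefined] exI[of _ id]) (auto simp: strict_mono_def)
  next
    case (insert j I)
    then obtain l r where lr: "strict_mono (r :: nat \<Rightarrow> nat)" "\<forall>i\<in>I. (\<lambda>m. x (r m) i) \<longlonglongrightarrow> l i" by blast
    have "compact (cball (0::'a) B)" by simp
    moreover have "\<forall>m. x (r m) j \<in> cball 0 B" using insert.prems by simp
    ultimately obtain l' r' where l': "strict_mono (r' :: nat \<Rightarrow> nat)" "((\<lambda>m. x (r m) j) \<circ> r') \<longlonglongrightarrow> l'"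
      by (metis (no_types, lifting) compact_def)
    have "\<forall>i\<in>insert j I. (\<lambda>m. x ((r \<circ> r') m) i) \<longlonglongrightarrow> (l(j := l')) i"
    proof
      fix i assume "i \<in> insert j I"
      show "(\<lambda>m. x ((r \<circ> r') m) i) \<longlonglongrightarrow> (l(j := l')) i"
      proof (cases "i = j")
        case True
        then show ?thesis using l'(2) by (simp add: o_def)
      next
        case False
        then have "(\<lambda>m. x (r m) i) \<longlonglongrightarrow> l i" using \<open>i \<in> insert j I\<close> lr(2) by simp
        from LIMSEQ_subseq_LIMSEQ[OF this l'(1)] show ?thesis using False by (simp add: o_def)
      qed
    qed
    then show ?case using strict_mono_o[OF lr(1) l'(1)] by blast
  qed
  then show ?thesis using that by blast
qed

text \<open>Only finitely many values of each function matter, so compactness is expressed by sequences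
  converging on \<open>I\<close>; closedness of \<open>S\<close> and continuity of \<open>F\<close> are then checked together.\<close>
lemma sequential_attains_max:
  fixes F :: "('i \<Rightarrow> 'a::euclidean_space) \<Rightarrow> real"
  assumes I: "finite I" and bd: "\<And>x i. x \<in> S \<Longrightarrow> i \<in> I \<Longrightarrow> norm (x i) \<le> B" and ne: "S \<noteq> {}"
    and cl: "\<And>x l. (\<And>m::nat. x m \<in> S) \<Longrightarrow> (\<And>i. i \<in> I \<Longrightarrow> (\<lambda>m. x m i) \<longlonglongrightarrow> l i) \<Longrightarrow>
        l \<in> S \<and> (\<lambda>m. F (x m)) \<longlonglongrightarrow> F l"
  obtains x where "x \<in> S" "\<And>y. y \<in> S \<Longrightarrow> F y \<le> F x"
proof -
  have sub: "\<exists>l r. l \<in> S \<and> strict_mono (r :: nat \<Rightarrow> nat) \<and> (\<lambda>m. F (x (r m))) \<longlonglongrightarrow> F l"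
    if x: "\<And>m::nat. x m \<in> S" for x
  proof -
    obtain l r where lr: "strict_mono (r :: nat \<Rightarrow> nat)" "\<And>i. i \<in> I \<Longrightarrow> (\<lambda>m. x (r m) i) \<longlonglongrightarrow> l i"
      using bounded_sequence_subsequence[OF I, of x B] bd x by metis
    then show ?thesis using cl[of "\<lambda>m. x (r m)" l] x by blast
  qed
  have bdd: "bdd_above (F ` S)"
  proof (rule ccontr)
    assume "\<not> bdd_above (F ` S)"
    then have "\<forall>m::nat. \<exists>x\<in>S. F x > real m" unfolding bdd_above_def by (auto simp: not_le)
    then obtain x where x: "\<And>m. x m \<in> S" "\<And>m. F (x m) > real m" by metis
    obtain l r where lr: "strict_mono (r :: nat \<Rightarrow> nat)" "(\<lambda>m. F (x (r m))) \<longlonglongrightarrow> F l" using sub[of x, OF x(1)] by blast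
    have "filterlim (\<lambda>m. F (x (r m))) at_top sequentially"
    proof (rule filterlim_at_top_mono[OF filterlim_real_sequentially])
      show "\<forall>\<^sub>F m in sequentially. real m \<le> F (x (r m))"
        using x(2) seq_suble[OF lr(1)] by (intro always_eventually allI) (meson less_imp_le of_nat_mono order_trans)
    qed
    then show False using lr(2) not_tendsto_and_filterlim_at_infinity
      by (metis filterlim_at_top_imp_at_infinity trivial_limit_sequentially)
  qed
  define s where "s = Sup (F ` S)"
  have "\<exists>x\<in>S. F x > s - 1 / real (Suc m)" for m
  proof -
    have "s - 1 / real (Suc m) < Sup (F ` S)" by (simp add: s_def)
    then show ?thesis using less_cSup_iff[of "F ` S" "s - 1 / real (Suc m)"] ne bdd by auto
  qed
  then obtain x where x: "\<And>m. x m \<in> S" "\<And>m. F (x m) > s - 1 / real (Suc m)" by metis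
  obtain l r where lr: "l \<in> S" "strict_mono (r :: nat \<Rightarrow> nat)" "(\<lambda>m. F (x (r m))) \<longlonglongrightarrow> F l" using sub[of x, OF x(1)] by blast
  have "(\<lambda>m. s - 1 / real (Suc m)) \<longlonglongrightarrow> s - 0"
    by (intro tendsto_intros LIMSEQ_Suc[OF lim_1_over_n])
  then have "(\<lambda>m. s - 1 / real (Suc (r m))) \<longlonglongrightarrow> s"
    using LIMSEQ_subseq_LIMSEQ[OF _ lr(2)] by (force simp: o_def)
  then have "s \<le> F l"
    by (rule LIMSEQ_le[OF _ lr(3)]) (use x(2) in \<open>auto intro: less_imp_le\<close>)
  moreover have "F y \<le> s" if "y \<in> S" for y unfolding s_def using bdd that by (simp add: cSup_upper)
  ultimately show ?thesis using that lr(1) by (meson order_trans)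
qed

lemma tendsto_app [tendsto_intros]:
  assumes "\<And>a b. a < d \<Longrightarrow> b < d \<Longrightarrow> ((\<lambda>m. g m a b) \<longlongrightarrow> g' a b) F" "\<And>b. b < d \<Longrightarrow> ((\<lambda>m. x m b) \<longlongrightarrow> x' b) F" "a < d"
  shows "((\<lambda>m. app d (g m) (x m) a :: 'a::rc_scalar) \<longlongrightarrow> app d g' x' a) F"
  unfolding app_def using assms by (intro tendsto_sum tendsto_mult) auto

lemma tendsto_nsq:
  assumes "\<And>a. a < d \<Longrightarrow> ((\<lambda>m. x m a) \<longlongrightarrow> x' a) F"
  shows "((\<lambda>m. nsq d (x m)) \<longlongrightarrow> nsq d x') F"
  unfolding nsq_def using assms by (intro tendsto_sum tendsto_power tendsto_norm) auto

lemma tendsto_ip: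
  assumes "\<And>a. a < d \<Longrightarrow> ((\<lambda>m. x m a) \<longlongrightarrow> x' a) F" "\<And>a. a < d \<Longrightarrow> ((\<lambda>m. y m a) \<longlongrightarrow> y' a) F"
  shows "((\<lambda>m. ip d (x m) (y m)) \<longlongrightarrow> ip d x' y') F"
  unfolding ip_def using assms by (intro tendsto_sum tendsto_inner) auto

lemma tendsto_normalised:
  assumes "\<And>a. a < d \<Longrightarrow> ((\<lambda>m. x m a) \<longlongrightarrow> x' a) F" "nsq d x' \<noteq> 0" "a < d"
  shows "((\<lambda>m. normalised d (x m) a) \<longlongrightarrow> normalised d x' a) F"
  unfolding normalised_def using assms by (intro tendsto_intros tendsto_nsq) auto

lemma norm_le_nsq: "a < d \<Longrightarrow> (norm (x a))\<^sup>2 \<le> nsq d x"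
  unfolding nsq_def by (intro member_le_sum) auto

section \<open>Uniqueness of the tight rescaling\<close>

definition scaled_diff :: "real \<Rightarrow> (nat \<Rightarrow> nat \<Rightarrow> 'a) \<Rightarrow> (nat \<Rightarrow> nat \<Rightarrow> 'a) \<Rightarrow> nat \<Rightarrow> nat \<Rightarrow> 'a::rc_scalar" where
  "scaled_diff r P R = (\<lambda>a b. r *\<^sub>R P a b - R a b)"

lemma app_scaled_diff: "app d (scaled_diff r P R) x = (\<lambda>a. r *\<^sub>R app d P x a - app d R x a)"
  by (simp add: fun_eq_iff app_def scaled_diff_def left_diff_distrib sum_subtractf scaleR_sum_right)

lemma selfadj_scaled_diff: "selfadj d P \<Longrightarrow> selfadj d R \<Longrightarrow> selfadj d (scaled_diff r P R)"
proof -
  assume P: "selfadj d P" and R: "selfadj d R"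
  show ?thesis unfolding selfadj_def scaled_diff_def
  proof (intro allI impI)
    fix a b assume ab: "a < d" "b < d"
    have "P a b = conjugate (P b a)" "R a b = conjugate (R b a)" using P R ab unfolding selfadj_def by blast+
    then have e: "conjugate (P b a) = P a b" "conjugate (R b a) = R a b" by simp_all
    have "conjugate (r *\<^sub>R P b a - R b a) = r *\<^sub>R conjugate (P b a) - conjugate (R b a)"
      by (metis bounded_linear.linear conj_linear conj_scaleR linear_diff)
    then show "r *\<^sub>R P a b - R a b = conjugate (r *\<^sub>R P b a - R b a)" by (simp only: e)
  qed
qed

lemma selfadj_mmul_self: "selfadj d P \<Longrightarrow> selfadj d (mmul d P P)"
proof -
  assume P: "selfadj d P"
  show ?thesis unfolding selfadj_def
  proof (intro allI impI)
    fix a b assume ab: "a < d" "b < d"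
    have "P a c * P c b = conjugate (P b c * P c a)" if "c < d" for c
    proof -
      have "P a c = conjugate (P c a)" "P c b = conjugate (P b c)" using P ab that unfolding selfadj_def by blast+
      then show ?thesis by (simp only: conjugate_dist_mul mult.commute)
    qed
    then show "mmul d P P a b = conjugate (mmul d P P b a)"
      unfolding mmul_def conj_sum by (intro sum.cong refl) (simp only: lessThan_iff)
  qed
qed

lemma app_zero: "(\<And>b. b < d \<Longrightarrow> x b = 0) \<Longrightarrow> app d g x a = 0"
  by (simp add: app_def)

text \<open>Let \<open>x\<close> maximise \<open>|R y|\<^sup>2 / |P y|\<^sup>2\<close>, with maximum \<open>\<mu>\<close>.  Then \<open>\<mu> P\<^sup>2 - R\<^sup>2\<close> is positive semidefinite
  and its form vanishes at \<open>x\<close>, so it kills \<open>x\<close>.  This replaces the spectral theorem.\<close>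
lemma top_generalised_eigenvector:
  fixes P R :: "nat \<Rightarrow> nat \<Rightarrow> 'a::rc_scalar"
  assumes P: "selfadj d P" "dt d P \<noteq> 0" and R: "selfadj d R" and d: "d > 0"
  obtains x \<mu> where "nsq d x = 1" "\<And>y. nsq d (app d R y) \<le> \<mu> * nsq d (app d P y)"
    "psd d (scaled_diff \<mu> (mmul d P P) (mmul d R R))"
    "\<And>a. a < d \<Longrightarrow> app d R (app d R x) a = \<mu> *\<^sub>R app d P (app d P x) a"
    "\<And>y. ip d (app d (scaled_diff \<mu> (mmul d P P) (mmul d R R)) y) y = \<mu> * nsq d (app d P y) - nsq d (app d R y)"
    "\<mu> = nsq d (app d R x) / nsq d (app d P x)"
proof -
  define F where "F = (\<lambda>x. nsq d (app d R x) / nsq d (app d P x))"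
  define S where "S = {x :: nat \<Rightarrow> 'a. nsq d x = 1}"
  have "(\<lambda>a. if a = 0 then 1 else 0) \<in> S"
  proof -
    have "nsq d (\<lambda>a. if a = 0 then 1 else 0 :: 'a) = (\<Sum>a<d. if a = 0 then 1 else 0)"
      unfolding nsq_def by (intro sum.cong) auto
    then show ?thesis using d by (simp add: S_def)
  qed
  then have ne: "S \<noteq> {}" by blast
  obtain x where x: "x \<in> S" "\<And>y. y \<in> S \<Longrightarrow> F y \<le> F x"
  proof (rule sequential_attains_max[of "{..<d}" S 1 F])
    fix x :: "nat \<Rightarrow> 'a" and i assume "x \<in> S" "i \<in> {..<d}"
    then show "norm (x i) \<le> 1"
      using norm_le_nsq[of i d x] by (simp add: S_def abs_square_le_1)
  next
    fix x :: "nat \<Rightarrow> nat \<Rightarrow> 'a" and l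
    assume x: "\<And>m. x m \<in> S" "\<And>i. i \<in> {..<d} \<Longrightarrow> (\<lambda>m. x m i) \<longlonglongrightarrow> l i"
    have "(\<lambda>m. nsq d (x m)) \<longlonglongrightarrow> nsq d l" using x(2) by (intro tendsto_nsq) auto
    then have l: "nsq d l = 1" using x(1) LIMSEQ_unique[of "\<lambda>_. 1::real" _ 1] by (simp add: S_def)
    have "nsq d (app d P l) \<noteq> 0" using nsq_pos_app_pd[OF P(2), of l] l by simp
    moreover have "(\<lambda>m. nsq d (app d P (x m))) \<longlonglongrightarrow> nsq d (app d P l)"
      using x(2) by (intro tendsto_nsq tendsto_app tendsto_const) auto
    moreover have "(\<lambda>m. nsq d (app d R (x m))) \<longlonglongrightarrow> nsq d (app d R l)"
      using x(2) by (intro tendsto_nsq tendsto_app tendsto_const) auto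
    ultimately have "(\<lambda>m. F (x m)) \<longlonglongrightarrow> F l" unfolding F_def by (intro tendsto_divide)
    then show "l \<in> S \<and> (\<lambda>m. F (x m)) \<longlonglongrightarrow> F l" using l by (simp add: S_def)
  qed (use ne in auto)
  define \<mu> where "\<mu> = F x"
  have nx: "nsq d x = 1" using x(1) by (simp add: S_def)
  have Px: "nsq d (app d P x) > 0" using nsq_pos_app_pd[OF P(2), of x] nx by simp
  have le: "nsq d (app d R y) \<le> \<mu> * nsq d (app d P y)" for y
  proof (cases "nsq d y = 0")
    case True
    then have "app d R y a = 0" for a using nsq_eq_0_iff by (intro app_zero) blast
    then have "nsq d (app d R y) = 0" by (simp add: nsq_eq_0_iff)
    moreover have "\<mu> \<ge> 0" by (simp add: \<mu>_def F_def)
    ultimately show ?thesis by simp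
  next
    case False
    then have yp: "nsq d y > 0" using nsq_nonneg[of d y] by linarith
    have "normalised d y \<in> S" using nsq_normalised[OF False] by (simp add: S_def)
    then have "F (normalised d y) \<le> \<mu>" using x(2) by (simp add: \<mu>_def)
    moreover have "F (normalised d y) = F y" using yp unfolding F_def normalised_def app_scale nsq_scale by simp
    ultimately have "F y \<le> \<mu>" by (simp only:)
    then show ?thesis using nsq_pos_app_pd[OF P(2) yp] by (simp add: F_def field_simps)
  qed
  let ?M = "scaled_diff \<mu> (mmul d P P) (mmul d R R)"
  have Mapp: "app d ?M y a = \<mu> *\<^sub>R app d P (app d P y) a - app d R (app d R y) a" for y a
    unfolding app_scaled_diff app_mmul ..
  have form: "ip d (app d ?M y) y = \<mu> * nsq d (app d P y) - nsq d (app d R y)" for y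
  proof -
    have "ip d (app d ?M y) y = \<mu> * ip d (app d P (app d P y)) y - ip d (app d R (app d R y)) y"
      unfolding Mapp[abs_def] ip_linear ..
    then show ?thesis unfolding ip_selfadj[OF P(1)] ip_selfadj[OF R] ip_self .
  qed
  have psd: "psd d ?M"
    unfolding psd_def form using le selfadj_scaled_diff[OF selfadj_mmul_self[OF P(1)] selfadj_mmul_self[OF R]] by auto
  have "ip d (app d ?M x) x = 0" unfolding form using Px by (simp add: \<mu>_def F_def)
  then have "app d ?M x a = 0" if "a < d" for a using psd_kernel[OF psd _ that] by blast
  then have "app d R (app d R x) a = \<mu> *\<^sub>R app d P (app d P x) a" if "a < d" for a using that by (simp add: Mapp)
  then show ?thesis using that[OF nx le psd _ form] by (simp add: \<mu>_def F_def)
qed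

lemma dt_idm: "dt d idm = (1 :: 'a::comm_ring_1)"
proof -
  have "mat d d (\<lambda>(a, b). if a = b then 1 else 0 :: 'a) = 1\<^sub>m d" by (rule eq_matI) auto
  then show ?thesis by (simp add: dt_def)
qed

lemma app_idm': "a < d \<Longrightarrow> app d idm x a = x a"
  unfolding app_def by (subst app_idm) auto

text \<open>Put \<open>A = s P - R\<close> and \<open>S = s P + R\<close>.  From \<open>R\<^sup>2 = s\<^sup>2 P\<^sup>2\<close> one gets \<open>S A = - A S\<close>.  If \<open>z\<close> is an
  eigenvector of \<open>A\<^sup>2\<close> for the largest eigenvalue \<open>\<mu>\<close>, then
  \<open>0 \<le> \<langle>S A z, A z\<rangle> = - \<mu> \<langle>S z, z\<rangle>\<close> with \<open>\<langle>S z, z\<rangle> > 0\<close>, hence \<open>\<mu> \<le> 0\<close> and \<open>A = 0\<close>.\<close>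
lemma psd_sqrt_unique:
  fixes P R :: "nat \<Rightarrow> nat \<Rightarrow> 'a::rc_scalar"
  assumes P: "pd d P" and R: "psd d R" and s: "s > 0" and d: "d > 0"
    and eq: "\<And>x a. a < d \<Longrightarrow> app d R (app d R x) a = s\<^sup>2 *\<^sub>R app d P (app d P x) a"
    and a: "a < d"
  shows "app d R x a = s *\<^sub>R app d P x a"
proof -
  define A where "A = scaled_diff s P R"
  define S where "S = scaled_diff s P (\<lambda>a b. - R a b)"
  have P': "psd d P" "dt d P \<noteq> 0" "selfadj d P" and R': "selfadj d R" using P R by (auto simp: pd_def psd_def)
  have A: "app d A y = (\<lambda>a. s *\<^sub>R app d P y a - app d R y a)" for y by (simp add: A_def app_scaled_diff)
  have S: "app d S y = (\<lambda>a. s *\<^sub>R app d P y a + app d R y a)" for y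
    by (simp add: S_def app_scaled_diff) (simp add: app_def sum_negf)
  have anti: "app d S (app d A y) a = - app d A (app d S y) a" if "a < d" for y a
    unfolding S A app_diff app_add app_scale using eq[OF that, of y] by (simp add: algebra_simps power2_eq_square)
  have Aadj: "selfadj d A" unfolding A_def by (rule selfadj_scaled_diff) fact+
  have Iadj: "selfadj d (idm :: nat \<Rightarrow> nat \<Rightarrow> 'a)" unfolding selfadj_def by auto
  have dI: "dt d (idm :: nat \<Rightarrow> nat \<Rightarrow> 'a) \<noteq> 0" by (simp add: dt_idm)
  obtain z \<mu> where z: "nsq d z = 1" "\<And>y. nsq d (app d A y) \<le> \<mu> * nsq d (app d idm y)"
    "\<And>a. a < d \<Longrightarrow> app d A (app d A z) a = \<mu> *\<^sub>R app d idm (app d idm z) a"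
    by (rule top_generalised_eigenvector[OF Iadj dI Aadj d], rule that, assumption+)
  have Idn: "nsq d (app d idm y) = nsq d y" for y :: "nat \<Rightarrow> 'a" by (rule nsq_cong) (rule app_idm')
  have II: "app d idm (app d idm y) a = y a" if "a < d" for y :: "nat \<Rightarrow> 'a" and a
    using that by (simp add: app_idm')
  have Spos: "ip d (app d S y) y = s * ip d (app d P y) y + ip d (app d R y) y" for y
    unfolding S ip_linear ..
  have Sge: "ip d (app d S y) y \<ge> 0" for y
    unfolding Spos using P'(1) R s unfolding psd_def by (simp add: add_nonneg_nonneg)
  have Sz: "ip d (app d S z) z > 0"
  proof -
    have "ip d (app d P z) z \<noteq> 0"
    proof
      assume "ip d (app d P z) z = 0"
      then have "nsq d (app d P z) = 0" unfolding nsq_eq_0_iff using psd_kernel[OF P'(1)] by blast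
      then show False using nsq_pos_app_pd[OF P'(2), of z] z(1) by simp
    qed
    moreover have "ip d (app d P z) z \<ge> 0" "ip d (app d R z) z \<ge> 0" using P'(1) R unfolding psd_def by auto
    ultimately show ?thesis unfolding Spos using s by (simp add: add_pos_nonneg)
  qed
  have "ip d (app d S (app d A z)) (app d A z) = - ip d (app d A (app d S z)) (app d A z)"
    unfolding ip_def using anti by (simp add: sum_negf)
  also have "\<dots> = - ip d (app d S z) (app d A (app d A z))" by (simp add: ip_selfadj[OF Aadj])
  also have "ip d (app d S z) (app d A (app d A z)) = ip d (app d S z) (\<lambda>a. \<mu> *\<^sub>R z a)"
    by (rule ip_cong) (simp_all add: z(3) II)
  finally have "\<mu> * ip d (app d S z) z \<le> 0" using Sge[of "app d A z"] by (simp add: ip_linear)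
  then have "\<mu> \<le> 0" using Sz by (simp add: mult_le_0_iff)
  then have "\<mu> * nsq d x \<le> 0" by (simp add: mult_nonpos_nonneg)
  then have "nsq d (app d A x) \<le> 0" using z(2)[of x] unfolding Idn by linarith
  then have "nsq d (app d A x) = 0" using nsq_nonneg[of d "app d A x"] by linarith
  then show ?thesis using a unfolding nsq_eq_0_iff A by simp
qed

text \<open>Let \<open>x\<close> maximise \<open>|R x|\<^sup>2 / |P x|\<^sup>2\<close>, with maximum \<open>\<mu>\<close>, and let \<open>f = P\<^sup>2 x\<close>, so that
  \<open>R\<^sup>2 x = \<mu> f\<close>.  The frame identities of the two tight tuples at \<open>P x\<close> and at \<open>R x\<close> are both
  statements about the numbers \<open>|\<langle>f, v\<^sub>i\<rangle>|\<^sup>2\<close>, and their difference is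
  \<open>\<Sum>\<^sub>i |\<langle>f, v\<^sub>i\<rangle>|\<^sup>2 (\<mu> / |R v\<^sub>i|\<^sup>2 - 1 / |P v\<^sub>i|\<^sup>2) = 0\<close>, a sum of nonnegative terms.  So each \<open>v\<^sub>i\<close> is
  orthogonal to \<open>f\<close> or lies in the kernel of \<open>\<mu> P\<^sup>2 - R\<^sup>2\<close>.  Were this matrix nonzero, its kernel would
  lie in a second hyperplane, and two hyperplanes would contain all \<open>n\<close> vectors; stability allows
  them fewer than \<open>2 n / d \<le> n\<close>.  Hence \<open>R\<^sup>2 = \<mu> P\<^sup>2\<close>, so \<open>R\<close> is a multiple of \<open>P\<close>.\<close>
lemma tight_action_unique:
  fixes P R :: "nat \<Rightarrow> nat \<Rightarrow> 'a::rc_scalar"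
  assumes d: "d \<ge> 2" and st: "stable d n v" and unit: "\<And>i. i < n \<Longrightarrow> nsq d (v i) = 1"
    and P: "pd d P" "tight d n (act d P v)" and R: "pd d R" "tight d n (act d R v)"
    and i: "i < n" and a: "a < d"
  shows "act d P v i a = act d R v i a"
proof -
  have P': "psd d P" "dt d P \<noteq> 0" "selfadj d P" and R': "psd d R" "dt d R \<noteq> 0" "selfadj d R"
    using P R by (auto simp: pd_def psd_def)
  have d0: "d > 0" using d by simp
  define p where "p = (\<lambda>i. nsq d (app d P (v i)))"
  define r where "r = (\<lambda>i. nsq d (app d R (v i)))"
  have pos: "p i > 0" "r i > 0" if "i < n" for i
    using nsq_pos_app_pd[OF P'(2)] nsq_pos_app_pd[OF R'(2)] unit[OF that] by (auto simp: p_def r_def)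
  obtain x \<mu> where x: "nsq d x = 1" "\<And>y. nsq d (app d R y) \<le> \<mu> * nsq d (app d P y)"
    "psd d (scaled_diff \<mu> (mmul d P P) (mmul d R R))"
    "\<And>a. a < d \<Longrightarrow> app d R (app d R x) a = \<mu> *\<^sub>R app d P (app d P x) a"
    "\<And>y. ip d (app d (scaled_diff \<mu> (mmul d P P) (mmul d R R)) y) y = \<mu> * nsq d (app d P y) - nsq d (app d R y)"
    "\<mu> = nsq d (app d R x) / nsq d (app d P x)"
    by (rule top_generalised_eigenvector[OF P'(3,2) R'(3) d0], rule that, assumption+)
  let ?M = "scaled_diff \<mu> (mmul d P P) (mmul d R R)"
  have Pxp: "nsq d (app d P x) > 0" and Rxp: "nsq d (app d R x) > 0"
    using nsq_pos_app_pd[OF P'(2), of x] nsq_pos_app_pd[OF R'(2), of x] x(1) by auto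
  have mu: "\<mu> > 0" and Rx: "nsq d (app d R x) = \<mu> * nsq d (app d P x)" using Pxp Rxp by (simp_all add: x(6))
  define f where "f = app d P (app d P x)"
  have fv: "hp d f (v i) = hp d (app d P x) (app d P (v i))" for i
    unfolding f_def by (rule hp_selfadj[OF P'(3)])
  have fv': "of_real \<mu> * hp d f (v i) = hp d (app d R x) (app d R (v i))" for i
  proof -
    have "hp d (app d R (app d R x)) (v i) = of_real \<mu> * hp d f (v i)"
      by (simp add: hp_def f_def sum_distrib_left x(4) scaleR_conv_of_real mult.assoc)
    then show ?thesis unfolding hp_selfadj[OF R'(3)] by simp
  qed
  have hs: "(norm (hp d y (act d Q v i)))\<^sup>2 = (norm (hp d y (app d Q (v i))))\<^sup>2 / nsq d (app d Q (v i))" for y Q i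
  proof -
    have "hp d y (act d Q v i) = (1 / sqrt (nsq d (app d Q (v i)))) *\<^sub>R hp d y (app d Q (v i))"
      by (simp add: hp_def act_def normalised_def conj_scaleR scaleR_sum_right)
    then show ?thesis by (simp add: power_mult_distrib power_divide)
  qed
  define \<alpha> where "\<alpha> = (\<lambda>i. (norm (hp d f (v i)))\<^sup>2)"
  have "(\<Sum>i<n. \<alpha> i / p i) = real n / real d * nsq d (app d P x)"
    using tight_frame_identity[OF P(2), of "app d P x"] unfolding hs fv[symmetric] \<alpha>_def p_def .
  moreover have "(\<Sum>i<n. \<mu>\<^sup>2 * \<alpha> i / r i) = real n / real d * nsq d (app d R x)"
    using tight_frame_identity[OF R(2), of "app d R x"] unfolding hs fv'[symmetric] \<alpha>_def r_def
    by (simp add: norm_mult power_mult_distrib)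
  then have "\<mu> * (\<Sum>i<n. \<mu> * \<alpha> i / r i) = \<mu> * (real n / real d * nsq d (app d P x))"
    by (simp add: Rx sum_distrib_left power2_eq_square mult_ac)
  then have "(\<Sum>i<n. \<mu> * \<alpha> i / r i) = real n / real d * nsq d (app d P x)"
    using mu mult_left_cancel[of \<mu>] by (metis less_irrefl)
  ultimately have sum0: "(\<Sum>i<n. \<mu> * \<alpha> i / r i - \<alpha> i / p i) = 0" by (simp add: sum_subtractf)
  have tm: "\<mu> * \<alpha> i / r i - \<alpha> i / p i = \<alpha> i * (\<mu> * p i - r i) / (r i * p i)" if "i < n" for i
    using pos[OF that] by (simp add: field_simps)
  have ge0: "\<mu> * \<alpha> i / r i - \<alpha> i / p i \<ge> 0" if "i < n" for i
    unfolding tm[OF that] using pos[OF that] x(2)[of "v i"] by (simp add: \<alpha>_def p_def r_def)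
  have zero: "hp d f (v i) = 0 \<or> (\<forall>a<d. app d ?M (v i) a = 0)" if "i < n" for i
  proof -
    have "\<forall>j\<in>{..<n}. \<mu> * \<alpha> j / r j - \<alpha> j / p j = 0"
      using sum_nonneg_eq_0_iff[of "{..<n}" "\<lambda>i. \<mu> * \<alpha> i / r i - \<alpha> i / p i"] ge0 sum0 by simp
    then have "\<alpha> i * (\<mu> * p i - r i) / (r i * p i) = 0" using that tm[OF that] by simp
    then have "\<alpha> i = 0 \<or> \<mu> * p i - r i = 0" using pos[OF that] by auto
    then show ?thesis
    proof
      assume "\<mu> * p i - r i = 0"
      then have "ip d (app d ?M (v i)) (v i) = 0" unfolding x(5) p_def r_def .
      then show ?thesis using psd_kernel[OF x(3)] by blast
    qed (simp add: \<alpha>_def)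
  qed
  have M0: "?M a b = 0" if ab: "a < d" "b < d" for a b
  proof (rule ccontr)
    assume M: "?M a b \<noteq> 0"
    \<comment> \<open>A nonzero row of the matrix defines a hyperplane containing its kernel.\<close>
    define g where "g = (\<lambda>b. conjugate (?M a b))"
    have hg: "hp d g y = conjugate (app d ?M y a)" for y
      by (simp only: hp_def g_def app_def conj_sum conjugate_dist_mul)
    define G where "G = {i. i < n \<and> hp d g (v i) = 0}"
    define H where "H = {i. i < n \<and> hp d f (v i) = 0}"
    have "g b \<noteq> 0" using M unfolding g_def by simp
    then have "\<exists>b<d. g b \<noteq> 0" using ab(2) by blast
    then have 1: "d * card G < n" unfolding G_def by (rule stableD[OF st])
    have "nsq d f > 0" unfolding f_def by (rule nsq_pos_app_pd[OF P'(2) Pxp])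
    then have "\<exists>b<d. f b \<noteq> 0" unfolding nsq_pos_iff .
    then have 2: "d * card H < n" unfolding H_def by (rule stableD[OF st])
    have "i \<in> H \<union> G" if "i < n" for i
    proof (cases "hp d f (v i) = 0")
      case True
      then show ?thesis using that unfolding H_def by blast
    next
      case False
      then have "app d ?M (v i) a = 0" using zero[OF that] ab(1) by blast
      then have "hp d g (v i) = 0" unfolding hg by simp
      then show ?thesis using that unfolding G_def by blast
    qed
    then have "{..<n} \<subseteq> H \<union> G" by (simp add: subset_eq)
    moreover have "finite (H \<union> G)" by (simp add: H_def G_def)
    ultimately have "card {..<n} \<le> card (H \<union> G)" by (intro card_mono)
    also have "\<dots> \<le> card H + card G" by (rule card_Un_le)
    finally have "n \<le> card H + card G" by simp
    then have "d * n \<le> d * (card H + card G)" by (rule mult_le_mono2)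
    then have "d * n \<le> d * card H + d * card G" by (simp only: distrib_left)
    moreover have "2 * n \<le> d * n" using d by simp
    ultimately show False using 1 2 by linarith
  qed
  have sq: "app d R (app d R y) a = (sqrt \<mu>)\<^sup>2 *\<^sub>R app d P (app d P y) a" if "a < d" for y a
  proof -
    have "app d ?M y a = 0" unfolding app_def[of d ?M] using M0 that by (intro sum.neutral) simp
    then show ?thesis using mu by (simp add: app_scaled_diff app_mmul)
  qed
  have "sqrt \<mu> > 0" using mu by simp
  from psd_sqrt_unique[OF P(1) R'(1) this d0 sq]
  have RP: "app d R y a = sqrt \<mu> *\<^sub>R app d P y a" if "a < d" for y a using that by blast
  have "nsq d (app d R (v i)) = nsq d (\<lambda>a. sqrt \<mu> *\<^sub>R app d P (v i) a)" by (rule nsq_cong) (rule RP)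
  then have e: "nsq d (app d R (v i)) = \<mu> * nsq d (app d P (v i))" using mu unfolding nsq_scale by simp
  have "act d R v i a = (1 / sqrt (\<mu> * nsq d (app d P (v i))) * sqrt \<mu>) *\<^sub>R app d P (v i) a"
    unfolding act_def normalised_def RP[OF a] e scaleR_scaleR ..
  also have "1 / sqrt (\<mu> * nsq d (app d P (v i))) * sqrt \<mu> = 1 / sqrt (nsq d (app d P (v i)))"
    using mu by (simp add: real_sqrt_mult)
  finally show ?thesis by (simp only: act_def normalised_def)
qed

section \<open>Polar decomposition\<close>

definition isometry :: "nat \<Rightarrow> (nat \<Rightarrow> nat \<Rightarrow> 'a::rc_scalar) \<Rightarrow> bool" where
  "isometry d k \<longleftrightarrow> (\<forall>x. nsq d (app d k x) = nsq d x)"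

definition re_trace :: "nat \<Rightarrow> (nat \<Rightarrow> nat \<Rightarrow> 'a::rc_scalar) \<Rightarrow> real" where
  "re_trace d g = (\<Sum>a<d. inner 1 (g a a))"

definition basis_vec :: "nat \<Rightarrow> nat \<Rightarrow> 'a::comm_ring_1" where
  "basis_vec b = (\<lambda>a. if a = b then 1 else 0)"

lemma app_basis_vec: "b < d \<Longrightarrow> app d g (basis_vec b) a = g a b"
  unfolding app_def basis_vec_def by (simp add: if_distrib cong: if_cong)

lemma nsq_basis_vec: "b < d \<Longrightarrow> nsq d (basis_vec b :: nat \<Rightarrow> 'a::rc_scalar) = 1"
proof -
  assume b: "b < d"
  have "nsq d (basis_vec b :: nat \<Rightarrow> 'a) = (\<Sum>a<d. if a = b then 1 else 0)"
    unfolding nsq_def basis_vec_def by (intro sum.cong refl) auto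
  then show ?thesis using b by simp
qed

lemma isometry_dt: "isometry d k \<Longrightarrow> dt d k \<noteq> 0"
proof
  assume k: "isometry d k" and 0: "dt d k = 0"
  obtain x where x: "\<exists>a<d. x a \<noteq> 0" "\<And>a. a < d \<Longrightarrow> app d k x a = 0"
    using dt_zero_kernel[OF 0] by metis
  have "nsq d (app d k x) = 0" unfolding nsq_eq_0_iff using x(2) by blast
  moreover have "nsq d x > 0" unfolding nsq_pos_iff by (rule x(1))
  ultimately show False using k[unfolded isometry_def, rule_format, of x] by simp
qed

text \<open>For a unit vector \<open>e\<close> this multiplies the component along \<open>e\<close> by \<open>1 + \<alpha>\<close> and fixes its
  orthogonal complement.\<close>
definition rank_one_update :: "'a \<Rightarrow> (nat \<Rightarrow> 'a) \<Rightarrow> nat \<Rightarrow> nat \<Rightarrow> 'a::rc_scalar" where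
  "rank_one_update \<alpha> e = (\<lambda>a b. (if a = b then 1 else 0) + \<alpha> * e a * conjugate (e b))"

lemma app_rank_one_update: "a < d \<Longrightarrow> app d (rank_one_update \<alpha> e) x a = x a + \<alpha> * hp d x e * e a"
  unfolding app_def rank_one_update_def distrib_right sum.distrib using app_idm[of a d 1 x]
  by (simp add: hp_def sum_distrib_left sum_distrib_right mult_ac)

lemma nsq_add: "nsq d (\<lambda>a. x a + y a) = nsq d x + 2 * ip d x y + nsq d y"
  unfolding ip_self[symmetric] ip_linear by (simp add: ip_commute[of d y x])

lemma ip_mult_right: "ip d x (\<lambda>a. c * y a) = inner (hp d x y) c" for x :: "nat \<Rightarrow> 'a::rc_scalar"
proof -
  have "inner (x a) (c * y a) = inner (x a * conjugate (y a)) c" for a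
    by (metis inner_commute inner_mult_left_conj mult.commute)
  then show ?thesis unfolding ip_def hp_def by (simp add: inner_sum_left)
qed

lemma isometry_rank_one_update:
  assumes e: "nsq d e = 1" and \<alpha>: "norm (1 + \<alpha>) = 1"
  shows "isometry d (rank_one_update \<alpha> e)"
  unfolding isometry_def
proof
  fix x
  define q where "q = hp d x e"
  have "nsq d (app d (rank_one_update \<alpha> e) x) = nsq d (\<lambda>a. x a + (\<alpha> * q) * e a)"
    by (rule nsq_cong) (simp add: app_rank_one_update q_def)
  also have "\<dots> = nsq d x + 2 * inner q (\<alpha> * q) + (norm (\<alpha> * q))\<^sup>2"
    unfolding nsq_add ip_mult_right nsq_mult e q_def[symmetric] by simp
  also have "inner q (\<alpha> * q) = inner (\<alpha> * q) q" by (rule inner_commute)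
  also have "inner (\<alpha> * q) q = inner 1 \<alpha> * (norm q)\<^sup>2"
  proof -
    have "inner (q * \<alpha>) q = inner \<alpha> (conjugate q * q)" by (rule inner_mult_left_conj)
    then show ?thesis unfolding conj_mult_self
      by (metis inner_commute inner_of_real_left mult.commute mult.right_neutral)
  qed
  also have "nsq d x + 2 * (inner 1 \<alpha> * (norm q)\<^sup>2) + (norm (\<alpha> * q))\<^sup>2 =
     nsq d x + (2 * inner 1 \<alpha> + (norm \<alpha>)\<^sup>2) * (norm q)\<^sup>2"
    by (simp add: norm_mult power_mult_distrib algebra_simps)
  also have "2 * inner 1 \<alpha> + (norm \<alpha>)\<^sup>2 = 0"
  proof -
    have "(norm (1 + \<alpha>))\<^sup>2 = (norm (1::'a))\<^sup>2 + 2 * inner 1 \<alpha> + (norm \<alpha>)\<^sup>2"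
      unfolding power2_norm_eq_inner by (simp only: inner_add_left inner_add_right inner_commute[of \<alpha> 1])
    then show ?thesis using \<alpha> by simp
  qed
  finally show "nsq d (app d (rank_one_update \<alpha> e) x) = nsq d x" by simp
qed

lemma re_trace_rank_one_update: "re_trace d (mmul d (rank_one_update \<alpha> e) g) = re_trace d g + inner 1 (\<alpha> * hp d (app d g e) e)"
proof -
  have "(\<Sum>a<d. mmul d (rank_one_update \<alpha> e) g a a) = (\<Sum>a<d. g a a + \<alpha> * (e a * (\<Sum>b<d. conjugate (e b) * g b a)))"
  proof (rule sum.cong[OF refl])
    fix a assume a: "a \<in> {..<d}"
    show "mmul d (rank_one_update \<alpha> e) g a a = g a a + \<alpha> * (e a * (\<Sum>b<d. conjugate (e b) * g b a))"
      unfolding mmul_def rank_one_update_def distrib_right sum.distrib using a app_idm[of a d 1 "\<lambda>b. g b a"]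
      by (simp add: sum_distrib_left mult_ac)
  qed
  also have "\<dots> = (\<Sum>a<d. g a a) + \<alpha> * (\<Sum>a<d. \<Sum>b<d. e a * (conjugate (e b) * g b a))"
    by (simp add: sum.distrib sum_distrib_left)
  also have "(\<Sum>a<d. \<Sum>b<d. e a * (conjugate (e b) * g b a)) = (\<Sum>b<d. \<Sum>a<d. e a * (conjugate (e b) * g b a))"
    by (rule sum.swap)
  also have "\<dots> = hp d (app d g e) e"
    unfolding hp_def app_def sum_distrib_right by (intro sum.cong refl) (simp only: mult_ac)
  finally have "inner 1 (\<Sum>a<d. mmul d (rank_one_update \<alpha> e) g a a) = inner 1 ((\<Sum>a<d. g a a) + \<alpha> * hp d (app d g e) e)"
    by simp
  then show ?thesis unfolding re_trace_def by (simp only: inner_sum_right inner_add_right)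
qed

lemma hp_add_mult: "hp d (\<lambda>a. x a + c * y a) z = hp d x z + c * hp d y z"
  by (simp add: hp_def distrib_right sum.distrib sum_distrib_left mult.assoc)

text \<open>Let \<open>k\<close> maximise the real part of the trace of \<open>k g\<close> over the isometries, and \<open>P = k g\<close>.  Then no
  isometry increases the trace of \<open>P\<close>.  Rotating \<open>\<langle>P e, e\<rangle>\<close> onto the positive axis by a rank one
  update would increase it, so \<open>\<langle>P e, e\<rangle>\<close> is real and nonnegative for every unit vector \<open>e\<close>.  Over the
  reals this does not give symmetry.  For that, compare with products of two reflections: if \<open>f\<close> is a
  basis vector and \<open>Q\<close> is \<open>P\<close> followed by the reflection at \<open>f\<close>, then \<open>f\<close> minimises \<open>\<langle>Q e, e\<rangle>\<close>
  among unit vectors, and the first order condition compares the entries \<open>(a, b)\<close> and \<open>(b, a)\<close>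
  of \<open>P\<close>.\<close>
lemma polar_decomposition:
  fixes g :: "nat \<Rightarrow> nat \<Rightarrow> 'a::rc_scalar"
  obtains k where "isometry d k" "psd d (mmul d k g)"
proof -
  define F where "F = (\<lambda>x :: nat \<times> nat \<Rightarrow> 'a. re_trace d (mmul d (\<lambda>a b. x (a, b)) g))"
  define S where "S = {x :: nat \<times> nat \<Rightarrow> 'a. isometry d (\<lambda>a b. x (a, b))}"
  have Id: "app d idm x a = x a" if "a < d" for x :: "nat \<Rightarrow> 'a" and a using that by (rule app_idm')
  have "isometry d (idm :: nat \<Rightarrow> nat \<Rightarrow> 'a)" unfolding isometry_def by (intro allI nsq_cong Id)
  then have "(\<lambda>(a, b). idm a b) \<in> S" by (simp add: S_def)
  then have ne: "S \<noteq> {}" by blast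
  obtain x where x: "x \<in> S" "\<And>y. y \<in> S \<Longrightarrow> F y \<le> F x"
  proof (rule sequential_attains_max[of "{..<d} \<times> {..<d}" S 1 F])
    fix x :: "nat \<times> nat \<Rightarrow> 'a" and i assume x: "x \<in> S" and i: "i \<in> {..<d} \<times> {..<d}"
    obtain a b where ab: "i = (a, b)" "a < d" "b < d" using i by auto
    have "nsq d (app d (\<lambda>a b. x (a, b)) (basis_vec b)) = 1"
      using x nsq_basis_vec[OF ab(3)] unfolding S_def isometry_def by simp
    moreover have "(norm (app d (\<lambda>a b. x (a, b)) (basis_vec b) a))\<^sup>2 \<le> nsq d (app d (\<lambda>a b. x (a, b)) (basis_vec b))"
      by (rule norm_le_nsq[OF ab(2)])
    ultimately show "norm (x i) \<le> 1" using ab by (simp add: app_basis_vec abs_square_le_1)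
  next
    fix x :: "nat \<Rightarrow> nat \<times> nat \<Rightarrow> 'a" and l
    assume x: "\<And>m. x m \<in> S" "\<And>i. i \<in> {..<d} \<times> {..<d} \<Longrightarrow> (\<lambda>m. x m i) \<longlonglongrightarrow> l i"
    have "isometry d (\<lambda>a b. l (a, b))" unfolding isometry_def
    proof
      fix y
      have "(\<lambda>m. nsq d (app d (\<lambda>a b. x m (a, b)) y)) \<longlonglongrightarrow> nsq d (app d (\<lambda>a b. l (a, b)) y)"
        using x(2) by (intro tendsto_nsq tendsto_app tendsto_const) auto
      moreover have "nsq d (app d (\<lambda>a b. x m (a, b)) y) = nsq d y" for m
        using x(1)[of m] unfolding S_def isometry_def by simp
      ultimately show "nsq d (app d (\<lambda>a b. l (a, b)) y) = nsq d y" by (simp add: LIMSEQ_const_iff)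
    qed
    moreover have "(\<lambda>m. F (x m)) \<longlonglongrightarrow> F l"
      unfolding F_def re_trace_def mmul_def using x(2) by (intro tendsto_sum tendsto_inner tendsto_mult tendsto_const) auto
    ultimately show "l \<in> S \<and> (\<lambda>m. F (x m)) \<longlonglongrightarrow> F l" by (simp add: S_def)
  qed (use ne in auto)
  define k where "k = (\<lambda>a b. x (a, b))"
  have k: "isometry d k" using x(1) by (simp add: S_def k_def)
  define P where "P = mmul d k g"
  have max: "re_trace d (mmul d w P) \<le> re_trace d P" if w: "isometry d w" for w
  proof -
    have "isometry d (mmul d w k)"
    proof -
      have "app d (mmul d w k) y = app d w (app d k y)" for y by (rule ext) (rule app_mmul)
      then show ?thesis using w k unfolding isometry_def by simp
    qed
    then have "(\<lambda>(a, b). mmul d w k a b) \<in> S" by (simp add: S_def)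
    from x(2)[OF this] have "re_trace d (mmul d (mmul d w k) g) \<le> re_trace d P"
      by (simp add: F_def P_def k_def)
    moreover have "mmul d (mmul d w k) g = mmul d w P"
    proof (intro ext)
      fix a b
      have "mmul d (mmul d w k) g a b = app d (mmul d w k) (\<lambda>c. g c b) a" by (simp add: mmul_def app_def)
      also have "\<dots> = app d w (app d k (\<lambda>c. g c b)) a" by (rule app_mmul)
      also have "\<dots> = mmul d w P a b" by (simp add: mmul_def app_def P_def)
      finally show "mmul d (mmul d w k) g a b = mmul d w P a b" .
    qed
    ultimately show ?thesis by simp
  qed
  have q: "hp d (app d P e) e = of_real (norm (hp d (app d P e) e))" if e: "nsq d e = 1" for e
  proof (cases "hp d (app d P e) e = 0")
    case False
    define q where "q = hp d (app d P e) e"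
    define \<omega> where "\<omega> = conjugate q / of_real (norm q)"
    have q0: "norm q > 0" using False by (simp add: q_def)
    have "norm (1 + (\<omega> - 1)) = 1" using q0 by (simp add: \<omega>_def norm_divide)
    then have "inner 1 ((\<omega> - 1) * q) \<le> 0"
      using max[OF isometry_rank_one_update[OF e]] unfolding re_trace_rank_one_update q_def by fastforce
    moreover have "\<omega> * q = of_real (norm q)"
      using q0 by (simp add: \<omega>_def conj_mult_self power2_eq_square)
    ultimately have "inner 1 (of_real (norm q) :: 'a) \<le> inner 1 q" by (simp add: left_diff_distrib inner_diff_right)
    moreover have "inner (1::'a) (of_real (norm q)) = norm q"
      using inner_of_real_left[of "norm q" 1 "1::'a"] by (simp add: inner_commute power2_norm_eq_inner[symmetric])
    ultimately have le: "norm q \<le> inner 1 q" by simp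
    have "(norm (q - of_real (norm q)))\<^sup>2 = (norm q)\<^sup>2 - 2 * (norm q * inner 1 q) + (norm q)\<^sup>2"
    proof -
      have "inner q (of_real (norm q)) = norm q * inner 1 q"
        using inner_of_real_left[of "norm q" 1 q] by (simp add: inner_commute)
      moreover have "inner (of_real (norm q)) (of_real (norm q) :: 'a) = inner q q"
        by (simp only: power2_norm_eq_inner[symmetric] norm_of_real abs_norm_cancel)
      ultimately show ?thesis unfolding power2_norm_eq_inner inner_diff_left inner_diff_right
        by (simp add: inner_commute)
    qed
    also have "\<dots> \<le> 0" using mult_left_mono[OF le, of "norm q"] by (simp add: power2_eq_square)
    finally show ?thesis by (simp add: q_def)
  qed simp
  have ipq: "ip d (app d P e) e = norm (hp d (app d P e) e)" if e: "nsq d e = 1" for e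
  proof -
    have "of_real (2 * ip d (app d P e) e) = (of_real (2 * norm (hp d (app d P e) e)) :: 'a)"
      unfolding ip_hp by (subst (1 2) q[OF e]) (simp only: conj_of_real mult_2 of_real_add)
    then show ?thesis unfolding of_real_eq_iff by simp
  qed
  have pos: "ip d (app d P y) y \<ge> 0" for y
  proof (cases "nsq d y = 0")
    case True
    then have "ip d (app d P y) y = 0" unfolding nsq_eq_0_iff ip_def by simp
    then show ?thesis by simp
  next
    case False
    have "ip d (app d P (normalised d y)) (normalised d y) \<ge> 0" using ipq[OF nsq_normalised[OF False]] by simp
    moreover have "ip d (app d P (normalised d y)) (normalised d y) = (1 / sqrt (nsq d y))\<^sup>2 * ip d (app d P y) y"
      unfolding normalised_def app_scale ip_linear by (simp add: power2_eq_square)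
    moreover have "(1 / sqrt (nsq d y))\<^sup>2 > 0" using False nsq_nonneg[of d y] by (simp add: less_le)
    ultimately show ?thesis by (simp add: zero_le_mult_iff)
  qed
  \<comment> \<open>For \<open>\<alpha> = -2\<close> a rank one update is a reflection.\<close>
  have two: "norm (1 + (- 2 :: 'a)) = 1" by simp
  have sa: "P b a = conjugate (P a b)" if ab: "a < d" "b < d" for a b
  proof (cases "a = b")
    case True
    have "P a a = hp d (app d P (basis_vec a)) (basis_vec a)"
      using ab(1) by (simp add: hp_def app_basis_vec) (simp add: basis_vec_def if_distrib cong: if_cong)
    then obtain r where "P a a = of_real r" using q[OF nsq_basis_vec[OF ab(1)]] by metis
    then have "conjugate (P a a) = P a a" by simp
    then show ?thesis unfolding True[symmetric] by (rule sym)
  next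
    case False
    define f where "f = (basis_vec a :: nat \<Rightarrow> 'a)"
    have nf: "nsq d f = 1" unfolding f_def by (rule nsq_basis_vec[OF ab(1)])
    define Q where "Q = mmul d (rank_one_update (-2) f) P"
    have rQ: "re_trace d (mmul d (rank_one_update (-2) e) Q) = re_trace d Q - 2 * ip d (app d Q e) e" for e
    proof -
      have "inner 1 ((-2) * hp d (app d Q e) e) = - 2 * inner 1 (hp d (app d Q e) e)"
        using inner_of_real_left[of "-2" "hp d (app d Q e) e" 1] by (simp add: inner_commute)
      moreover have "inner 1 (hp d (app d Q e) e) = ip d (app d Q e) e"
        using ip_mult_right[of d "app d Q e" 1 e] by (simp add: inner_commute)
      ultimately show ?thesis unfolding re_trace_rank_one_update by simp
    qed
    have QP: "re_trace d Q - 2 * ip d (app d Q f) f = re_trace d P"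
    proof -
      have "app d (rank_one_update (-2) f) (app d (rank_one_update (-2) f) y) c = y c" if "c < d" for y c
      proof -
        have "hp d (app d (rank_one_update (-2) f) y) f = hp d (\<lambda>a. y a + (-2) * hp d y f * f a) f"
          unfolding hp_def[of d _ f] by (intro sum.cong refl) (simp add: app_rank_one_update hp_def)
        also have "\<dots> = hp d y f + (-2) * hp d y f * hp d f f"
          by (rule hp_add_mult)
        also have "\<dots> = - hp d y f" by (simp add: hp_self nf)
        finally show ?thesis using that by (simp add: app_rank_one_update)
      qed
      then have "mmul d (rank_one_update (-2) f) Q a b = P a b" if "a < d" "b < d" for a b
      proof -
        have "mmul d (rank_one_update (-2) f) Q a b = app d (rank_one_update (-2) f) (app d (rank_one_update (-2) f) (\<lambda>c. P c b)) a"
          by (simp add: mmul_def app_def Q_def)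
        then show ?thesis using \<open>\<And>y c. c < d \<Longrightarrow> app d (rank_one_update (-2) f) (app d (rank_one_update (-2) f) y) c = y c\<close> that by simp
      qed
      then have "re_trace d (mmul d (rank_one_update (-2) f) Q) = re_trace d P" unfolding re_trace_def by (intro sum.cong refl) simp
      then show ?thesis unfolding rQ .
    qed
    have min: "ip d (app d Q f) f \<le> ip d (app d Q e) e" if e: "nsq d e = 1" for e
    proof -
      have "isometry d (mmul d (rank_one_update (-2) e) (rank_one_update (-2) f))"
      proof -
        have "app d (mmul d (rank_one_update (-2) e) (rank_one_update (-2) f)) y = app d (rank_one_update (-2) e) (app d (rank_one_update (-2) f) y)" for y
          by (rule ext) (rule app_mmul)
        then show ?thesis using isometry_rank_one_update[OF e two] isometry_rank_one_update[OF nf two] unfolding isometry_def by simp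
      qed
      from max[OF this] have "re_trace d (mmul d (mmul d (rank_one_update (-2) e) (rank_one_update (-2) f)) P) \<le> re_trace d P" .
      moreover have "mmul d (mmul d (rank_one_update (-2) e) (rank_one_update (-2) f)) P = mmul d (rank_one_update (-2) e) Q"
      proof (intro ext)
        fix a b
        have "mmul d (mmul d (rank_one_update (-2) e) (rank_one_update (-2) f)) P a b = app d (mmul d (rank_one_update (-2) e) (rank_one_update (-2) f)) (\<lambda>c. P c b) a"
          by (simp add: mmul_def app_def)
        also have "\<dots> = app d (rank_one_update (-2) e) (app d (rank_one_update (-2) f) (\<lambda>c. P c b)) a" by (rule app_mmul)
        also have "\<dots> = mmul d (rank_one_update (-2) e) Q a b" by (simp add: mmul_def app_def Q_def)
        finally show "mmul d (mmul d (rank_one_update (-2) e) (rank_one_update (-2) f)) P a b = mmul d (rank_one_update (-2) e) Q a b" .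
      qed
      ultimately show ?thesis using QP rQ[of e] by simp
    qed
    define m0 where "m0 = ip d (app d Q f) f"
    have form: "ip d (app d Q y) y - m0 * nsq d y \<ge> 0" for y
    proof (cases "nsq d y = 0")
      case True
      then have "ip d (app d Q y) y = 0" unfolding nsq_eq_0_iff ip_def by simp
      then show ?thesis using True by simp
    next
      case False
      then have p: "nsq d y > 0" using nsq_nonneg[of d y] by linarith
      have "m0 \<le> ip d (app d Q (normalised d y)) (normalised d y)" unfolding m0_def by (rule min[OF nsq_normalised[OF False]])
      also have "\<dots> = (1 / sqrt (nsq d y))\<^sup>2 * ip d (app d Q y) y"
        unfolding normalised_def app_scale ip_linear by (simp add: power2_eq_square)
      also have "\<dots> = ip d (app d Q y) y / nsq d y" using p by (simp add: power_divide)
      finally show ?thesis using p by (simp add: field_simps)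
    qed
    have lin: "ip d (app d Q f) y + ip d (app d Q y) f = 2 * m0 * ip d f y" for y
    proof -
      define B where "B = (ip d (app d Q f) y + ip d (app d Q y) f) / 2 - m0 * ip d f y"
      have "B\<^sup>2 \<le> 0 * (ip d (app d Q y) y - m0 * nsq d y)"
      proof (rule semi_Cauchy_Schwarz)
        fix t
        have "ip d (app d Q (\<lambda>a. f a + t *\<^sub>R y a)) (\<lambda>a. f a + t *\<^sub>R y a) - m0 * nsq d (\<lambda>a. f a + t *\<^sub>R y a) =
           0 + 2 * t * B + t\<^sup>2 * (ip d (app d Q y) y - m0 * nsq d y)"
          unfolding app_add app_scale nsq_add nsq_scale ip_linear nf
          by (simp add: B_def m0_def[symmetric] power2_eq_square algebra_simps)
        then show "0 + 2 * t * B + t\<^sup>2 * (ip d (app d Q y) y - m0 * nsq d y) \<ge> 0"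
          using form[of "\<lambda>a. f a + t *\<^sub>R y a"] by linarith
      qed (rule form)
      then have "B = 0" by simp
      then show ?thesis unfolding B_def by simp
    qed
    have "inner (P b a - conjugate (P a b)) \<omega> = 0" for \<omega>
    proof -
      define y where "y = (\<lambda>c. \<omega> * basis_vec b c)"
      have Qe: "Q c e = P c e + (-2) * (if c = a then P a e else 0)" if "c < d" "e < d" for c e
      proof -
        have "Q c e = app d (rank_one_update (-2) f) (\<lambda>c. P c e) c" by (simp add: Q_def mmul_def app_def)
        also have "\<dots> = P c e + (-2) * hp d (\<lambda>c. P c e) f * f c" using that(1) by (rule app_rank_one_update)
        also have "hp d (\<lambda>c. P c e) f = P a e"
          unfolding hp_def f_def basis_vec_def using ab(1) by (simp add: if_distrib cong: if_cong)
        finally show ?thesis by (simp add: f_def basis_vec_def)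
      qed
      have "ip d f y = inner (hp d f (basis_vec b)) \<omega>" unfolding y_def by (rule ip_mult_right)
      also have "hp d f (basis_vec b) = 0" unfolding hp_def f_def basis_vec_def using False by (intro sum.neutral) auto
      finally have 0: "ip d f y = 0" by simp
      have "ip d (app d Q f) y = inner (hp d (app d Q f) (basis_vec b)) \<omega>" unfolding y_def by (rule ip_mult_right)
      also have "hp d (app d Q f) (basis_vec b) = Q b a"
        unfolding hp_def f_def app_basis_vec[OF ab(1)] unfolding basis_vec_def using ab(2) by (simp add: if_distrib cong: if_cong)
      also have "Q b a = P b a" using Qe[OF ab(2,1)] False by simp
      finally have 1: "ip d (app d Q f) y = inner (P b a) \<omega>" .
      have "ip d (app d Q y) f = ip d (app d Q y) (\<lambda>c. 1 * f c)" by simp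
      also have "\<dots> = inner (hp d (app d Q y) f) 1" by (rule ip_mult_right)
      also have "hp d (app d Q y) f = \<omega> * Q a b"
        unfolding hp_def y_def app_mult app_basis_vec[OF ab(2)] unfolding f_def basis_vec_def using ab(1) by (simp add: if_distrib cong: if_cong)
      also have "Q a b = - P a b" using Qe[OF ab] by simp
      also have "inner (\<omega> * - P a b) 1 = - inner (P a b * \<omega>) 1" by (simp add: mult.commute)
      also have "inner (P a b * \<omega>) 1 = inner \<omega> (conjugate (P a b))" by (subst inner_mult_left_conj) simp
      finally have 2: "ip d (app d Q y) f = - inner \<omega> (conjugate (P a b))" .
      show ?thesis using lin[of y] unfolding 0 1 2 by (simp add: inner_diff_left inner_diff_right inner_commute)
    qed
    from this[of "P b a - conjugate (P a b)"] show ?thesis by simp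
  qed
  have "selfadj d P" unfolding selfadj_def using sa by blast
  then have "psd d P" unfolding psd_def using pos by blast
  then show ?thesis using that k unfolding P_def by blast
qed

section \<open>Existence of a tight rescaling\<close>

definition frob_sq :: "nat \<Rightarrow> (nat \<Rightarrow> nat \<Rightarrow> 'a::real_normed_vector) \<Rightarrow> real" where
  "frob_sq d g = (\<Sum>a<d. \<Sum>b<d. (norm (g a b))\<^sup>2)"

text \<open>The function whose maximisers are the tight rescalings; it is homogeneous of degree zero, so it
  can be studied on matrices of norm one.\<close>
definition theta :: "nat \<Rightarrow> nat \<Rightarrow> (nat \<Rightarrow> nat \<Rightarrow> 'a::rc_scalar) \<Rightarrow> (nat \<Rightarrow> nat \<Rightarrow> 'a) \<Rightarrow> real" where
  "theta d n v g = (norm (dt d g)) ^ (2 * n) / (\<Prod>i<n. nsq d (app d g (v i))) ^ d"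

lemma nsq_app_le: "nsq d (app d g x) \<le> frob_sq d g * nsq d x" for g :: "nat \<Rightarrow> nat \<Rightarrow> 'a::rc_scalar"
proof -
  have "(norm (app d g x a))\<^sup>2 \<le> (\<Sum>b<d. (norm (g a b))\<^sup>2) * nsq d x" for a
  proof -
    have "app d g x a = hp d x (\<lambda>b. conjugate (g a b))" by (simp add: app_def hp_def mult.commute)
    then have "(norm (app d g x a))\<^sup>2 \<le> nsq d x * nsq d (\<lambda>b. conjugate (g a b))" using norm_hp_le by metis
    then show ?thesis by (simp add: nsq_def mult.commute)
  qed
  then have "nsq d (app d g x) \<le> (\<Sum>a<d. (\<Sum>b<d. (norm (g a b))\<^sup>2) * nsq d x)"
    unfolding nsq_def[of d "app d g x"] by (rule sum_mono)
  then show ?thesis by (simp add: frob_sq_def sum_distrib_right)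
qed

lemma dt_scale: "dt d (\<lambda>a b. r *\<^sub>R g a b) = of_real r ^ d * dt d g" for g :: "nat \<Rightarrow> nat \<Rightarrow> 'a::rc_scalar"
proof -
  have "mat d d (\<lambda>(a, b). r *\<^sub>R g a b) = of_real r \<cdot>\<^sub>m mat d d (\<lambda>(a, b). g a b)"
    by (rule eq_matI) (auto simp: scaleR_conv_of_real)
  then show ?thesis by (simp add: dt_def det_smult)
qed

lemma theta_scale:
  assumes "r \<noteq> 0"
  shows "theta d n v (\<lambda>a b. r *\<^sub>R g a b) = theta d n v g"
proof -
  have "app d (\<lambda>a b. r *\<^sub>R g a b) x = (\<lambda>a. r *\<^sub>R app d g x a)" for x
    by (simp add: fun_eq_iff app_def scaleR_sum_right)
  then have "(\<Prod>i<n. nsq d (app d (\<lambda>a b. r *\<^sub>R g a b) (v i))) = (\<Prod>i<n. r\<^sup>2 * nsq d (app d g (v i)))"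
    by (simp add: nsq_scale)
  also have "\<dots> = (r\<^sup>2) ^ n * (\<Prod>i<n. nsq d (app d g (v i)))" by (simp add: prod.distrib)
  finally have p: "(\<Prod>i<n. nsq d (app d (\<lambda>a b. r *\<^sub>R g a b) (v i))) ^ d =
     ((r\<^sup>2) ^ n) ^ d * (\<Prod>i<n. nsq d (app d g (v i))) ^ d" by (simp add: power_mult_distrib power_mult)
  have "norm (dt d (\<lambda>a b. r *\<^sub>R g a b)) ^ (2 * n) = (\<bar>r\<bar> ^ d) ^ (2 * n) * norm (dt d g) ^ (2 * n)"
    by (simp add: dt_scale norm_mult norm_power power_mult_distrib)
  also have "(\<bar>r\<bar> ^ d) ^ (2 * n) = ((\<bar>r\<bar>\<^sup>2) ^ n) ^ d"
    by (simp only: power_mult[symmetric] mult_ac)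
  also have "\<dots> = ((r\<^sup>2) ^ n) ^ d" by (simp only: power2_abs)
  finally have q: "norm (dt d (\<lambda>a b. r *\<^sub>R g a b)) ^ (2 * n) = ((r\<^sup>2) ^ n) ^ d * norm (dt d g) ^ (2 * n)" .
  have "((r\<^sup>2) ^ n) ^ d \<noteq> 0" using assms by simp
  then show ?thesis unfolding theta_def p q by (rule mult_divide_mult_cancel_left)
qed

text \<open>Bounds \<open>|g x|\<close> from below with a constant that stays finite when \<open>g\<close> tends to a singular
  matrix; the adjugate is used because the inverse would blow up.\<close>
lemma adjugate_bound: "(norm (dt d g))\<^sup>2 * nsq d x \<le> frob_sq d (adjugate d g) * nsq d (app d g x)"
  for g :: "nat \<Rightarrow> nat \<Rightarrow> 'a::rc_scalar"
proof -
  have "nsq d (app d (adjugate d g) (app d g x)) = nsq d (\<lambda>a. dt d g * x a)"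
    by (rule nsq_cong) (rule app_adjugate)
  then show ?thesis using nsq_app_le[of d "adjugate d g" "app d g x"] by (simp add: nsq_mult)
qed

text \<open>Suppose the limit \<open>l\<close> is singular and kills \<open>r\<close> of the vectors.  By \<open>adjugate_bound\<close> the factors
  of the denominator of \<open>theta\<close> belonging to these are at least a constant times \<open>|det g|\<^sup>2\<close>, and the
  other factors stay away from zero, so \<open>theta\<close> is at most a constant times
  \<open>|det g|\<close> to the power \<open>2 (n - r d)\<close>.  The killed vectors lie in a hyperplane because \<open>l \<noteq> 0\<close>, so stability gives
  \<open>r d < n\<close> and \<open>theta\<close> tends to zero.\<close>
lemma theta_proper:
  fixes v :: "nat \<Rightarrow> nat \<Rightarrow> 'a::rc_scalar"
  assumes st: "stable d n v" and unit: "\<And>i. i < n \<Longrightarrow> nsq d (v i) = 1" and c: "c > 0"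
    and lim: "\<And>a b. a < d \<Longrightarrow> b < d \<Longrightarrow> (\<lambda>m::nat. g m a b) \<longlonglongrightarrow> l a b"
    and l: "\<exists>a<d. \<exists>b<d. l a b \<noteq> 0" and th: "\<And>m. theta d n v (g m) \<ge> c"
  shows "dt d l \<noteq> 0"
proof
  assume l0: "dt d l = 0"
  obtain a0 b0 where ab: "a0 < d" "b0 < d" "l a0 b0 \<noteq> 0" using l by blast
  \<comment> \<open>A nonzero row of \<open>l\<close> defines a hyperplane containing its kernel.\<close>
  define f where "f = (\<lambda>b. conjugate (l a0 b))"
  have hf: "hp d f y = conjugate (app d l y a0)" for y
    by (simp only: hp_def f_def app_def conj_sum conjugate_dist_mul)
  have "f b0 \<noteq> 0" using ab by (simp add: f_def)
  then have "\<exists>b<d. f b \<noteq> 0" using ab(2) by blast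
  then have cardf: "d * card {i. i < n \<and> hp d f (v i) = 0} < n" by (rule stableD[OF st])
  define K where "K = {i. i < n \<and> nsq d (app d l (v i)) = 0}"
  have "K \<subseteq> {i. i < n \<and> hp d f (v i) = 0}"
    unfolding K_def hf nsq_eq_0_iff using ab(1) by auto
  then have "card K \<le> card {i. i < n \<and> hp d f (v i) = 0}" by (intro card_mono) auto
  then have Kn: "d * card K < n" using cardf by (meson le_less_trans mult_le_mono2)
  have KS: "K \<subseteq> {..<n}" by (auto simp: K_def)
  define D where "D = (\<lambda>m. (norm (dt d (g m)))\<^sup>2)"
  define L where "L = (\<Prod>i\<in>{..<n} - K. nsq d (app d l (v i)))"
  have L: "L > 0" unfolding L_def
  proof (rule prod_pos)
    fix i assume "i \<in> {..<n} - K"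
    then have "nsq d (app d l (v i)) \<noteq> 0" by (simp add: K_def)
    then show "0 < nsq d (app d l (v i))" using nsq_nonneg[of d "app d l (v i)"] by linarith
  qed
  have limapp: "(\<lambda>m. nsq d (app d (g m) x)) \<longlonglongrightarrow> nsq d (app d l x)" for x
    using lim by (intro tendsto_nsq tendsto_app tendsto_const) auto
  define C where "C = frob_sq d (adjugate d l) + 1"
  have C: "C > 0" unfolding C_def frob_sq_def by (intro add_nonneg_pos sum_nonneg) auto
  have "(\<lambda>m. frob_sq d (adjugate d (g m))) \<longlonglongrightarrow> frob_sq d (adjugate d l)"
    unfolding frob_sq_def using lim by (intro tendsto_sum tendsto_power tendsto_norm tendsto_adjugate) auto
  then have ev1: "\<forall>\<^sub>F m in sequentially. frob_sq d (adjugate d (g m)) < C"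
    unfolding C_def by (rule order_tendstoD) simp
  have "(\<lambda>m. \<Prod>i\<in>{..<n} - K. nsq d (app d (g m) (v i))) \<longlonglongrightarrow> L"
    unfolding L_def by (intro tendsto_prod limapp)
  then have ev2: "\<forall>\<^sub>F m in sequentially. L / 2 < (\<Prod>i\<in>{..<n} - K. nsq d (app d (g m) (v i)))"
    by (rule order_tendstoD) (use L in simp)
  have "(\<lambda>m. dt d (g m)) \<longlonglongrightarrow> dt d l" using lim by (rule tendsto_dt)
  then have "(\<lambda>m. D m) \<longlonglongrightarrow> (norm (dt d l))\<^sup>2" unfolding D_def by (intro tendsto_power tendsto_norm)
  then have D0: "D \<longlonglongrightarrow> 0" by (simp add: l0)
  define k where "k = d * card K"
  define e where "e = c * (inverse C ^ card K * (L / 2)) ^ d"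
  have e: "e > 0" unfolding e_def using c C L by simp
  have key: "e \<le> D m ^ (n - k)" if 1: "frob_sq d (adjugate d (g m)) < C" and 2: "L / 2 < (\<Prod>i\<in>{..<n} - K. nsq d (app d (g m) (v i)))" for m
  proof -
    let ?p = "\<lambda>i. nsq d (app d (g m) (v i))"
    have Dn: "norm (dt d (g m)) ^ (2 * n) = D m ^ n" by (simp add: D_def power_mult)
    have "theta d n v (g m) > 0" using th[of m] c by linarith
    then have Dpos: "D m > 0" and pp: "(\<Prod>i<n. ?p i) ^ d > 0"
    proof -
      assume t: "theta d n v (g m) > 0"
      have n0: "n > 0" using cardf by simp
      have "dt d (g m) \<noteq> 0"
      proof
        assume "dt d (g m) = 0"
        then have "theta d n v (g m) = 0" using n0 by (simp add: theta_def)
        then show False using t by simp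
      qed
      then show "D m > 0" by (simp add: D_def)
      have "(\<Prod>i<n. ?p i) ^ d \<noteq> 0"
      proof
        assume "(\<Prod>i<n. ?p i) ^ d = 0"
        then have "theta d n v (g m) = 0" unfolding theta_def by (simp only: div_by_0)
        then show False using t by simp
      qed
      moreover have "(\<Prod>i<n. ?p i) ^ d \<ge> 0" by (intro zero_le_power prod_nonneg) auto
      ultimately show "(\<Prod>i<n. ?p i) ^ d > 0" by linarith
    qed
    have low: "D m * inverse C \<le> ?p i" if "i \<in> K" for i
    proof -
      have "D m * nsq d (v i) \<le> frob_sq d (adjugate d (g m)) * ?p i" unfolding D_def by (rule adjugate_bound)
      also have "\<dots> \<le> C * ?p i" using 1 by (intro mult_right_mono) auto
      finally show ?thesis using unit[of i] that C by (simp add: K_def field_simps)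
    qed
    have "(D m * inverse C) ^ card K = (\<Prod>i\<in>K. D m * inverse C)" by simp
    also have "\<dots> \<le> (\<Prod>i\<in>K. ?p i)" using low Dpos C by (intro prod_mono) auto
    finally have "(D m * inverse C) ^ card K * (L / 2) \<le> (\<Prod>i\<in>K. ?p i) * (\<Prod>i\<in>{..<n} - K. ?p i)"
      using 2 L Dpos C by (intro mult_mono prod_nonneg) auto
    also have "\<dots> = (\<Prod>i<n. ?p i)" using prod.subset_diff[of K "{..<n}" ?p] KS by (simp add: mult.commute)
    finally have "((D m * inverse C) ^ card K * (L / 2)) ^ d \<le> (\<Prod>i<n. ?p i) ^ d"
      using L Dpos C by (intro power_mono) auto
    then have "c * ((D m * inverse C) ^ card K * (L / 2)) ^ d \<le> c * (\<Prod>i<n. ?p i) ^ d" using c by (intro mult_left_mono) auto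
    also have "\<dots> \<le> D m ^ n" using th[of m] pp unfolding theta_def Dn by (simp add: field_simps)
    finally have 3: "c * ((D m * inverse C) ^ card K * (L / 2)) ^ d \<le> D m ^ n" .
    have "((D m * inverse C) ^ card K * (L / 2)) ^ d = (D m ^ card K) ^ d * (inverse C ^ card K * (L / 2)) ^ d"
      by (simp only: power_mult_distrib mult.assoc)
    also have "(D m ^ card K) ^ d = D m ^ k" by (simp add: k_def power_mult[symmetric] mult.commute)
    finally have "e * D m ^ k \<le> D m ^ n" using 3 by (simp add: e_def mult_ac)
    also have "D m ^ n = D m ^ (n - k) * D m ^ k" using Kn by (simp add: k_def power_add[symmetric])
    finally show ?thesis using Dpos by simp
  qed
  have "\<forall>\<^sub>F m in sequentially. e \<le> D m ^ (n - k)"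
    using ev1 ev2 by eventually_elim (rule key)
  moreover have "(\<lambda>m. D m ^ (n - k)) \<longlonglongrightarrow> 0 ^ (n - k)" by (intro tendsto_power D0)
  ultimately have "e \<le> 0 ^ (n - k)" by (intro tendsto_lowerbound) auto
  moreover have "(0::real) ^ (n - k) = 0" using Kn by (intro zero_power) (simp add: k_def)
  ultimately show False using e by simp
qed

lemma prod_le_exp: "(\<And>i. i \<in> A \<Longrightarrow> 1 + x i \<ge> (0::real)) \<Longrightarrow> (\<Prod>i\<in>A. 1 + x i) \<le> exp (\<Sum>i\<in>A. x i)"
proof (cases "finite A")
  case True
  assume "\<And>i. i \<in> A \<Longrightarrow> 1 + x i \<ge> 0"
  then have "(\<Prod>i\<in>A. 1 + x i) \<le> (\<Prod>i\<in>A. exp (x i))"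
    by (intro prod_mono) auto
  then show ?thesis by (simp add: exp_sum True)
qed auto

lemma quadratic_nonneg_linear_zero:
  fixes B E :: real
  assumes "\<And>t. t * B + t\<^sup>2 * E \<ge> 0" "E \<ge> 0"
  shows "B = 0"
proof -
  have "(B / 2)\<^sup>2 \<le> 0 * E" using assms by (intro semi_Cauchy_Schwarz) auto
  then show ?thesis by simp
qed

lemma dt_elementary:
  assumes "k < d" "k \<noteq> l"
  shows "dt d (\<lambda>a b. (if a = b then 1 else 0) + (if a = k \<and> b = l then c else 0)) = (1 :: 'a::comm_ring_1)"
proof -
  have "mat d d (\<lambda>(a, b). (if a = b then 1 else 0) + (if a = k \<and> b = l then c else 0)) = addrow_mat d c k l"
    using assms by (intro eq_matI) auto
  then show ?thesis unfolding dt_def using det_addrow_mat[OF assms(2), of d c] by simp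
qed

lemma dt_elementary_diag:
  assumes "k < d"
  shows "dt d (\<lambda>a b. if a = b then (if a = k then c else 1) else 0) = (c :: 'a::comm_ring_1)"
proof -
  have "mat d d (\<lambda>(a, b). if a = b then (if a = k then c else 1) else 0) = multrow_mat d k c"
    using assms by (intro eq_matI) auto
  then show ?thesis unfolding dt_def using det_multrow_mat[OF assms, of c] by simp
qed

lemma nsq_delta: "k < d \<Longrightarrow> nsq d (\<lambda>a. if a = k then z else 0) = (norm z)\<^sup>2"
proof -
  assume k: "k < d"
  have "nsq d (\<lambda>a. if a = k then z else 0) = (\<Sum>a<d. if a = k then (norm z)\<^sup>2 else 0)"
    unfolding nsq_def by (intro sum.cong refl) simp
  then show ?thesis using k by simp
qed

lemma ip_delta: "k < d \<Longrightarrow> ip d x (\<lambda>a. if a = k then z else 0) = inner (x k) z"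
proof -
  assume k: "k < d"
  have "ip d x (\<lambda>a. if a = k then z else 0) = (\<Sum>a<d. if a = k then inner (x k) z else 0)"
    unfolding ip_def by (intro sum.cong refl) simp
  then show ?thesis using k by simp
qed

text \<open>It suffices to test elementary matrices.  The matrix \<open>I + t w E\<^sub>k\<^sub>l\<close> has determinant one, and by
  \<open>1 + x \<le> exp x\<close> the linear coefficient in \<open>t\<close> must vanish; for \<open>w\<close> the Gram entry \<open>(k, l)\<close> itself this
  coefficient is \<open>2 |w|\<^sup>2\<close>.  Scaling the \<open>k\<close>-th coordinate up gives \<open>\<Sum>\<^sub>i |u\<^sub>i\<^sub>k|\<^sup>2 \<ge> n/d\<close>; these \<open>d\<close> numbers add
  up to \<open>n\<close>, so all of them equal \<open>n/d\<close>.\<close>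
lemma stationary_imp_tight:
  fixes u :: "nat \<Rightarrow> nat \<Rightarrow> 'a::rc_scalar"
  assumes d: "d > 0" and unit: "\<And>i. i < n \<Longrightarrow> nsq d (u i) = 1"
    and opt: "\<And>h. norm (dt d h) ^ (2 * n) \<le> (\<Prod>i<n. nsq d (app d h (u i))) ^ d"
  shows "tight d n u"
proof -
  have off: "gram n u k l = 0" if kl: "k < d" "l < d" "k \<noteq> l" for k l
  proof -
    \<comment> \<open>The direction in which the first order condition is tested.\<close>
    define w where "w = gram n u k l"
    define B where "B = (\<Sum>i<n. 2 * inner (u i k) (w * u i l))"
    define E where "E = (\<Sum>i<n. (norm (w * u i l))\<^sup>2)"
    have "t * B + t\<^sup>2 * E \<ge> 0" for t
    proof -
      define h where "h = (\<lambda>a b. (if a = b then 1 else 0) + (if a = k \<and> b = l then of_real t * w else 0))"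
      have "dt d h = 1" unfolding h_def by (rule dt_elementary[OF kl(1,3)])
      have ah: "app d h x a = x a + (if a = k then t *\<^sub>R (w * x l) else 0)" if "a < d" for x a
      proof -
        have "(\<Sum>b<d. (if a = k \<and> b = l then of_real t * w else 0) * x b) = (if a = k then of_real t * w * x l else 0)"
          by (subst sum.mono_neutral_right[of _ "{l}"]) (use kl in auto)
        then show ?thesis unfolding app_def h_def distrib_right sum.distrib using app_idm[OF that, of 1 x]
          by (simp add: scaleR_conv_of_real mult.assoc)
      qed
      define x where "x = (\<lambda>i. t * (2 * inner (u i k) (w * u i l)) + t\<^sup>2 * (norm (w * u i l))\<^sup>2)"
      have ns: "nsq d (app d h (u i)) = 1 + x i" if "i < n" for i
      proof -
        have "nsq d (app d h (u i)) = nsq d (\<lambda>a. u i a + (if a = k then t *\<^sub>R (w * u i l) else 0))"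
          by (rule nsq_cong) (rule ah)
        also have "\<dots> = 1 + 2 * inner (u i k) (t *\<^sub>R (w * u i l)) + (norm (t *\<^sub>R (w * u i l)))\<^sup>2"
          unfolding nsq_add unit[OF that] nsq_delta[OF kl(1)] ip_delta[OF kl(1)] ..
        finally show ?thesis by (simp add: x_def power_mult_distrib)
      qed
      have "1 \<le> (\<Prod>i<n. nsq d (app d h (u i))) ^ d" using opt[of h] by (simp add: \<open>dt d h = 1\<close>)
      also have "(\<Prod>i<n. nsq d (app d h (u i))) = (\<Prod>i<n. 1 + x i)" using ns by (intro prod.cong) auto
      finally have "1 \<le> (\<Prod>i<n. 1 + x i) ^ d" .
      moreover have ge: "1 + x i \<ge> 0" if "i \<in> {..<n}" for i
        using nsq_nonneg[of d "app d h (u i)"] ns[of i] that by (simp del: nsq_nonneg)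
      have "(\<Prod>i<n. 1 + x i) \<ge> 0" by (rule prod_nonneg) (rule ge)
      ultimately have "1 \<le> (\<Prod>i<n. 1 + x i)" using power_strict_mono[of "\<Prod>i<n. 1 + x i" 1 d] d by fastforce
      also have "\<dots> \<le> exp (\<Sum>i<n. x i)" by (rule prod_le_exp) (rule ge)
      finally have "(\<Sum>i<n. x i) \<ge> 0" by simp
      then show ?thesis by (simp add: x_def sum.distrib B_def E_def sum_distrib_left)
    qed
    then have "B = 0" by (rule quadratic_nonneg_linear_zero) (simp add: E_def sum_nonneg)
    moreover have "inner (u i k) (w * u i l) = inner w (u i k * conjugate (u i l))" for i
      by (metis inner_commute inner_mult_left_conj mult.commute)
    ultimately have "inner w (gram n u k l) = 0" by (simp add: B_def gram_def inner_sum_right sum_distrib_left[symmetric])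
    then show ?thesis by (simp add: w_def)
  qed
  define W where "W = (\<lambda>k. \<Sum>i<n. (norm (u i k))\<^sup>2)"
  have Wge: "real d * W k \<ge> real n" if k: "k < d" for k
  proof (rule ccontr)
    assume "\<not> real d * W k \<ge> real n"
    then have lt: "real d * W k < real n" by simp
    have W0: "W k \<ge> 0" by (simp add: W_def sum_nonneg)
    \<comment> \<open>Letting \<open>b\<close> tend to one gives the claim; for \<open>W k = 0\<close> a single \<open>b\<close> is enough.\<close>
    have bound: "real n \<le> b * (real d * W k)" if b: "b > 1" for b
    proof -
      define c where "c = sqrt b"
      define h where "h = (\<lambda>a b. if a = b then (if a = k then of_real c else 1) else 0 :: 'a)"
      have c2: "c\<^sup>2 = b" using b by (simp add: c_def)
      have dh: "dt d h = of_real c" unfolding h_def by (rule dt_elementary_diag[OF k])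
      have ah: "app d h x a = (if a = k then c *\<^sub>R x a else x a)" if "a < d" for x a
        unfolding app_def h_def using app_idm[OF that, of "if a = k then of_real c else 1" x]
        by (simp add: scaleR_conv_of_real)
      have ns: "nsq d (app d h (u i)) = 1 + (b - 1) * (norm (u i k))\<^sup>2" if "i < n" for i
      proof -
        have "nsq d (app d h (u i)) = (\<Sum>a<d. (norm (u i a))\<^sup>2 + (if a = k then (b - 1) * (norm (u i k))\<^sup>2 else 0))"
          unfolding nsq_def by (intro sum.cong refl) (simp add: ah power_mult_distrib c2 algebra_simps)
        also have "\<dots> = nsq d (u i) + (b - 1) * (norm (u i k))\<^sup>2" using k by (simp add: sum.distrib nsq_def)
        finally show ?thesis using unit[OF that] by simp
      qed
      have "b ^ n = norm (dt d h) ^ (2 * n)" by (simp add: dh power_mult c2 power2_abs)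
      also have "\<dots> \<le> (\<Prod>i<n. nsq d (app d h (u i))) ^ d" by (rule opt)
      also have "(\<Prod>i<n. nsq d (app d h (u i))) = (\<Prod>i<n. 1 + (b - 1) * (norm (u i k))\<^sup>2)" using ns by (intro prod.cong) auto
      also have "(\<Prod>i<n. 1 + (b - 1) * (norm (u i k))\<^sup>2) ^ d \<le> exp (\<Sum>i<n. (b - 1) * (norm (u i k))\<^sup>2) ^ d"
        using b by (intro power_mono prod_le_exp prod_nonneg) (auto intro!: add_nonneg_nonneg)
      also have "\<dots> = exp (real d * ((b - 1) * W k))" unfolding exp_of_nat_mult by (simp only: W_def sum_distrib_left)
      finally have "b ^ n \<le> exp (real d * ((b - 1) * W k))" .
      then have "ln (b ^ n) \<le> ln (exp (real d * ((b - 1) * W k)))"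
        using b by (subst ln_le_cancel_iff) auto
      then have "ln (b ^ n) \<le> real d * ((b - 1) * W k)" by simp
      then have 1: "real n * ln b \<le> real d * ((b - 1) * W k)" using b by (simp add: ln_realpow)
      have "ln (1 / b) \<le> 1 / b - 1" using b by (intro ln_le_minus_one) simp
      then have "1 - 1 / b \<le> ln b" using b by (simp add: ln_div)
      then have "real n * (1 - 1 / b) \<le> real d * ((b - 1) * W k)" using 1 mult_left_mono[of "1 - 1 / b" "ln b" "real n"] by linarith
      then have "(b - 1) * real n \<le> (b - 1) * (b * (real d * W k))" using b by (simp add: field_simps)
      then show ?thesis using b by (simp add: mult_le_cancel_left)
    qed
    show False
    proof (cases "W k = 0")
      case True
      then show False using bound[of 2] lt by simp
    next
      case False
      then have p: "real d * W k > 0" using W0 d by simp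
      define z where "z = real n / (real d * W k)"
      define b where "b = (1 + z) / 2"
      have "z > 1" using lt p by (simp add: z_def)
      then have b: "b > 1" "b < real n / (real d * W k)" unfolding b_def z_def[symmetric] by simp_all
      then have "b * (real d * W k) < real n" using p by (simp add: field_simps)
      then show False using bound[OF b(1)] by linarith
    qed
  qed
  have "(\<Sum>k<d. W k) = (\<Sum>i<n. nsq d (u i))" unfolding W_def nsq_def by (rule sum.swap)
  also have "\<dots> = real n" using unit by simp
  finally have sumW: "(\<Sum>k<d. W k) = real n" .
  have "W k = real n / real d" if k: "k < d" for k
  proof -
    have "(\<Sum>k<d. W k - real n / real d) = 0" using d by (simp add: sum_subtractf sumW)
    moreover have "W k - real n / real d \<ge> 0" if "k \<in> {..<d}" for k using Wge[of k] that d by (simp add: field_simps)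
    ultimately have "\<forall>k\<in>{..<d}. W k - real n / real d = 0" using sum_nonneg_eq_0_iff[of "{..<d}" "\<lambda>k. W k - real n / real d"] by simp
    then show ?thesis using k by simp
  qed
  moreover have "gram n u k k = of_real (W k)" for k by (simp add: gram_def W_def mult_conj_self)
  ultimately show ?thesis unfolding tight_def using off by simp
qed

text \<open>The inverse of an isometry is an isometry, so an upper bound valid for all of them is also a
  lower bound.\<close>
lemma isometry_norm_dt_eq_1:
  fixes k :: "nat \<Rightarrow> nat \<Rightarrow> 'a::rc_scalar"
  assumes k: "isometry d k"
    and le: "\<And>k :: nat \<Rightarrow> nat \<Rightarrow> 'a. isometry d k \<Longrightarrow> norm (dt d k) \<le> 1"
  shows "norm (dt d k) = 1"
proof -
  obtain j where j: "\<And>x a. a < d \<Longrightarrow> app d k (app d j x) a = x a"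
    using dt_inverse[OF isometry_dt[OF k]] by metis
  have "nsq d (app d j x) = nsq d x" for x
  proof -
    have "nsq d (app d j x) = nsq d (app d k (app d j x))" using k unfolding isometry_def by simp
    also have "\<dots> = nsq d x" by (rule nsq_cong) (rule j)
    finally show ?thesis .
  qed
  then have "norm (dt d j) \<le> 1" by (intro le) (simp add: isometry_def)
  have "dt d k * dt d j = 1"
  proof -
    have "mat d d (\<lambda>(a, b). mmul d k j a b) = 1\<^sub>m d"
    proof (rule eq_matI)
      fix a b assume "a < dim_row (1\<^sub>m d :: 'a mat)" "b < dim_col (1\<^sub>m d :: 'a mat)"
      then have ab: "a < d" "b < d" by auto
      have "mmul d k j a b = app d (mmul d k j) (basis_vec b) a" using app_basis_vec[OF ab(2)] by metis
      also have "\<dots> = basis_vec b a" unfolding app_mmul by (rule j[OF ab(1)])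
      finally show "mat d d (\<lambda>(a, b). mmul d k j a b) $$ (a, b) = 1\<^sub>m d $$ (a, b)" using ab by (simp add: basis_vec_def)
    qed auto
    then have "dt d (mmul d k j) = 1" unfolding dt_def by (simp only: det_one)
    then show ?thesis by (simp add: dt_mmul)
  qed
  then have "norm (dt d k * dt d j) = 1" by simp
  then have "norm (dt d k) * norm (dt d j) = 1" by (simp only: norm_mult)
  moreover have "norm (dt d k) * norm (dt d j) \<le> norm (dt d k) * 1"
    using \<open>norm (dt d j) \<le> 1\<close> by (intro mult_left_mono) auto
  ultimately show ?thesis using le[OF k] by linarith
qed

lemma frob_sq_scale: "frob_sq d (\<lambda>a b. r *\<^sub>R g a b) = r\<^sup>2 * frob_sq d g"
  by (simp add: frob_sq_def power_mult_distrib sum_distrib_left)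

lemma frob_sq_nonneg: "frob_sq d g \<ge> 0"
  by (simp add: frob_sq_def sum_nonneg)

lemma frob_sq_zero_entry: "frob_sq d g = 0 \<Longrightarrow> a < d \<Longrightarrow> b < d \<Longrightarrow> g a b = 0"
proof -
  assume 0: "frob_sq d g = 0" and ab: "a < d" "b < d"
  have "\<forall>a\<in>{..<d}. (\<Sum>b<d. (norm (g a b))\<^sup>2) = 0"
    using 0 unfolding frob_sq_def by (subst (asm) sum_nonneg_eq_0_iff) (auto simp: sum_nonneg)
  then have "(\<Sum>b<d. (norm (g a b))\<^sup>2) = 0" using ab by simp
  then have "\<forall>b\<in>{..<d}. (norm (g a b))\<^sup>2 = 0" by (subst (asm) sum_nonneg_eq_0_iff) auto
  then show ?thesis using ab by simp
qed

lemma frob_sq_entry_le: "a < d \<Longrightarrow> b < d \<Longrightarrow> (norm (g a b))\<^sup>2 \<le> frob_sq d g"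
proof -
  assume ab: "a < d" "b < d"
  have "(norm (g a b))\<^sup>2 \<le> (\<Sum>b<d. (norm (g a b))\<^sup>2)" using ab by (intro member_le_sum) auto
  also have "\<dots> \<le> frob_sq d g" unfolding frob_sq_def using ab
    by (intro member_le_sum[of a "{..<d}" "\<lambda>a. \<Sum>b<d. (norm (g a b))\<^sup>2"]) (auto simp: sum_nonneg)
  finally show ?thesis .
qed

lemma frob_sq_pos_of_dt: "dt d g \<noteq> 0 \<Longrightarrow> d > 0 \<Longrightarrow> frob_sq d g > 0" for g :: "nat \<Rightarrow> nat \<Rightarrow> 'a::rc_scalar"
proof (rule ccontr)
  assume dt: "dt d g \<noteq> 0" and d: "d > 0" and "\<not> frob_sq d g > 0"
  then have 0: "frob_sq d g = 0" using frob_sq_nonneg[of d g] by linarith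
  have "nsq d (app d g (basis_vec 0)) > 0" using nsq_pos_app_pd[OF dt, of "basis_vec 0"] nsq_basis_vec[OF d, where 'a = 'a] by simp
  moreover have "app d g (basis_vec 0) a = 0" if "a < d" for a using frob_sq_zero_entry[OF 0 that d] by (simp add: app_basis_vec[OF d])
  then have "nsq d (app d g (basis_vec 0)) = 0" unfolding nsq_eq_0_iff by blast
  ultimately show False by simp
qed

lemma act_scale:
  assumes "r > 0"
  shows "act d (\<lambda>a b. r *\<^sub>R P a b) v i = act d P v i"
proof -
  have "app d (\<lambda>a b. r *\<^sub>R P a b) x = (\<lambda>a. r *\<^sub>R app d P x a)" for x
    by (simp add: fun_eq_iff app_def scaleR_sum_right)
  then show ?thesis using assms unfolding act_def normalised_def
    by (simp add: nsq_scale real_sqrt_mult)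
qed

lemma theta_pos_dt: "theta d n v g > 0 \<Longrightarrow> n > 0 \<Longrightarrow> dt d g \<noteq> 0"
  by (auto simp: theta_def zero_power)

text \<open>A maximiser \<open>g\<close> of \<open>theta\<close> exists among matrices of norm one, by \<open>theta_proper\<close>.  Multiplicativity
  of the determinant turns maximality of \<open>g\<close> for \<open>v\<close> into maximality of the identity for the
  rescaled tuple, which is the hypothesis of \<open>stationary_imp_tight\<close>.  Multiplying \<open>g\<close> by an isometry
  preserves that condition, so \<open>g\<close> may be replaced by its polar factor.\<close>
lemma tight_scaling_exists:
  fixes v :: "nat \<Rightarrow> nat \<Rightarrow> 'a::rc_scalar"
  assumes d: "d > 0" and st: "stable d n v" and unit: "\<And>i. i < n \<Longrightarrow> nsq d (v i) = 1"
  obtains P where "pd d P" "tight d n (act d P v)"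
proof -
  have n: "n > 0"
  proof -
    have "\<exists>a<d. (basis_vec 0 :: nat \<Rightarrow> 'a) a \<noteq> 0" using d by (auto simp: basis_vec_def)
    from stableD[OF st this] show ?thesis by simp
  qed
  define T where "T = theta d n v"
  \<comment> \<open>The bound \<open>1\<close> is the value of \<open>theta\<close> at the identity; it keeps limits invertible.\<close>
  define S where "S = {x :: nat \<times> nat \<Rightarrow> 'a. frob_sq d (\<lambda>a b. x (a, b)) = 1 \<and> T (\<lambda>a b. x (a, b)) \<ge> 1}"
  have scal: "\<exists>x\<in>S. T (\<lambda>a b. x (a, b)) = T g" if g: "dt d g \<noteq> 0" "T g \<ge> 1" for g
  proof -
    have p: "frob_sq d g > 0" by (rule frob_sq_pos_of_dt[OF g(1) d])
    define r where "r = 1 / sqrt (frob_sq d g)"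
    have r: "r \<noteq> 0" "r\<^sup>2 * frob_sq d g = 1" using p by (simp_all add: r_def power_divide)
    have "(\<lambda>(a, b). r *\<^sub>R g a b) \<in> S" using r g(2) by (simp add: S_def frob_sq_scale T_def theta_scale)
    moreover have "T (\<lambda>a b. (\<lambda>(a, b). r *\<^sub>R g a b) (a, b)) = T g" using r by (simp add: T_def theta_scale)
    ultimately show ?thesis by blast
  qed
  have "T idm = 1"
  proof -
    have "nsq d (app d idm (v i)) = 1" if "i < n" for i
      using nsq_cong[of d "app d idm (v i)" "v i"] app_idm' unit[OF that] by metis
    then show ?thesis by (simp add: T_def theta_def dt_idm)
  qed
  then have ne: "S \<noteq> {}" using scal[of idm] by (auto simp: dt_idm)
  obtain x where x: "x \<in> S" "\<And>y. y \<in> S \<Longrightarrow> T (\<lambda>a b. y (a, b)) \<le> T (\<lambda>a b. x (a, b))"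
  proof (rule sequential_attains_max[of "{..<d} \<times> {..<d}" S 1 "\<lambda>x. T (\<lambda>a b. x (a, b))"])
    fix x :: "nat \<times> nat \<Rightarrow> 'a" and i assume x: "x \<in> S" and i: "i \<in> {..<d} \<times> {..<d}"
    obtain a b where ab: "i = (a, b)" "a < d" "b < d" using i by auto
    have "(norm (x (a, b)))\<^sup>2 \<le> frob_sq d (\<lambda>a b. x (a, b))" using frob_sq_entry_le[OF ab(2,3), of "\<lambda>a b. x (a, b)"] .
    then show "norm (x i) \<le> 1" using x ab by (simp add: S_def abs_square_le_1)
  next
    fix x :: "nat \<Rightarrow> nat \<times> nat \<Rightarrow> 'a" and l
    assume x: "\<And>m. x m \<in> S" "\<And>i. i \<in> {..<d} \<times> {..<d} \<Longrightarrow> (\<lambda>m. x m i) \<longlonglongrightarrow> l i"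
    have lim: "(\<lambda>m. x m (a, b)) \<longlonglongrightarrow> l (a, b)" if "a < d" "b < d" for a b using x(2) that by simp
    have "(\<lambda>m. frob_sq d (\<lambda>a b. x m (a, b))) \<longlonglongrightarrow> frob_sq d (\<lambda>a b. l (a, b))"
      unfolding frob_sq_def using lim by (intro tendsto_sum tendsto_power tendsto_norm) auto
    then have f1: "frob_sq d (\<lambda>a b. l (a, b)) = 1" using x(1) by (simp add: S_def LIMSEQ_const_iff)
    have "\<exists>a<d. \<exists>b<d. l (a, b) \<noteq> 0"
    proof (rule ccontr)
      assume "\<not> ?thesis"
      then have "frob_sq d (\<lambda>a b. l (a, b)) = 0" by (simp add: frob_sq_def)
      then show False using f1 by simp
    qed
    then have dl: "dt d (\<lambda>a b. l (a, b)) \<noteq> 0"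
    proof (intro theta_proper[where c = 1 and g = "\<lambda>m a b. x m (a, b)" and d = d and n = n and v = v])
      show "1 \<le> theta d n v (\<lambda>a b. x m (a, b))" for m using x(1)[of m] by (simp add: S_def T_def)
    qed (use st unit lim in auto)
    have "(\<lambda>m. T (\<lambda>a b. x m (a, b))) \<longlonglongrightarrow> T (\<lambda>a b. l (a, b))"
      unfolding T_def theta_def
    proof (intro tendsto_divide tendsto_power tendsto_norm tendsto_prod)
      show "(\<lambda>m. dt d (\<lambda>a b. x m (a, b))) \<longlonglongrightarrow> dt d (\<lambda>a b. l (a, b))" using lim by (rule tendsto_dt)
      show "(\<lambda>m. nsq d (app d (\<lambda>a b. x m (a, b)) (v i))) \<longlonglongrightarrow> nsq d (app d (\<lambda>a b. l (a, b)) (v i))" for i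
        using lim by (intro tendsto_nsq tendsto_app tendsto_const) auto
      have "nsq d (app d (\<lambda>a b. l (a, b)) (v i)) \<noteq> 0" if "i < n" for i
        using nsq_pos_app_pd[OF dl, of "v i"] unit[OF that] by simp
      then show "(\<Prod>i<n. nsq d (app d (\<lambda>a b. l (a, b)) (v i))) ^ d \<noteq> 0" by simp
    qed
    moreover from this have "T (\<lambda>a b. l (a, b)) \<ge> 1"
      using x(1) by (intro LIMSEQ_le_const) (auto simp: S_def)
    ultimately show "l \<in> S \<and> (\<lambda>m. T (\<lambda>a b. x m (a, b))) \<longlonglongrightarrow> T (\<lambda>a b. l (a, b))"
      using f1 by (simp add: S_def)
  qed (use ne in auto)
  define g where "g = (\<lambda>a b. x (a, b))"
  have Tg: "T g \<ge> 1" using x(1) by (simp add: S_def g_def)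
  have dg: "dt d g \<noteq> 0" using Tg n by (intro theta_pos_dt[of d n v]) (simp_all add: T_def)
  have gmax: "T h \<le> T g" if h: "dt d h \<noteq> 0" for h
  proof (cases "T h \<ge> 1")
    case True
    then show ?thesis using scal[OF h] x(2) unfolding g_def by metis
  qed (use Tg in simp)
  define p where "p = (\<lambda>i. nsq d (app d g (v i)))"
  have p: "p i > 0" if "i < n" for i using nsq_pos_app_pd[OF dg, of "v i"] unit[OF that] by (simp add: p_def)
  define u where "u = act d g v"
  have u: "u i = (\<lambda>a. (1 / sqrt (p i)) *\<^sub>R app d g (v i) a)" for i by (simp add: u_def act_def normalised_def p_def)
  have opt: "norm (dt d h) ^ (2 * n) \<le> (\<Prod>i<n. nsq d (app d h (u i))) ^ d" for h
  proof (cases "dt d h = 0")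
    case True
    then show ?thesis using n by (simp add: prod_nonneg zero_power)
  next
    case False
    have dhg: "dt d (mmul d h g) \<noteq> 0" using False dg by (simp add: dt_mmul)
    define q where "q = (\<lambda>i. nsq d (app d h (app d g (v i))))"
    have qe: "nsq d (app d (mmul d h g) (v i)) = q i" for i
      unfolding q_def by (rule nsq_cong) (rule app_mmul)
    have q: "q i > 0" if "i < n" for i
      using nsq_pos_app_pd[OF dhg, of "v i"] unit[OF that] by (simp add: qe)
    have "nsq d (app d h (u i)) = q i / p i" if "i < n" for i
      using p[OF that] unfolding u app_scale nsq_scale q_def by (simp add: power_divide)
    then have e: "(\<Prod>i<n. nsq d (app d h (u i))) ^ d = (\<Prod>i<n. q i) ^ d / (\<Prod>i<n. p i) ^ d"
      by (simp add: prod_dividef power_divide)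
    have P: "(\<Prod>i<n. p i) ^ d > 0" "(\<Prod>i<n. q i) ^ d > 0" using p q by (auto intro!: zero_less_power prod_pos)
    have "T (mmul d h g) \<le> T g" by (rule gmax[OF dhg])
    then have "norm (dt d h) ^ (2 * n) * norm (dt d g) ^ (2 * n) / (\<Prod>i<n. q i) ^ d \<le> norm (dt d g) ^ (2 * n) / (\<Prod>i<n. p i) ^ d"
      unfolding T_def theta_def qe by (simp add: dt_mmul norm_mult power_mult_distrib p_def)
    moreover have "norm (dt d g) ^ (2 * n) > 0" using dg by simp
    ultimately show ?thesis unfolding e using P by (simp add: field_simps)
  qed
  have uu: "nsq d (u i) = 1" if "i < n" for i
    using p[OF that] unfolding u_def act_def by (intro nsq_normalised) (simp add: p_def)
  obtain k where k: "isometry d k" "psd d (mmul d k g)" by (rule polar_decomposition)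
  have dk: "norm (dt d k) = 1"
  proof (rule isometry_norm_dt_eq_1[OF k(1)])
    fix k :: "nat \<Rightarrow> nat \<Rightarrow> 'a" assume "isometry d k"
    then have "(\<Prod>i<n. nsq d (app d k (u i))) ^ d = 1" using uu unfolding isometry_def by simp
    then have "norm (dt d k) ^ (2 * n) \<le> 1" using opt[of k] by simp
    then show "norm (dt d k) \<le> 1" using n one_less_power[of "norm (dt d k)" "2 * n"] by fastforce
  qed
  define P where "P = mmul d k g"
  have "dt d P \<noteq> 0" using isometry_dt[OF k(1)] dg by (simp add: P_def dt_mmul)
  then have pdP: "pd d P" using k(2) by (simp add: pd_def P_def)
  have aP: "act d P v i = app d k (u i)" for i
  proof -
    have e: "app d P (v i) = app d k (app d g (v i))" unfolding P_def by (rule ext) (rule app_mmul)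
    have "nsq d (app d P (v i)) = p i" unfolding e p_def using k(1) unfolding isometry_def by blast
    then show ?thesis unfolding act_def normalised_def u app_scale by (simp only: e)
  qed
  have "tight d n (act d P v)"
  proof (rule stationary_imp_tight[OF d])
    show "nsq d (act d P v i) = 1" if "i < n" for i
      using uu[OF that] k(1) unfolding aP isometry_def by simp
    show "norm (dt d h) ^ (2 * n) \<le> (\<Prod>i<n. nsq d (app d h (act d P v i))) ^ d" for h
    proof -
      have "app d (mmul d h k) (u i) = app d h (act d P v i)" for i unfolding aP by (rule ext) (rule app_mmul)
      then show ?thesis using opt[of "mmul d h k"] by (simp add: dt_mmul norm_mult power_mult_distrib dk)
    qed
  qed
  then show ?thesis using that pdP by blast
qed

section \<open>Continuity of the rescaling at stable tuples\<close>

lemma LIMSEQ_by_subsequences: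
  fixes x :: "nat \<Rightarrow> 'a::metric_space"
  assumes "\<And>r. strict_mono (r :: nat \<Rightarrow> nat) \<Longrightarrow> \<exists>r'. strict_mono (r' :: nat \<Rightarrow> nat) \<and> (\<lambda>m. x (r (r' m))) \<longlonglongrightarrow> l"
  shows "x \<longlonglongrightarrow> l"
proof (rule ccontr)
  assume "\<not> x \<longlonglongrightarrow> l"
  then obtain e where e: "e > 0" "\<forall>N. \<exists>m\<ge>N. dist (x m) l \<ge> e"
    unfolding lim_sequentially by (meson not_le)
  then have "infinite {m. dist (x m) l \<ge> e}" unfolding infinite_nat_iff_unbounded_le by blast
  then obtain r where r: "strict_mono (r :: nat \<Rightarrow> nat)" "\<And>m. dist (x (r m)) l \<ge> e"
    using infinite_enumerate by blast
  obtain r' where "(\<lambda>m. x (r (r' m))) \<longlonglongrightarrow> l" using assms[OF r(1)] by blast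
  then have "\<exists>m. dist (x (r (r' m))) l < e" using e(1) unfolding lim_sequentially by blast
  then show False using r(2) by (meson not_le)
qed

lemma tendsto_gram:
  assumes "\<And>i. i < n \<Longrightarrow> ((\<lambda>m. u m i a) \<longlongrightarrow> u' i a) F" "\<And>i. i < n \<Longrightarrow> ((\<lambda>m. u m i b) \<longlongrightarrow> u' i b) F"
  shows "((\<lambda>m. gram n (u m) a b) \<longlongrightarrow> gram n u' a b) F"
  unfolding gram_def using assms by (intro tendsto_sum tendsto_mult tendsto_conj) auto

lemma tight_limit:
  assumes "\<And>m::nat. tight d n (u m)" "\<And>i a. i < n \<Longrightarrow> a < d \<Longrightarrow> (\<lambda>m. u m i a) \<longlonglongrightarrow> u' i a"
  shows "tight d n u'"
  unfolding tight_def
proof (intro allI impI)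
  fix a b assume ab: "a < d" "b < d"
  have "(\<lambda>m. gram n (u m) a b) \<longlonglongrightarrow> gram n u' a b" using assms(2) ab by (intro tendsto_gram) auto
  then show "gram n u' a b = (if a = b then of_real (real n / real d) else 0)"
    unfolding tightD[OF assms(1) ab] by (simp only: LIMSEQ_const_iff)
qed

lemma psd_limit:
  assumes "\<And>m::nat. psd d (P m)" "\<And>a b. a < d \<Longrightarrow> b < d \<Longrightarrow> (\<lambda>m. P m a b) \<longlonglongrightarrow> Q a b"
  shows "psd d Q"
proof -
  have "Q a b = conjugate (Q b a)" if ab: "a < d" "b < d" for a b
  proof -
    have "(\<lambda>m. conjugate (P m b a)) \<longlonglongrightarrow> conjugate (Q b a)" using assms(2) ab by (intro tendsto_conj)
    moreover have "conjugate (P m b a) = P m a b" for m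
      using assms(1)[of m] ab unfolding psd_def selfadj_def by (metis conjugate_id)
    ultimately have "(\<lambda>m. P m a b) \<longlonglongrightarrow> conjugate (Q b a)" by simp
    then show ?thesis using assms(2)[OF ab] by (rule LIMSEQ_unique[rotated])
  qed
  moreover have "ip d (app d Q x) x \<ge> 0" for x
  proof -
    have "(\<lambda>m. ip d (app d (P m) x) x) \<longlonglongrightarrow> ip d (app d Q x) x"
      using assms(2) by (intro tendsto_ip tendsto_app tendsto_const) auto
    then show ?thesis using assms(1) unfolding psd_def by (intro LIMSEQ_le_const) auto
  qed
  ultimately show ?thesis unfolding psd_def selfadj_def by blast
qed

text \<open>Scale the \<open>Q m\<close> to norm one and let \<open>M\<close> be the limit of a subsequence along which the rescaled
  tuples converge to some \<open>U\<close>, which is tight.  If \<open>M\<close> is invertible, then \<open>U\<close> is the rescaling of \<open>v\<close> by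
  \<open>M\<close>, and \<open>tight_action_unique\<close> identifies it.  If \<open>M f = 0\<close> with \<open>f \<noteq> 0\<close>, then \<open>U\<^sub>i\<close> is in the range of \<open>M\<close>,
  hence orthogonal to \<open>f\<close>, unless \<open>M v\<^sub>i = 0\<close>.  As \<open>M \<noteq> 0\<close>, stability leaves fewer than \<open>n/d\<close> such \<open>i\<close>, too
  few for \<open>\<Sum>\<^sub>i |\<langle>f, U\<^sub>i\<rangle>|\<^sup>2 = (n/d) |f|\<^sup>2\<close>.\<close>
lemma tight_action_sequence:
  fixes v :: "nat \<Rightarrow> nat \<Rightarrow> 'a::rc_scalar"
  assumes d: "d \<ge> 2" and st: "stable d n v" and unit: "\<And>i. i < n \<Longrightarrow> nsq d (v i) = 1"
    and P: "pd d P" "tight d n (act d P v)"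
    and um: "\<And>m i. i < n \<Longrightarrow> nsq d (w m i) = 1"
    and lim: "\<And>i a. i < n \<Longrightarrow> a < d \<Longrightarrow> (\<lambda>m. w m i a) \<longlonglongrightarrow> v i a"
    and Pm: "\<And>m. pd d (Q m)" "\<And>m. tight d n (act d (Q m) (w m))"
    and i: "i < n" and a: "a < d"
  shows "(\<lambda>m. act d (Q m) (w m) i a) \<longlonglongrightarrow> act d P v i a"
proof (rule LIMSEQ_by_subsequences)
  fix r :: "nat \<Rightarrow> nat" assume r: "strict_mono r"
  have d0: "d > 0" using d by simp
  define c where "c = (\<lambda>m. 1 / sqrt (frob_sq d (Q m)))"
  have fp: "frob_sq d (Q m) > 0" for m using Pm(1) d0 unfolding pd_def by (intro frob_sq_pos_of_dt) auto
  have c: "c m > 0" "(c m)\<^sup>2 * frob_sq d (Q m) = 1" for m using fp[of m] by (simp_all add: c_def power_divide)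
  define N where "N = (\<lambda>m a b. c m *\<^sub>R Q m a b)"
  have fN: "frob_sq d (N m) = 1" for m using c(2)[of m] by (simp add: N_def frob_sq_scale)
  have aN: "act d (N m) (w m) = act d (Q m) (w m)" for m
    unfolding N_def by (rule ext) (rule act_scale[OF c(1)])
  have Npsd: "psd d (N m)" for m
  proof -
    have Q: "psd d (Q m)" using Pm(1) unfolding pd_def by blast
    have "selfadj d (N m)" unfolding selfadj_def N_def conj_scaleR using Q unfolding psd_def selfadj_def by metis
    moreover have "app d (N m) x = (\<lambda>a. c m *\<^sub>R app d (Q m) x a)" for x
      by (simp add: fun_eq_iff app_def scaleR_sum_right N_def)
    then have "ip d (app d (N m) x) x \<ge> 0" for x using Q c(1)[of m] unfolding psd_def by (simp add: ip_linear)
    ultimately show ?thesis unfolding psd_def by blast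
  qed
  define u where "u = (\<lambda>m. act d (Q m) (w m))"
  have uunit: "nsq d (u m i) = 1" if "i < n" for m i
  proof -
    have "dt d (Q m) \<noteq> 0" using Pm(1) unfolding pd_def by blast
    then have "nsq d (app d (Q m) (w m i)) > 0" using um[OF that] by (intro nsq_pos_app_pd) auto
    then show ?thesis unfolding u_def act_def by (intro nsq_normalised) simp
  qed
  define X where "X = (\<lambda>m (a, b). N (r m) a b)"
  have Xb: "norm (X m j) \<le> 1" if j: "j \<in> {..<d} \<times> {..<d}" for m j
  proof -
    obtain a b where ab: "j = (a, b)" "a < d" "b < d" using j by auto
    have "(norm (N (r m) a b))\<^sup>2 \<le> 1" using frob_sq_entry_le[OF ab(2,3), of "N (r m)"] fN by simp
    then show ?thesis using ab by (simp add: abs_square_le_1 X_def)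
  qed
  have "finite ({..<d} \<times> {..<d})" by simp
  then obtain L r1 where r1: "strict_mono (r1 :: nat \<Rightarrow> nat)"
      "\<And>j. j \<in> {..<d} \<times> {..<d} \<Longrightarrow> (\<lambda>m. X (r1 m) j) \<longlonglongrightarrow> L j"
    using bounded_sequence_subsequence[of "{..<d} \<times> {..<d}" X 1] Xb by metis
  define Y where "Y = (\<lambda>m (i, a). u (r (r1 m)) i a)"
  have Yb: "norm (Y m j) \<le> 1" if j: "j \<in> {..<n} \<times> {..<d}" for m j
  proof -
    obtain i a where ab: "j = (i, a)" "i < n" "a < d" using j by auto
    have "(norm (u (r (r1 m)) i a))\<^sup>2 \<le> 1" using norm_le_nsq[OF ab(3), of "u (r (r1 m)) i"] uunit[OF ab(2)] by simp
    then show ?thesis using ab by (simp add: abs_square_le_1 Y_def)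
  qed
  have "finite ({..<n} \<times> {..<d})" by simp
  then obtain U r2 where r2: "strict_mono (r2 :: nat \<Rightarrow> nat)"
      "\<And>j. j \<in> {..<n} \<times> {..<d} \<Longrightarrow> (\<lambda>m. Y (r2 m) j) \<longlonglongrightarrow> U j"
    using bounded_sequence_subsequence[of "{..<n} \<times> {..<d}" Y 1] Yb by metis
  define s where "s = (\<lambda>m. r (r1 (r2 m)))"
  have smono: "strict_mono s" using strict_mono_o[OF r strict_mono_o[OF r1(1) r2(1)]] by (simp add: s_def o_def)
  define M where "M = (\<lambda>a b. L (a, b))"
  have limN: "(\<lambda>m. N (s m) a b) \<longlonglongrightarrow> M a b" if "a < d" "b < d" for a b
    using LIMSEQ_subseq_LIMSEQ[OF r1(2)[of "(a, b)"] r2(1)] that by (simp add: M_def s_def o_def X_def)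
  have limu: "(\<lambda>m. u (s m) i a) \<longlonglongrightarrow> U (i, a)" if "i < n" "a < d" for i a
    using r2(2)[of "(i, a)"] that by (simp add: s_def Y_def)
  have limw: "(\<lambda>m. w (s m) i a) \<longlonglongrightarrow> v i a" if "i < n" "a < d" for i a
    using LIMSEQ_subseq_LIMSEQ[OF lim[OF that] smono] by (simp add: o_def)
  have Mpsd: "psd d M" by (rule psd_limit[of d "\<lambda>m. N (s m)"]) (rule Npsd, rule limN)
  have Mfn: "frob_sq d M = 1"
  proof -
    have "(\<lambda>m. frob_sq d (N (s m))) \<longlonglongrightarrow> frob_sq d M"
      unfolding frob_sq_def using limN by (intro tendsto_sum tendsto_power tendsto_norm) auto
    then show ?thesis by (simp add: fN LIMSEQ_const_iff)
  qed
  have Ut: "tight d n (\<lambda>i a. U (i, a))"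
  proof (rule tight_limit[of d n "\<lambda>m. u (s m)"])
    show "tight d n (u (s m))" for m unfolding u_def by (rule Pm(2))
  qed (rule limu)
  have limNw: "(\<lambda>m. app d (N (s m)) (w (s m) i) a) \<longlonglongrightarrow> app d M (v i) a" if "i < n" "a < d" for i a
    using limN limw[OF that(1)] that(2) by (intro tendsto_app)
  have limact: "U (i, a) = act d M v i a" if "i < n" "a < d" and nz: "nsq d (app d M (v i)) \<noteq> 0" for i a
  proof -
    have "(\<lambda>m. normalised d (app d (N (s m)) (w (s m) i)) a) \<longlonglongrightarrow> normalised d (app d M (v i)) a"
      using limNw[OF that(1)] nz that(2) by (rule tendsto_normalised)
    then have "(\<lambda>m. u (s m) i a) \<longlonglongrightarrow> act d M v i a" by (simp add: u_def act_def[symmetric] aN)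
    then show ?thesis using limu[OF that(1,2)] by (rule LIMSEQ_unique[rotated])
  qed
  have "dt d M \<noteq> 0"
  proof
    assume "dt d M = 0"
    then obtain f where f: "\<exists>a<d. f a \<noteq> 0" "\<And>a. a < d \<Longrightarrow> app d M f a = 0"
      using dt_zero_kernel by metis
    have fpos: "nsq d f > 0" unfolding nsq_pos_iff by (rule f(1))
    define K where "K = {i. i < n \<and> nsq d (app d M (v i)) = 0}"
    have KS: "K \<subseteq> {..<n}" by (auto simp: K_def)
    have z: "hp d f (\<lambda>a. U (i, a)) = 0" if "i \<in> {..<n} - K" for i
    proof -
      have in_: "i < n" "nsq d (app d M (v i)) \<noteq> 0" using that by (auto simp: K_def)
      have "hp d f (\<lambda>a. U (i, a)) = hp d f (act d M v i)"
        unfolding hp_def by (intro sum.cong refl) (simp add: limact[OF in_(1) _ in_(2)])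
      also have "\<dots> = (1 / sqrt (nsq d (app d M (v i)))) *\<^sub>R hp d f (app d M (v i))"
        by (simp add: hp_def act_def normalised_def conj_scaleR scaleR_sum_right)
      also have "hp d f (app d M (v i)) = hp d (app d M f) (v i)"
        using hp_selfadj[of d M f "v i"] Mpsd unfolding psd_def by simp
      also have "\<dots> = 0" unfolding hp_def using f(2) by (intro sum.neutral) simp
      finally show ?thesis by simp
    qed
    have Uunit: "nsq d (\<lambda>a. U (i, a)) = 1" if "i < n" for i
    proof -
      have "(\<lambda>m. nsq d (u (s m) i)) \<longlonglongrightarrow> nsq d (\<lambda>a. U (i, a))" using limu[OF that] by (rule tendsto_nsq)
      then show ?thesis by (simp add: uunit[OF that] LIMSEQ_const_iff)
    qed
    have "real n / real d * nsq d f = (\<Sum>i<n. (norm (hp d f (\<lambda>a. U (i, a))))\<^sup>2)"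
      using tight_frame_identity[OF Ut] by simp
    also have "\<dots> = (\<Sum>i\<in>K. (norm (hp d f (\<lambda>a. U (i, a))))\<^sup>2)"
      using KS z by (intro sum.mono_neutral_right) auto
    also have "\<dots> \<le> (\<Sum>i\<in>K. nsq d f)"
    proof (rule sum_mono)
      fix i assume "i \<in> K"
      then have "i < n" by (simp add: K_def)
      from norm_hp_le[of d f "\<lambda>a. U (i, a)"] show "(norm (hp d f (\<lambda>a. U (i, a))))\<^sup>2 \<le> nsq d f"
        by (simp add: Uunit[OF \<open>i < n\<close>])
    qed
    finally have "real n / real d * nsq d f \<le> real (card K) * nsq d f" by simp
    then have "real n / real d \<le> real (card K)" using fpos by (rule mult_right_le_imp_le)
    then have le: "real n \<le> real (d * card K)" using d0 by (simp add: field_simps)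
    have "\<exists>a0<d. \<exists>b0<d. M a0 b0 \<noteq> 0"
    proof (rule ccontr)
      assume "\<not> ?thesis"
      then have "frob_sq d M = 0" by (simp add: frob_sq_def)
      then show False using Mfn by simp
    qed
    then obtain a0 b0 where ab: "a0 < d" "b0 < d" "M a0 b0 \<noteq> 0" by blast
    define h where "h = (\<lambda>b. conjugate (M a0 b))"
    have hh: "hp d h y = conjugate (app d M y a0)" for y
      by (simp only: hp_def h_def app_def conj_sum conjugate_dist_mul)
    have "h b0 \<noteq> 0" using ab by (simp add: h_def)
    then have "\<exists>b<d. h b \<noteq> 0" using ab(2) by blast
    then have 1: "d * card {i. i < n \<and> hp d h (v i) = 0} < n" by (rule stableD[OF st])
    have "K \<subseteq> {i. i < n \<and> hp d h (v i) = 0}" unfolding K_def hh nsq_eq_0_iff using ab(1) by auto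
    then have "card K \<le> card {i. i < n \<and> hp d h (v i) = 0}" by (intro card_mono) auto
    then have "d * card K < n" using 1 by (meson le_less_trans mult_le_mono2)
    then show False using le by (simp flip: of_nat_mult)
  qed
  then have Mpd: "pd d M" using Mpsd by (simp add: pd_def)
  have nz: "nsq d (app d M (v i)) \<noteq> 0" if "i < n" for i
    using nsq_pos_app_pd[OF \<open>dt d M \<noteq> 0\<close>, of "v i"] unit[OF that] by simp
  have "tight d n (act d M v)"
    unfolding tight_def
  proof (intro allI impI)
    fix a b assume ab: "a < d" "b < d"
    have "gram n (act d M v) a b = gram n (\<lambda>i a. U (i, a)) a b"
      unfolding gram_def using limact nz ab by (intro sum.cong refl) simp
    then show "gram n (act d M v) a b = (if a = b then of_real (real n / real d) else 0)"
      using tightD[OF Ut ab] by simp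
  qed
  then have "act d M v i a = act d P v i a"
    using tight_action_unique[OF d st unit Mpd _ P i a] by blast
  then have "(\<lambda>m. u (s m) i a) \<longlonglongrightarrow> act d P v i a" using limu[OF i a] limact[OF i a nz[OF i]] by simp
  then show "\<exists>r'. strict_mono (r' :: nat \<Rightarrow> nat) \<and> (\<lambda>m. act d (Q (r (r' m))) (w (r (r' m))) i a) \<longlonglongrightarrow> act d P v i a"
    using strict_mono_o[OF r1(1) r2(1)] by (intro exI[of _ "r1 \<circ> r2"]) (simp add: u_def s_def)
qed

section \<open>The retraction onto tight tuples\<close>

text \<open>On stable tuples the chosen \<open>P\<close> does not matter, by \<open>tight_action_unique\<close>.  For a tight tuple
  the identity could be chosen; the case distinction makes \<open>tighten\<close> fix it as a function, also at
  indices out of range.\<close>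
definition tighten :: "nat \<Rightarrow> nat \<Rightarrow> (nat \<Rightarrow> nat \<Rightarrow> 'a::rc_scalar) \<Rightarrow> nat \<Rightarrow> nat \<Rightarrow> 'a" where
  "tighten d n v = (if tight d n v then v else act d (SOME P. pd d P \<and> tight d n (act d P v)) v)"

definition unit_tuple :: "nat \<Rightarrow> nat \<Rightarrow> (nat \<Rightarrow> nat \<Rightarrow> 'a::rc_scalar) \<Rightarrow> bool" where
  "unit_tuple d n v \<longleftrightarrow> (\<forall>i<n. nsq d (v i) = 1)"

lemma pd_idm: "pd d (idm :: nat \<Rightarrow> nat \<Rightarrow> 'a::rc_scalar)"
proof -
  have "ip d (app d idm x) x = nsq d x" for x :: "nat \<Rightarrow> 'a"
    unfolding ip_self[symmetric] by (rule ip_cong) (simp_all add: app_idm')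
  then have "psd d (idm :: nat \<Rightarrow> nat \<Rightarrow> 'a)" unfolding psd_def selfadj_def by auto
  then show ?thesis by (simp add: pd_def dt_idm)
qed

lemma act_idm: "unit_tuple d n v \<Longrightarrow> i < n \<Longrightarrow> a < d \<Longrightarrow> act d idm v i a = v i a"
proof -
  assume v: "unit_tuple d n v" "i < n" "a < d"
  have "nsq d (app d idm (v i)) = nsq d (v i)" by (rule nsq_cong) (rule app_idm')
  then show ?thesis using v unfolding act_def normalised_def by (simp add: app_idm' unit_tuple_def)
qed

lemma tight_cong:
  assumes "\<And>i a. i < n \<Longrightarrow> a < d \<Longrightarrow> v i a = w i a"
  shows "tight d n v = tight d n w"
proof -
  have "gram n v a b = gram n w a b" if "a < d" "b < d" for a b
    unfolding gram_def using assms that by (intro sum.cong refl) simp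
  then show ?thesis unfolding tight_def by simp
qed

text \<open>The identity serves as \<open>P\<close> for tight tuples, so that both kinds of tuples can be handled in the
  same way.\<close>
lemma tighten_action:
  fixes v :: "nat \<Rightarrow> nat \<Rightarrow> 'a::rc_scalar"
  assumes d: "d > 0" and v: "unit_tuple d n v" "stable d n v \<or> tight d n v"
  obtains P where "pd d P" "tight d n (act d P v)" "\<And>i a. i < n \<Longrightarrow> a < d \<Longrightarrow> tighten d n v i a = act d P v i a"
proof (cases "tight d n v")
  case True
  have "tight d n (act d idm v) = tight d n v" using act_idm[OF v(1)] by (intro tight_cong)
  then show ?thesis using that[OF pd_idm] act_idm[OF v(1)] True by (simp add: tighten_def)
next
  case False
  then have "stable d n v" using v(2) by blast
  moreover have "\<And>i. i < n \<Longrightarrow> nsq d (v i) = 1" using v(1) unfolding unit_tuple_def by blast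
  ultimately obtain P where "pd d P" "tight d n (act d P v)" using tight_scaling_exists[OF d] by metis
  then have "pd d P \<and> tight d n (act d P v)" by blast
  from someI[of "\<lambda>P. pd d P \<and> tight d n (act d P v)", OF this]
  have "pd d (SOME P. pd d P \<and> tight d n (act d P v))" "tight d n (act d (SOME P. pd d P \<and> tight d n (act d P v)) v)"
    by blast+
  then show ?thesis by (rule that) (simp only: tighten_def False if_False)
qed

lemma tighten_tight: "d > 0 \<Longrightarrow> unit_tuple d n v \<Longrightarrow> stable d n v \<or> tight d n v \<Longrightarrow> tight d n (tighten d n v)"
proof -
  assume "d > 0" "unit_tuple d n v" "stable d n v \<or> tight d n v"
  then obtain P where P: "tight d n (act d P v)" "\<And>i a. i < n \<Longrightarrow> a < d \<Longrightarrow> tighten d n v i a = act d P v i a"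
    using tighten_action by metis
  then show ?thesis using tight_cong[of n d "tighten d n v" "act d P v"] by blast
qed

lemma tighten_unit: "d > 0 \<Longrightarrow> unit_tuple d n v \<Longrightarrow> stable d n v \<or> tight d n v \<Longrightarrow> unit_tuple d n (tighten d n v)"
  unfolding unit_tuple_def
proof (intro allI impI)
  fix i assume d: "d > 0" and v: "\<forall>i<n. nsq d (v i) = 1" "stable d n v \<or> tight d n v" and i: "i < n"
  then obtain P where P: "pd d P" "\<And>i a. i < n \<Longrightarrow> a < d \<Longrightarrow> tighten d n v i a = act d P v i a"
    using tighten_action[of d n v] unfolding unit_tuple_def by metis
  have "nsq d (tighten d n v i) = nsq d (act d P v i)" by (rule nsq_cong) (rule P(2)[OF i])
  also have "\<dots> = 1" unfolding act_def
  proof (rule nsq_normalised)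
    show "nsq d (app d P (v i)) \<noteq> 0" using nsq_pos_app_pd[of d P "v i"] P(1) v(1) i unfolding pd_def by simp
  qed
  finally show "nsq d (tighten d n v i) = 1" .
qed

lemma tighten_id: "tight d n v \<Longrightarrow> tighten d n v = v"
  by (simp add: tighten_def)

text \<open>At a stable limit this is \<open>tight_action_sequence\<close>.  At a tight limit the defect of the sequence
  tends to zero, and \<open>tight_action_estimate\<close> shows that the sequence is hardly moved.\<close>
lemma tighten_continuous:
  fixes v :: "nat \<Rightarrow> nat \<Rightarrow> 'a::rc_scalar"
  assumes d: "d \<ge> 2"
    and v: "unit_tuple d n v" "stable d n v \<or> tight d n v"
    and w: "\<And>m. unit_tuple d n (w m)" "\<And>m. stable d n (w m) \<or> tight d n (w m)"
    and lim: "\<And>i a. i < n \<Longrightarrow> a < d \<Longrightarrow> (\<lambda>m::nat. w m i a) \<longlonglongrightarrow> v i a"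
    and i: "i < n" and a: "a < d"
  shows "(\<lambda>m. tighten d n (w m) i a) \<longlonglongrightarrow> tighten d n v i a"
proof -
  have d0: "d > 0" using d by simp
  have "\<forall>m. \<exists>P. pd d P \<and> tight d n (act d P (w m)) \<and> (\<forall>i<n. \<forall>a<d. tighten d n (w m) i a = act d P (w m) i a)"
  proof
    fix m
    show "\<exists>P. pd d P \<and> tight d n (act d P (w m)) \<and> (\<forall>i<n. \<forall>a<d. tighten d n (w m) i a = act d P (w m) i a)"
      using tighten_action[OF d0 w(1) w(2), of m] by metis
  qed
  then obtain Q where Q: "\<And>m. pd d (Q m)" "\<And>m. tight d n (act d (Q m) (w m))"
    "\<And>m i a. i < n \<Longrightarrow> a < d \<Longrightarrow> tighten d n (w m) i a = act d (Q m) (w m) i a" by metis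
  have wu: "nsq d (w m i) = 1" if "i < n" for m i using w(1)[of m] that unfolding unit_tuple_def by blast
  have vu: "nsq d (v i) = 1" if "i < n" for i using v(1) that unfolding unit_tuple_def by blast
  show ?thesis
  proof (cases "tight d n v")
    case False
    obtain P where P: "pd d P" "tight d n (act d P v)" "\<And>i a. i < n \<Longrightarrow> a < d \<Longrightarrow> tighten d n v i a = act d P v i a"
      using tighten_action[OF d0 v] by metis
    have "(\<lambda>m. act d (Q m) (w m) i a) \<longlonglongrightarrow> act d P v i a"
      using tight_action_sequence[OF d _ vu P(1,2) wu lim Q(1,2) i a] v(2) False by blast
    then show ?thesis by (simp add: P(3)[OF i a] Q(3)[OF i a])
  next
    case True
    have "(\<lambda>m. defect d n (w m)) \<longlonglongrightarrow> defect d n v"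
      unfolding defect_def using lim by (intro tendsto_sum tendsto_norm tendsto_diff tendsto_const tendsto_gram) auto
    moreover have "defect d n v = 0" unfolding defect_def using tightD[OF True] by (intro sum.neutral ballI) simp
    ultimately have "(\<lambda>m. sqrt (2 * defect d n (w m))) \<longlonglongrightarrow> sqrt (2 * 0)"
      by (intro tendsto_real_sqrt tendsto_mult tendsto_const) simp
    then have lim0: "(\<lambda>m. sqrt (2 * defect d n (w m))) \<longlonglongrightarrow> 0" by simp
    have "norm (act d (Q m) (w m) i a - w m i a) \<le> sqrt (2 * defect d n (w m))" for m
    proof -
      have "(norm (act d (Q m) (w m) i a - w m i a))\<^sup>2 \<le> nsq d (\<lambda>a. act d (Q m) (w m) i a - w m i a)"
        by (rule norm_le_nsq[OF a, of "\<lambda>a. act d (Q m) (w m) i a - w m i a"])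
      also have "\<dots> \<le> 2 * defect d n (w m)" by (rule tight_action_estimate[OF Q(1) wu Q(2) i])
      finally show ?thesis by (simp add: real_le_rsqrt)
    qed
    then have "(\<lambda>m. act d (Q m) (w m) i a - w m i a) \<longlonglongrightarrow> 0"
      by (intro Lim_null_comparison[OF _ lim0] always_eventually allI)
    from tendsto_add[OF this lim[OF i a]] have "(\<lambda>m. act d (Q m) (w m) i a) \<longlonglongrightarrow> v i a" by simp
    then show ?thesis by (simp add: Q(3)[OF i a] tighten_id[OF True])
  qed
qed

section \<open>The cube as a compact metric space\<close>

abbreviation cubeset :: "nat \<Rightarrow> (nat \<Rightarrow> real) set" where
  "cubeset N \<equiv> PiE {..<N} (\<lambda>_. {0..1})"

lemma continuous_on_coordinate: "continuous_on S (\<lambda>x :: 'i \<Rightarrow> 'b::topological_space. x i)"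
  by (rule continuous_on_subset[OF continuous_on_product_coordinates subset_UNIV])

lemma topspace_cube: "topspace (cube N) = cubeset N"
  by (simp add: cube_def)

lemma cube_coordinate: "i < N \<Longrightarrow> continuous_map (cube N) euclideanreal (\<lambda>x. x i)"
proof -
  assume i: "i < N"
  have "continuous_map (cube N) (top_of_set {0..1}) (\<lambda>x. x i)"
    unfolding cube_def using continuous_map_product_projection[of i "{..<N}" "\<lambda>_. top_of_set {0..1::real}"] i by simp
  then show ?thesis by (rule continuous_map_into_fulltopology)
qed

lemma continuous_map_to_fun:
  "continuous_map X euclidean f \<longleftrightarrow> (\<forall>i. continuous_map X euclidean (\<lambda>x. f x i))"
  for f :: "'a \<Rightarrow> 'i \<Rightarrow> 'b::topological_space"
  unfolding euclidean_product_topology[symmetric] by (simp add: continuous_map_componentwise_UNIV)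

text \<open>Points of the cube have a fixed value outside the index set, so the cube carries the subspace
  topology of the metric space of all functions; this gives access to uniform continuity.\<close>
lemma cube_eq_top_of_set: "cube N = top_of_set (cubeset N)"
proof -
  have 1: "continuous_map (top_of_set (cubeset N)) (cube N) id"
    unfolding cube_def continuous_map_componentwise
  proof (intro conjI ballI)
    show "id ` topspace (top_of_set (cubeset N)) \<subseteq> extensional {..<N}" by (auto simp: PiE_def)
    fix k assume k: "k \<in> {..<N}"
    have "continuous_on (cubeset N) (\<lambda>x. x k)" by (rule continuous_on_coordinate)
    then show "continuous_map (top_of_set (cubeset N)) (top_of_set {0..1}) (\<lambda>x. id x k)"
      using k unfolding continuous_map_in_subtopology id_def continuous_map_iff_continuous by fastforce
  qed
  have "continuous_map (cube N) euclidean id"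
    unfolding continuous_map_to_fun
  proof
    fix i
    show "continuous_map (cube N) euclidean (\<lambda>x. id x i)"
    proof (cases "i < N")
      case True
      then show ?thesis using cube_coordinate by simp
    next
      case False
      have "continuous_map (cube N) euclidean (\<lambda>x. undefined :: real)" by simp
      then show ?thesis
        by (rule continuous_map_eq) (use False in \<open>simp add: topspace_cube PiE_def extensional_def\<close>)
    qed
  qed
  then have 2: "continuous_map (cube N) (top_of_set (cubeset N)) id"
    by (simp add: continuous_map_in_subtopology topspace_cube)
  show ?thesis
  proof (rule topology_eq[THEN iffD2], intro allI iffI)
    fix U assume U: "openin (cube N) U"
    have "openin (top_of_set (cubeset N)) {x \<in> topspace (top_of_set (cubeset N)). id x \<in> U}"
      by (rule openin_continuous_map_preimage[OF 1 U])
    moreover have "{x \<in> topspace (top_of_set (cubeset N)). id x \<in> U} = U"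
      using openin_subset[OF U] by (auto simp: topspace_cube)
    ultimately show "openin (top_of_set (cubeset N)) U" by simp
  next
    fix U assume U: "openin (top_of_set (cubeset N)) U"
    have "openin (cube N) {x \<in> topspace (cube N). id x \<in> U}"
      by (rule openin_continuous_map_preimage[OF 2 U])
    moreover have "{x \<in> topspace (cube N). id x \<in> U} = U"
      using openin_subset[OF U] by (auto simp: topspace_cube)
    ultimately show "openin (cube N) U" by simp
  qed
qed

lemma compact_cubeset: "compact (cubeset N)"
proof -
  have "compact_space (cube N)"
    unfolding cube_def by (rule compact_space_product_topology[THEN iffD2]) (auto simp: compact_space_subtopology)
  then show ?thesis unfolding cube_eq_top_of_set by (simp add: compact_space_subtopology compact_space_def compactin_subtopology)
qed

text \<open>The metric weighs the coordinate distances by a geometric series with sum two.\<close>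
lemma dist_fun_le:
  fixes x y :: "nat \<Rightarrow> real"
  assumes "\<And>i. dist (x i) (y i) \<le> \<delta>"
  shows "dist x y \<le> 2 * \<delta>"
proof (rule field_le_epsilon)
  fix e :: real assume "e > 0"
  then obtain N where N: "(1/2)^N < e" using real_arch_pow_inv[of e "1/2"] by auto
  have "dist x y \<le> 2 * Max {dist (x (from_nat n)) (y (from_nat n))|n. n \<le> N} + (1/2)^N"
    by (rule dist_fun_le_dist_first_terms)
  moreover have "Max {dist (x (from_nat n)) (y (from_nat n))|n. n \<le> N} \<le> \<delta>"
    using assms by (subst Max_le_iff) auto
  ultimately show "dist x y \<le> 2 * \<delta> + e" using N by linarith
qed

lemma cube_uniform_continuity:
  fixes f :: "(nat \<Rightarrow> real) \<Rightarrow> 'b::metric_space"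
  assumes f: "continuous_on (cubeset N) f" and e: "e > 0"
  shows "\<exists>\<delta>>0. \<forall>x\<in>cubeset N. \<forall>y\<in>cubeset N. (\<forall>i<N. \<bar>x i - y i\<bar> \<le> \<delta>) \<longrightarrow> dist (f x) (f y) < e"
proof -
  have "uniformly_continuous_on (cubeset N) f" by (rule compact_uniformly_continuous[OF f compact_cubeset])
  then obtain d where d: "d > 0" "\<And>x y. x \<in> cubeset N \<Longrightarrow> y \<in> cubeset N \<Longrightarrow> dist y x < d \<Longrightarrow> dist (f y) (f x) < e"
    using e unfolding uniformly_continuous_on_def by metis
  show ?thesis
  proof (intro exI[of _ "d / 3"] conjI ballI impI)
    show "d / 3 > 0" using d by simp
    fix x y :: "nat \<Rightarrow> real" assume xy: "x \<in> cubeset N" "y \<in> cubeset N" "\<forall>i<N. \<bar>x i - y i\<bar> \<le> d / 3"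
    have "dist (x i) (y i) \<le> d / 3" for i
    proof (cases "i < N")
      case False
      then have "x i = undefined" "y i = undefined" using xy(1,2) by (auto simp: PiE_iff extensional_def)
      then show ?thesis using d by simp
    qed (use xy in \<open>simp add: dist_real_def\<close>)
    then have "dist x y \<le> 2 * (d / 3)" by (rule dist_fun_le)
    then have "dist x y < d" using d by simp
    then show "dist (f x) (f y) < e" by (rule d(2)[OF xy(2,1)])
  qed
qed

section \<open>Freudenthal partitions of unity\<close>

text \<open>The ends of the interval of all \<open>s \<in> [0, 1)\<close> with \<open>z\<^sub>i \<le> s < z\<^sub>i + 1\<close> for \<open>i < N\<close>; the value of \<open>hat\<close>
  is the length of this interval, and \<open>x \<mapsto> hat N (k - x)\<close> is the piecewise linear hat function of the
  Freudenthal triangulation at the grid point \<open>k\<close>.\<close>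
primrec lower :: "(nat \<Rightarrow> real) \<Rightarrow> nat \<Rightarrow> real" where
  "lower z 0 = 0"
| "lower z (Suc j) = max (lower z j) (z j)"

primrec upper :: "(nat \<Rightarrow> real) \<Rightarrow> nat \<Rightarrow> real" where
  "upper z 0 = 1"
| "upper z (Suc j) = min (upper z j) (z j + 1)"

lemma lower_upper: "(lower z N \<le> s \<and> s < upper z N) \<longleftrightarrow> (0 \<le> s \<and> s < 1 \<and> (\<forall>i<N. z i \<le> s \<and> s < z i + 1))"
  by (induction N) (auto simp: less_Suc_eq)

definition hat :: "nat \<Rightarrow> (nat \<Rightarrow> real) \<Rightarrow> real" where
  "hat N z = max 0 (upper z N - lower z N)"

lemma continuous_lower_upper:
  assumes "\<And>i. i < N \<Longrightarrow> continuous_on S (\<lambda>x. z x i)"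
  shows "continuous_on S (\<lambda>x. lower (z x) N)" "continuous_on S (\<lambda>x. upper (z x) N)"
  using assms by (induction N) (auto intro!: continuous_on_max continuous_on_min continuous_on_add continuous_on_const)

lemma continuous_hat:
  assumes "\<And>i. i < N \<Longrightarrow> continuous_on S (\<lambda>x. z x i)"
  shows "continuous_on S (\<lambda>x. hat N (z x))"
  unfolding hat_def using continuous_lower_upper[of N S z] assms by (intro continuous_intros) auto

lemma hat_measure: "hat N z = measure lborel {lower z N..<upper z N}"
  by (auto simp: hat_def max_def)

text \<open>Along the chain the coordinate sum is strictly increasing, and on a box of side one it takes at
  most \<open>N + 1\<close> values.\<close>
lemma chain_in_unit_box_card:
  fixes A :: "(nat \<Rightarrow> nat) set"
  assumes ext: "\<And>g. g \<in> A \<Longrightarrow> g \<in> extensional {..<N}"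
    and chain: "\<And>g h. g \<in> A \<Longrightarrow> h \<in> A \<Longrightarrow> (\<forall>i<N. g i \<le> h i) \<or> (\<forall>i<N. h i \<le> g i)"
    and base: "\<And>g i. g \<in> A \<Longrightarrow> i < N \<Longrightarrow> b i \<le> g i \<and> g i \<le> b i + 1"
  shows "card A \<le> N + 1"
proof -
  define S where "S = (\<lambda>g :: nat \<Rightarrow> nat. \<Sum>i<N. g i)"
  have eq: "g = h" if gh: "g \<in> A" "h \<in> A" "S g = S h" "\<forall>i<N. g i \<le> h i" for g h
  proof (rule extensionalityI[OF ext[OF gh(1)] ext[OF gh(2)]])
    fix i assume i: "i \<in> {..<N}"
    show "g i = h i"
    proof (rule ccontr)
      assume "g i \<noteq> h i"
      then have "g i < h i" using gh(4) i by (simp add: le_neq_implies_less)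
      then have "S g < S h" unfolding S_def using gh(4) i by (intro sum_strict_mono_ex1) auto
      then show False using gh(3) by simp
    qed
  qed
  have inj: "inj_on S A"
  proof (rule inj_onI)
    fix g h assume gh: "g \<in> A" "h \<in> A" "S g = S h"
    from chain[OF gh(1,2)] show "g = h"
    proof
      assume "\<forall>i<N. g i \<le> h i" then show ?thesis using eq gh by blast
    next
      assume "\<forall>i<N. h i \<le> g i" then show ?thesis using eq[of h g] gh by simp
    qed
  qed
  have "S ` A \<subseteq> {(\<Sum>i<N. b i)..(\<Sum>i<N. b i) + N}"
  proof
    fix s assume "s \<in> S ` A"
    then obtain g where g: "g \<in> A" "s = S g" by blast
    have sum1: "(\<Sum>i<N. b i + 1) = (\<Sum>i<N. b i) + N" unfolding sum.distrib by simp
    have "(\<Sum>i<N. b i) \<le> S g" unfolding S_def using base[OF g(1)] by (intro sum_mono) auto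
    moreover have "S g \<le> (\<Sum>i<N. b i + 1)" unfolding S_def using base[OF g(1)] by (intro sum_mono) auto
    ultimately show "s \<in> {(\<Sum>i<N. b i)..(\<Sum>i<N. b i) + N}" using g unfolding sum1 by simp
  qed
  then have "card (S ` A) \<le> card {(\<Sum>i<N. b i)..(\<Sum>i<N. b i) + N}" by (intro card_mono) auto
  then show ?thesis using card_image[OF inj] by simp
qed

text \<open>For \<open>s \<in> [0, 1)\<close> round every coordinate of \<open>M x + s\<close> down; let \<open>lam k x\<close> be the measure of those
  \<open>s\<close> for which the result is \<open>k\<close>.  Hence the sum is one.  As \<open>s\<close> increases, the points met form a
  chain between the floor of \<open>M x\<close> and that plus one, so there are at most \<open>N + 1\<close> of them.  A
  coordinate that is \<open>0\<close> or \<open>1\<close> is always rounded to itself, which is what keeps boundary values under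
  control.\<close>
lemma fine_partition_of_unity:
  fixes \<delta> :: real
  assumes "\<delta> > 0"
  obtains T :: "(nat \<Rightarrow> nat) set" and pt :: "(nat \<Rightarrow> nat) \<Rightarrow> nat \<Rightarrow> real" and lam :: "(nat \<Rightarrow> nat) \<Rightarrow> (nat \<Rightarrow> real) \<Rightarrow> real"
  where "finite T" "\<And>k. k \<in> T \<Longrightarrow> pt k \<in> cubeset N" "\<And>k. k \<in> T \<Longrightarrow> continuous_on (cubeset N) (lam k)"
    "\<And>k x. lam k x \<ge> 0"
    "\<And>x. x \<in> cubeset N \<Longrightarrow> (\<Sum>k\<in>T. lam k x) = 1"
    "\<And>x. x \<in> cubeset N \<Longrightarrow> card {k \<in> T. lam k x \<noteq> 0} \<le> N + 1"
    "\<And>x k i. x \<in> cubeset N \<Longrightarrow> k \<in> T \<Longrightarrow> lam k x \<noteq> 0 \<Longrightarrow> i < N \<Longrightarrow>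
       \<bar>x i - pt k i\<bar> \<le> \<delta> \<and> (x i = 0 \<longrightarrow> pt k i = 0) \<and> (x i = 1 \<longrightarrow> pt k i = 1)"
proof -
  obtain M' where M': "inverse (real (Suc M')) < \<delta>" using reals_Archimedean[OF assms] by blast
  define M where "M = Suc M'"
  have M: "M > 0" "1 / real M \<le> \<delta>" using M' by (simp_all add: M_def inverse_eq_divide)
  define T where "T = PiE {..<N} (\<lambda>_. {0..M})"
  define pt where "pt = (\<lambda>(k :: nat \<Rightarrow> nat). \<lambda>i\<in>{..<N}. real (k i) / real M)"
  define z where "z = (\<lambda>(k :: nat \<Rightarrow> nat) (x :: nat \<Rightarrow> real) i. real (k i) - real M * x i)"
  define lam where "lam = (\<lambda>k x. hat N (z k x))"
  define I where "I = (\<lambda>k x. {lower (z k x) N..<upper (z k x) N})"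
  have mem: "s \<in> I k x \<longleftrightarrow> 0 \<le> s \<and> s < 1 \<and> (\<forall>i<N. real (k i) \<le> real M * x i + s \<and> real M * x i + s < real (k i) + 1)" for s k x
    unfolding I_def atLeastLessThan_iff lower_upper z_def by (auto simp: algebra_simps)
  have ne: "\<exists>s. s \<in> I k x" if "lam k x \<noteq> 0" for k x
  proof -
    have "lower (z k x) N < upper (z k x) N" using that by (auto simp: lam_def hat_def max_def split: if_splits)
    then show ?thesis unfolding I_def by (intro exI[of _ "lower (z k x) N"]) simp
  qed
  have floor: "int (k i) = \<lfloor>real M * x i + s\<rfloor>" if "s \<in> I k x" "i < N" for s k x i
    using that unfolding mem by (intro floor_unique[symmetric]) auto
  show ?thesis
  proof (rule that[of T pt lam])
    show "finite T" unfolding T_def by (intro finite_PiE) auto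
    show "pt k \<in> cubeset N" if "k \<in> T" for k
      using that M unfolding T_def pt_def by (auto simp: PiE_iff field_simps)
    show "continuous_on (cubeset N) (lam k)" for k
      unfolding lam_def z_def
      by (intro continuous_hat continuous_on_diff continuous_on_mult continuous_on_const continuous_on_coordinate)
    show "lam k x \<ge> 0" for k x by (simp add: lam_def hat_def)
  next
    fix x assume x: "x \<in> cubeset N"
    have xb: "0 \<le> x i" "x i \<le> 1" if "i < N" for i using x that by (auto simp: PiE_iff)
    have disj: "disjoint_family_on (\<lambda>k. I k x) T"
      unfolding disjoint_family_on_def
    proof (intro ballI impI)
      fix k h assume kh: "k \<in> T" "h \<in> T" "k \<noteq> h"
      show "I k x \<inter> I h x = {}"
      proof (rule ccontr)
        assume "I k x \<inter> I h x \<noteq> {}"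
        then obtain s where "s \<in> I k x" "s \<in> I h x" by blast
        then have "k i = h i" if "i \<in> {..<N}" for i using floor[of s k x i] floor[of s h x i] that by simp
        moreover have "k \<in> extensional {..<N}" "h \<in> extensional {..<N}" using kh by (auto simp: T_def PiE_iff)
        ultimately have "k = h" by (intro extensionalityI[of k "{..<N}" h])
        then show False using kh(3) by simp
      qed
    qed
    have un: "(\<Union>k\<in>T. I k x) = {0..<1}"
    proof (intro equalityI subsetI)
      fix s assume "s \<in> (\<Union>k\<in>T. I k x)" then show "s \<in> {0..<1}" using mem by auto
    next
      fix s :: real assume s: "s \<in> {0..<1}"
      define k where "k = (\<lambda>i\<in>{..<N}. nat \<lfloor>real M * x i + s\<rfloor>)"
      have k: "0 \<le> \<lfloor>real M * x i + s\<rfloor>" "\<lfloor>real M * x i + s\<rfloor> \<le> int M" if "i < N" for i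
      proof -
        have "0 \<le> real M * x i" "real M * x i \<le> real M" using xb[OF that] by (simp_all add: mult_left_le)
        then show "0 \<le> \<lfloor>real M * x i + s\<rfloor>" "\<lfloor>real M * x i + s\<rfloor> \<le> int M" using s by (simp_all add: floor_le_iff)
      qed
      have "k \<in> T" using k by (auto simp: T_def k_def PiE_iff nat_le_iff)
      moreover have "s \<in> I k x"
        unfolding mem
      proof (intro conjI allI impI)
        fix i assume i: "i < N"
        have "real (k i) = of_int \<lfloor>real M * x i + s\<rfloor>" using k(1)[OF i] i by (simp add: k_def)
        then show "real (k i) \<le> real M * x i + s" "real M * x i + s < real (k i) + 1" by linarith+
      qed (use s in auto)
      ultimately show "s \<in> (\<Union>k\<in>T. I k x)" by blast
    qed
    have "(\<Sum>k\<in>T. lam k x) = (\<Sum>k\<in>T. measure lborel (I k x))" unfolding lam_def hat_measure I_def ..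
    also have "\<dots> = measure lborel (\<Union>k\<in>T. I k x)"
    proof (rule measure_finite_Union[symmetric])
      show "finite T" unfolding T_def by (intro finite_PiE) auto
      show "(\<lambda>k. I k x) ` T \<subseteq> sets lborel" by (auto simp: I_def)
      show "emeasure lborel (I k x) \<noteq> \<infinity>" for k
        unfolding I_def by (cases "lower (z k x) N \<le> upper (z k x) N") auto
    qed (rule disj)
    also have "\<dots> = 1" unfolding un by simp
    finally show "(\<Sum>k\<in>T. lam k x) = 1" .
    show "card {k \<in> T. lam k x \<noteq> 0} \<le> N + 1"
    proof (rule chain_in_unit_box_card)
      fix g assume "g \<in> {k \<in> T. lam k x \<noteq> 0}"
      then show "g \<in> extensional {..<N}" by (auto simp: T_def PiE_iff)
    next
      fix g h assume gh: "g \<in> {k \<in> T. lam k x \<noteq> 0}" "h \<in> {k \<in> T. lam k x \<noteq> 0}"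
      obtain s where s: "s \<in> I g x" using gh ne by blast
      obtain t where t: "t \<in> I h x" using gh ne by blast
      show "(\<forall>i<N. g i \<le> h i) \<or> (\<forall>i<N. h i \<le> g i)"
      proof (cases "s \<le> t")
        case True
        have "g i \<le> h i" if "i < N" for i
          using floor[OF s that] floor[OF t that] floor_mono[of "real M * x i + s" "real M * x i + t"] True by simp
        then show ?thesis by blast
      next
        case False
        have "h i \<le> g i" if "i < N" for i
          using floor[OF s that] floor[OF t that] floor_mono[of "real M * x i + t" "real M * x i + s"] False by simp
        then show ?thesis by blast
      qed
    next
      fix g i assume g: "g \<in> {k \<in> T. lam k x \<noteq> 0}" and i: "i < N"
      obtain s where s: "s \<in> I g x" using g ne by blast
      have y0: "0 \<le> real M * x i" using xb[OF i] by simp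
      have s01: "0 \<le> s" "s < 1" using s mem by auto
      have f: "int (g i) = \<lfloor>real M * x i + s\<rfloor>" by (rule floor[OF s i])
      have "\<lfloor>real M * x i\<rfloor> \<le> int (g i)" unfolding f using s01 by (intro floor_mono) simp
      moreover have "int (g i) \<le> \<lfloor>real M * x i\<rfloor> + 1"
        unfolding f using s01 by linarith
      ultimately show "nat \<lfloor>real M * x i\<rfloor> \<le> g i \<and> g i \<le> nat \<lfloor>real M * x i\<rfloor> + 1" using y0 by linarith
    qed
  next
    fix x k i assume x: "x \<in> cubeset N" and k: "k \<in> T" "lam k x \<noteq> 0" and i: "i < N"
    obtain s where s: "s \<in> I k x" using k ne by blast
    have s': "0 \<le> s" "s < 1" "real (k i) \<le> real M * x i + s" "real M * x i + s < real (k i) + 1"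
      using s i unfolding mem by auto
    have p: "pt k i = real (k i) / real M" using i by (simp add: pt_def)
    have "x i - pt k i = (real M * x i - real (k i)) / real M" using M p by (simp add: field_simps)
    moreover have "\<bar>real M * x i - real (k i)\<bar> \<le> 1" using s' by linarith
    ultimately have "\<bar>x i - pt k i\<bar> \<le> 1 / real M" using M by (simp add: divide_right_mono)
    moreover have "pt k i = 0" if "x i = 0" using s' that p by simp
    moreover have "pt k i = 1" if "x i = 1"
    proof -
      have "real M < real (k i) + 1" "real (k i) < real M + 1" using s' that by auto
      then have "k i = M" by linarith
      then show ?thesis using M p by simp
    qed
    ultimately show "\<bar>x i - pt k i\<bar> \<le> \<delta> \<and> (x i = 0 \<longrightarrow> pt k i = 0) \<and> (x i = 1 \<longrightarrow> pt k i = 1)"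
      using M(2) by auto
  qed
qed

section \<open>Generic perturbation of matrices\<close>

text \<open>Independence of the columns of a matrix with arbitrary index sets; when these have equal size
  it is nonvanishing of the determinant.\<close>
definition nonsing :: "'r set \<Rightarrow> 'c set \<Rightarrow> ('r \<Rightarrow> 'c \<Rightarrow> 'a::field) \<Rightarrow> bool" where
  "nonsing R C A \<longleftrightarrow> (\<forall>c. (\<forall>r\<in>R. (\<Sum>k\<in>C. A r k * c k) = 0) \<longrightarrow> (\<forall>k\<in>C. c k = 0))"

lemma nonsingD: "nonsing R C A \<Longrightarrow> (\<And>r. r \<in> R \<Longrightarrow> (\<Sum>k\<in>C. A r k * c k) = 0) \<Longrightarrow> k \<in> C \<Longrightarrow> c k = 0"
  unfolding nonsing_def by (erule allE[of _ c]) (erule impE, rule ballI, assumption, erule bspec, assumption)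

lemma nonsing_dt:
  assumes e: "bij_betw e {..<N} R" and f: "bij_betw f {..<N} C"
  shows "nonsing R C A \<longleftrightarrow> dt N (\<lambda>a b. A (e a) (f b)) \<noteq> 0"
proof -
  have s: "(\<Sum>k\<in>C. A (e a) k * c k) = app N (\<lambda>a b. A (e a) (f b)) (\<lambda>b. c (f b)) a" for c a
    unfolding app_def by (rule sum.reindex_bij_betw[OF f, symmetric])
  show ?thesis
  proof
    assume ns: "nonsing R C A"
    show "dt N (\<lambda>a b. A (e a) (f b)) \<noteq> 0"
    proof
      assume dt0: "dt N (\<lambda>a b. A (e a) (f b)) = 0"
      obtain x where x: "\<exists>a<N. x a \<noteq> 0" "\<And>a. a < N \<Longrightarrow> app N (\<lambda>a b. A (e a) (f b)) x a = 0"
        by (rule dt_zero_kernel[OF dt0], rule that, assumption+)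
      define c where "c = (\<lambda>k. x (the_inv_into {..<N} f k))"
      have cf: "c (f b) = x b" if "b < N" for b
        unfolding c_def using f that by (simp add: bij_betw_def the_inv_into_f_f)
      have "(\<Sum>k\<in>C. A r k * c k) = 0" if r: "r \<in> R" for r
      proof -
        obtain a where a: "a < N" "r = e a" using r e unfolding bij_betw_def by blast
        have "app N (\<lambda>a b. A (e a) (f b)) (\<lambda>b. c (f b)) a = app N (\<lambda>a b. A (e a) (f b)) x a"
          unfolding app_def using cf by (intro sum.cong refl) simp
        then show ?thesis using a x(2)[OF a(1)] s[of a c] by simp
      qed
      then have c0: "c k = 0" if "k \<in> C" for k using nonsingD[OF ns, of c] that by presburger
      have "x b = 0" if "b < N" for b
      proof -
        have "f b \<in> C" by (rule bij_betwE[OF f, rule_format]) (simp add: that)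
        then show ?thesis using c0 cf[OF that] by simp
      qed
      then show False using x(1) by blast
    qed
  next
    assume dt1: "dt N (\<lambda>a b. A (e a) (f b)) \<noteq> 0"
    obtain k where k: "\<And>x a. a < N \<Longrightarrow> app N k (app N (\<lambda>a b. A (e a) (f b)) x) a = x a"
      by (rule dt_inverse[OF dt1], rule that, assumption)
    show "nonsing R C A"
      unfolding nonsing_def
    proof (intro allI impI ballI)
      fix c j assume c: "\<forall>r\<in>R. (\<Sum>k\<in>C. A r k * c k) = 0" and j: "j \<in> C"
      have "app N (\<lambda>a b. A (e a) (f b)) (\<lambda>b. c (f b)) a = 0" if "a < N" for a
      proof -
        have "e a \<in> R" by (rule bij_betwE[OF e, rule_format]) (simp add: that)
        then show ?thesis using c unfolding s[of a c, symmetric] by blast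
      qed
      then have "app N k (app N (\<lambda>a b. A (e a) (f b)) (\<lambda>b. c (f b))) b = 0" for b
        unfolding app_def[of N k] by (intro sum.neutral) simp
      then have "c (f b) = 0" if "b < N" for b using k[OF that, of "\<lambda>b. c (f b)"] by simp
      moreover obtain b where "b < N" "j = f b" using j f unfolding bij_betw_def by blast
      ultimately show "c j = 0" by simp
    qed
  qed
qed

lemma poly_dt: "poly (dt N P) x = dt N (\<lambda>a b. poly (P a b) x)"
  unfolding dt_def
  by (subst (1 2) det_def'[of _ N]) (auto simp: poly_sum poly_prod poly_mult sign_def permutes_in_image intro!: sum.cong prod.cong)

text \<open>For \<open>t \<noteq> 0\<close> the determinant of \<open>V + t Z\<close> vanishes iff that of \<open>Z + (1/t) V\<close> does, and the latter is
  a polynomial in \<open>1/t\<close> whose value at zero is nonzero.\<close>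
lemma finite_singular_parameters:
  fixes V Z :: "'r \<Rightarrow> 'c \<Rightarrow> 'a::field"
  assumes fin: "finite R" "finite C" "card R = card C" and Z: "nonsing R C Z"
  shows "finite {t. \<not> nonsing R C (\<lambda>r k. V r k + t * Z r k)}"
proof -
  define N where "N = card C"
  obtain e where e: "bij_betw e {..<N} R"
    using ex_bij_betw_nat_finite[OF fin(1)] fin(3) by (auto simp: N_def lessThan_atLeast0)
  obtain f where f: "bij_betw f {..<N} C"
    using ex_bij_betw_nat_finite[OF fin(2)] by (auto simp: N_def lessThan_atLeast0)
  define P where "P = dt N (\<lambda>a b. [:Z (e a) (f b), V (e a) (f b):])"
  have Px: "poly P x = dt N (\<lambda>a b. Z (e a) (f b) + x * V (e a) (f b))" for x
    unfolding P_def poly_dt by simp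
  have "poly P 0 \<noteq> 0" unfolding Px using Z nonsing_dt[OF e f, of Z] by simp
  then have "P \<noteq> 0" by auto
  then have "finite {x. poly P x = 0}" by (rule poly_roots_finite)
  moreover have "{t. \<not> nonsing R C (\<lambda>r k. V r k + t * Z r k)} \<subseteq> insert 0 (inverse ` {x. poly P x = 0})"
  proof
    fix t assume "t \<in> {t. \<not> nonsing R C (\<lambda>r k. V r k + t * Z r k)}"
    then have t: "\<not> nonsing R C (\<lambda>r k. V r k + t * Z r k)" by simp
    show "t \<in> insert 0 (inverse ` {x. poly P x = 0})"
    proof (cases "t = 0")
      case False
      have "\<not> nonsing R C (\<lambda>r k. Z r k + inverse t * V r k)"
      proof
        assume n: "nonsing R C (\<lambda>r k. Z r k + inverse t * V r k)"
        have e': "(\<Sum>k\<in>C. (V r k + t * Z r k) * c k) = t * (\<Sum>k\<in>C. (Z r k + inverse t * V r k) * c k)" for r c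
          unfolding sum_distrib_left using False by (intro sum.cong refl) (simp add: field_simps)
        have "nonsing R C (\<lambda>r k. V r k + t * Z r k)"
          using n False unfolding nonsing_def e' by simp
        then show False using t by simp
      qed
      then have "poly P (inverse t) = 0" unfolding Px using nonsing_dt[OF e f] by blast
      then show ?thesis by (intro insertI2 image_eqI[of _ _ "inverse t"]) auto
    qed simp
  qed
  ultimately show ?thesis by (meson finite_imageI finite_insert finite_subset)
qed

text \<open>Countably many finite sets of bad parameters do not cover an interval.\<close>
lemma generic_perturbation:
  fixes V Z :: "'r \<Rightarrow> 'c \<Rightarrow> 'a::real_normed_field"
  assumes F: "countable F"
    and fin: "\<And>R C. (R, C) \<in> F \<Longrightarrow> finite R \<and> finite C \<and> card R = card C \<and> nonsing R C Z"
    and \<delta>: "\<delta> > 0"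
  obtains t where "0 < t" "t < \<delta>" "\<And>R C. (R, C) \<in> F \<Longrightarrow> nonsing R C (\<lambda>r k. V r k + of_real t * Z r k)"
proof -
  define bad where "bad = (\<lambda>(R, C). {t :: real. \<not> nonsing R C (\<lambda>r k. V r k + of_real t * Z r k)})"
  have "finite (bad p)" if p: "p \<in> F" for p
  proof -
    obtain R C where RC: "p = (R, C)" by fastforce
    have "finite {t. \<not> nonsing R C (\<lambda>r k. V r k + t * Z r k)}"
      using fin[of R C] p RC by (intro finite_singular_parameters) auto
    then have "finite (of_real -` {t. \<not> nonsing R C (\<lambda>r k. V r k + t * Z r k)} :: real set)"
      by (rule finite_vimageI) (auto intro: injI)
    then show ?thesis by (simp add: bad_def RC vimage_def)
  qed
  then have "countable (\<Union>p\<in>F. bad p)" using F by (intro countable_UN) (auto intro: countable_finite)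
  moreover have "uncountable {0<..<\<delta>}" using \<delta> by (simp add: uncountable_open_interval)
  ultimately have "\<not> {0<..<\<delta>} \<subseteq> (\<Union>p\<in>F. bad p)" using countable_subset by blast
  then obtain t where t: "t \<in> {0<..<\<delta>}" "t \<notin> (\<Union>p\<in>F. bad p)" by blast
  show ?thesis
  proof (rule that[of t])
    show "0 < t" "t < \<delta>" using t by auto
    fix R C assume "(R, C) \<in> F"
    then have "t \<notin> bad (R, C)" using t by blast
    then show "nonsing R C (\<lambda>r k. V r k + of_real t * Z r k)" by (simp add: bad_def)
  qed
qed

text \<open>Multiplied by \<open>\<Prod>\<^sub>j (x + y\<^sub>j)\<close>, a linear combination of the columns becomes a polynomial in \<open>x\<close> of
  degree less than \<open>card C\<close>.  If the combination vanishes at all rows, the polynomial has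
  \<open>card R\<close> roots, so it is zero, and its value at \<open>- y\<^sub>k\<close> is a nonzero multiple of the coefficient \<open>c\<^sub>k\<close>.\<close>
lemma cauchy_nonsing:
  fixes x :: "'r \<Rightarrow> 'a::field" and y :: "'c \<Rightarrow> 'a"
  assumes fin: "finite R" "finite C" "card C \<le> card R" and inj: "inj_on x R" "inj_on y C"
    and nz: "\<And>r k. r \<in> R \<Longrightarrow> k \<in> C \<Longrightarrow> x r + y k \<noteq> 0"
  shows "nonsing R C (\<lambda>r k. 1 / (x r + y k))"
  unfolding nonsing_def
proof (intro allI impI ballI)
  fix c k0 assume c: "\<forall>r\<in>R. (\<Sum>k\<in>C. 1 / (x r + y k) * c k) = 0" and k0: "k0 \<in> C"
  define p where "p = (\<Sum>k\<in>C. Polynomial.smult (c k) (\<Prod>j\<in>C - {k}. [:y j, 1:]))"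
  have pe: "poly p z = (\<Sum>k\<in>C. c k * (\<Prod>j\<in>C - {k}. y j + z))" for z
    by (simp add: p_def poly_sum poly_prod)
  have root: "poly p (x r) = 0" if r: "r \<in> R" for r
  proof -
    have "poly p (x r) = (\<Sum>k\<in>C. (\<Prod>j\<in>C. y j + x r) * (1 / (x r + y k) * c k))"
      unfolding pe
    proof (rule sum.cong[OF refl])
      fix k assume k: "k \<in> C"
      have "(\<Prod>j\<in>C. y j + x r) = (y k + x r) * (\<Prod>j\<in>C - {k}. y j + x r)" using fin(2) k by (rule prod.remove)
      then show "c k * (\<Prod>j\<in>C - {k}. y j + x r) = (\<Prod>j\<in>C. y j + x r) * (1 / (x r + y k) * c k)"
        using nz[OF r k] by (simp add: add.commute)
    qed
    also have "\<dots> = (\<Prod>j\<in>C. y j + x r) * (\<Sum>k\<in>C. 1 / (x r + y k) * c k)" by (simp add: sum_distrib_left)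
    finally show ?thesis using c r by simp
  qed
  have deg: "degree p < card C"
  proof -
    have "degree p \<le> card C - 1"
      unfolding p_def
    proof (rule degree_sum_le[OF fin(2)])
      fix k assume k: "k \<in> C"
      have "degree (Polynomial.smult (c k) (\<Prod>j\<in>C - {k}. [:y j, 1:])) \<le> degree (\<Prod>j\<in>C - {k}. [:y j, 1:])" by (rule degree_smult_le)
      also have "\<dots> \<le> sum (degree \<circ> (\<lambda>j. [:y j, 1:])) (C - {k})" by (rule degree_prod_sum_le) (use fin in auto)
      also have "\<dots> \<le> card C - 1" using k fin(2) by (simp add: card_Diff_singleton)
      finally show "degree (Polynomial.smult (c k) (\<Prod>j\<in>C - {k}. [:y j, 1:])) \<le> card C - 1" .
    qed
    moreover have "card C > 0" using k0 fin(2) by (auto simp: card_gt_0_iff)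
    ultimately show ?thesis by simp
  qed
  have "p = 0"
  proof (rule ccontr)
    assume p: "p \<noteq> 0"
    have "card (x ` R) \<le> card {z. poly p z = 0}"
      using root poly_roots_finite[OF p] by (intro card_mono) auto
    also have "\<dots> \<le> degree p" by (rule card_poly_roots_bound[OF p])
    finally show False using deg fin(3) card_image[OF inj(1)] by simp
  qed
  then have "poly p (- y k0) = 0" by simp
  moreover have "poly p (- y k0) = c k0 * (\<Prod>j\<in>C - {k0}. y j + - y k0)"
  proof -
    have "(\<Prod>j\<in>C - {k}. y j + - y k0) = 0" if "k \<in> C" "k \<noteq> k0" for k
      using that k0 fin(2) by (intro prod_zero) auto
    then have "c k * (\<Prod>j\<in>C - {k}. y j + - y k0) = (if k = k0 then c k0 * (\<Prod>j\<in>C - {k0}. y j + - y k0) else 0)" if "k \<in> C" for k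
      using that by simp
    then have "poly p (- y k0) = (\<Sum>k\<in>C. if k = k0 then c k0 * (\<Prod>j\<in>C - {k0}. y j + - y k0) else 0)"
      unfolding pe by (intro sum.cong refl) blast
    then show ?thesis using k0 fin(2) by simp
  qed
  moreover have "(\<Prod>j\<in>C - {k0}. y j + - y k0) \<noteq> 0"
    using inj(2) k0 fin(2) by (auto simp: prod_zero_iff inj_on_def)
  ultimately show "c k0 = 0" by simp
qed

section \<open>Null homotopies in the unit sphere\<close>

lemma cube_uniform_continuity_finite:
  fixes f :: "'i \<Rightarrow> (nat \<Rightarrow> real) \<Rightarrow> 'b::real_normed_vector"
  assumes A: "finite A" and f: "\<And>a. a \<in> A \<Longrightarrow> continuous_on (cubeset N) (f a)" and e: "e > 0"
  shows "\<exists>\<delta>>0. \<forall>a\<in>A. \<forall>x\<in>cubeset N. \<forall>y\<in>cubeset N. (\<forall>i<N. \<bar>x i - y i\<bar> \<le> \<delta>) \<longrightarrow> norm (f a x - f a y) < e"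
  using A f
  proof (induction A)
    case empty
    then show ?case by (intro exI[of _ 1]) simp
  next
    case (insert b A)
    have fA: "continuous_on (cubeset N) (f a)" if "a \<in> A" for a using insert.prems[of a] that by simp
    have "\<exists>\<delta>>0. \<forall>a\<in>A. \<forall>x\<in>cubeset N. \<forall>y\<in>cubeset N. (\<forall>i<N. \<bar>x i - y i\<bar> \<le> \<delta>) \<longrightarrow> norm (f a x - f a y) < e"
      by (rule insert.IH) (rule fA)
    then obtain \<delta>1 where 1: "\<delta>1 > 0" "\<forall>a\<in>A. \<forall>x\<in>cubeset N. \<forall>y\<in>cubeset N. (\<forall>i<N. \<bar>x i - y i\<bar> \<le> \<delta>1) \<longrightarrow> norm (f a x - f a y) < e"
      by (elim exE conjE) (rule that)
    obtain \<delta>2 where 2: "\<delta>2 > 0" "\<forall>x\<in>cubeset N. \<forall>y\<in>cubeset N. (\<forall>i<N. \<bar>x i - y i\<bar> \<le> \<delta>2) \<longrightarrow> dist (f b x) (f b y) < e"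
      using cube_uniform_continuity[OF insert.prems[OF insertI1] e] by (elim exE conjE) (rule that)
    show ?case
    proof (intro exI[of _ "min \<delta>1 \<delta>2"] conjI ballI impI)
      show "min \<delta>1 \<delta>2 > 0" using 1 2 by simp
      fix a x y assume a: "a \<in> insert b A" and xy: "x \<in> cubeset N" "y \<in> cubeset N" and c: "\<forall>i<N. \<bar>x i - y i\<bar> \<le> min \<delta>1 \<delta>2"
      show "norm (f a x - f a y) < e"
      proof (cases "a = b")
        case True
        have "dist (f b x) (f b y) < e" using c 2(2)[rule_format, OF xy] by simp
        then show ?thesis using True by (simp add: dist_norm)
      next
        case False
        have "\<forall>i<N. \<bar>x i - y i\<bar> \<le> \<delta>1" using c by auto
        then show ?thesis using 1(2) a False xy by blast
      qed
    qed
  qed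

lemma convex_combination_close:
  fixes w :: "'k \<Rightarrow> 'b::real_normed_vector"
  assumes "\<And>k. k \<in> T \<Longrightarrow> lam k \<ge> 0" "(\<Sum>k\<in>T. lam k) = 1" "\<And>k. k \<in> T \<Longrightarrow> lam k \<noteq> 0 \<Longrightarrow> norm (w k - z) \<le> e"
  shows "norm ((\<Sum>k\<in>T. lam k *\<^sub>R w k) - z) \<le> e"
proof -
  have "(\<Sum>k\<in>T. lam k *\<^sub>R w k) - z = (\<Sum>k\<in>T. lam k *\<^sub>R (w k - z))"
    by (simp add: scaleR_diff_right sum_subtractf scaleR_sum_left[symmetric] assms(2))
  also have "norm \<dots> \<le> (\<Sum>k\<in>T. norm (lam k *\<^sub>R (w k - z)))" by (rule norm_sum)
  also have "\<dots> \<le> (\<Sum>k\<in>T. lam k * e)"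
  proof (rule sum_mono)
    fix k assume k: "k \<in> T"
    show "norm (lam k *\<^sub>R (w k - z)) \<le> lam k * e"
      using assms(1,3)[OF k] by (cases "lam k = 0") (auto intro: mult_left_mono)
  qed
  also have "\<dots> = e" by (simp add: sum_distrib_right[symmetric] assms(2))
  finally show ?thesis .
qed

lemma continuous_normalised:
  assumes "\<And>a. a < d \<Longrightarrow> continuous_on S (\<lambda>x. g x a)" "\<And>x. x \<in> S \<Longrightarrow> nsq d (g x) \<noteq> 0" "a < d"
  shows "continuous_on S (\<lambda>x. normalised d (g x) a)"
proof -
  have "continuous_on S (\<lambda>x. nsq d (g x))"
    unfolding nsq_def using assms(1) by (intro continuous_on_sum continuous_on_power continuous_on_norm) auto
  then have "continuous_on S (\<lambda>x. 1 / sqrt (nsq d (g x)))"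
    using assms(2) by (intro continuous_on_divide continuous_on_const continuous_on_real_sqrt) auto
  then show ?thesis unfolding normalised_def using assms(1)[OF assms(3)] by (rule continuous_on_scaleR)
qed

lemma normalised_unit: "nsq d x = 1 \<Longrightarrow> normalised d x = x"
  by (simp add: normalised_def)

lemma nsq_coord_le: "(\<And>a. a < d \<Longrightarrow> norm (x a) \<le> e) \<Longrightarrow> nsq d x \<le> real d * e\<^sup>2"
proof -
  assume "\<And>a. a < d \<Longrightarrow> norm (x a) \<le> e"
  then have "nsq d x \<le> (\<Sum>a<d. e\<^sup>2)" unfolding nsq_def by (intro sum_mono power_mono) auto
  then show ?thesis by simp
qed

lemma nsq_nonzero_of_close:
  assumes f: "nsq d f = 1" and g: "\<And>a. a < d \<Longrightarrow> norm (g a - f a) \<le> 1 / real (d + 1)"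
  shows "nsq d g \<noteq> 0"
proof
  assume "nsq d g = 0"
  then have g0: "g a = 0" if "a < d" for a using that by (simp add: nsq_eq_0_iff)
  have "nsq d f \<le> real d * (1 / real (d + 1))\<^sup>2" using g g0 by (intro nsq_coord_le) simp
  also have "\<dots> = real d / (real (d + 1))\<^sup>2" by (simp add: power_divide)
  also have "\<dots> < 1"
  proof -
    have "real d < real (d + 1) * 1" by simp
    also have "\<dots> \<le> real (d + 1) * real (d + 1)" by (intro mult_left_mono) auto
    finally show ?thesis by (simp add: power2_eq_square)
  qed
  finally show False using f by simp
qed

lemma countable_injective_positive:
  assumes "countable A"
  obtains y :: "'k \<Rightarrow> real" where "inj_on y A" "\<And>k. y k \<ge> 1"
proof (rule that[of "\<lambda>k. real (to_nat_on A k) + 1"])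
  show "inj_on (\<lambda>k. real (to_nat_on A k) + 1) A"
    using inj_on_to_nat_on[OF assms] by (auto simp: inj_on_def)
qed simp

text \<open>After a small perturbation, no \<open>q + 1\<close> of the points have \<open>x\<close> in their real span: with \<open>x\<close> these
  are \<open>q + 2\<close> vectors in a space of at least that real dimension.  The perturbation is along a matrix \<open>Z\<close> with
  \<open>x\<close> as the column \<open>None\<close> and Cauchy columns that are set to zero in a row \<open>r0\<close> where \<open>x\<close> does not
  vanish; expanding along that row shows that its minors through \<open>r0\<close> are nonsingular.\<close>
lemma sphere_general_position:
  fixes v :: "'k \<Rightarrow> nat \<Rightarrow> 'a::euclidean_space"
  assumes T: "finite T" and x: "nsq d x = 1" and dim: "q + 2 \<le> DIM('a) * d" and e: "e > 0"
  obtains w where "\<And>k j. j < d \<Longrightarrow> norm (w k j - v k j) \<le> e"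
    "\<And>A c c0. A \<subseteq> T \<Longrightarrow> card A \<le> q + 1 \<Longrightarrow> \<forall>j<d. c0 *\<^sub>R x j + (\<Sum>k\<in>A. c k *\<^sub>R w k j) = 0 \<Longrightarrow> c0 = (0 :: real)"
proof -
  define J where "J = {..<d} \<times> (Basis :: 'a set)"
  have finJ: "finite J" unfolding J_def by (intro finite_cartesian_product finite_lessThan finite_Basis)
  have "card J = d * DIM('a)" unfolding J_def card_cartesian_product card_lessThan ..
  then have cardJ: "card J \<ge> q + 2" using dim by (simp only: mult.commute)
  have "nsq d x > 0" using x by simp
  then obtain j0 where j0: "j0 < d" "x j0 \<noteq> 0" unfolding nsq_pos_iff by blast
  then obtain b0 where b0: "b0 \<in> Basis" "inner (x j0) b0 \<noteq> 0"
    using euclidean_all_zero_iff[of "x j0"] by blast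
  obtain r0 where r0: "r0 \<in> J" "inner (x (fst r0)) (snd r0) \<noteq> 0"
  proof (rule that[of "(j0, b0)"])
    show "(j0, b0) \<in> J" using j0 b0 by (simp add: J_def)
    show "inner (x (fst (j0, b0))) (snd (j0, b0)) \<noteq> 0" using b0 by simp
  qed
  obtain \<xi> :: "nat \<times> 'a \<Rightarrow> real" where \<xi>: "inj_on \<xi> J" "\<And>r. \<xi> r \<ge> 1"
    by (rule countable_injective_positive[of J]) (use finJ in \<open>auto intro: countable_finite\<close>)
  obtain \<eta> :: "'k \<Rightarrow> real" where \<eta>: "inj_on \<eta> T" "\<And>k. \<eta> k \<ge> 1"
    by (rule countable_injective_positive[of T]) (use T in \<open>auto intro: countable_finite\<close>)
  have pos: "\<xi> r + \<eta> k > 0" "\<xi> r + \<eta> k \<ge> 1" for r k using \<xi>(2)[of r] \<eta>(2)[of k] by simp_all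
  define Z where "Z = (\<lambda>r. \<lambda>None \<Rightarrow> inner (x (fst r)) (snd r) | Some k \<Rightarrow> (if r = r0 then 0 else 1 / (\<xi> r + \<eta> k)))"
  \<comment> \<open>The column \<open>None\<close> of \<open>V + t Z\<close> is \<open>t x\<close>, hence the coefficient \<open>c0 / t\<close> further down.\<close>
  define V where "V = (\<lambda>r. \<lambda>None \<Rightarrow> 0 | Some k \<Rightarrow> inner (v k (fst r)) (snd r))"
  define F where "F = (\<lambda>(R, A). (R, insert None (Some ` A))) ` {(R, A). R \<subseteq> J \<and> r0 \<in> R \<and> A \<subseteq> T \<and> card R = card A + 1}"
  have "finite (Pow J \<times> Pow T)" using finJ T by simp
  then have "finite {(R, A). R \<subseteq> J \<and> r0 \<in> R \<and> A \<subseteq> T \<and> card R = card A + 1}"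
    by (rule finite_subset[rotated]) auto
  then have cF: "countable F" unfolding F_def by (intro countable_finite finite_imageI)
  have FZ: "finite R \<and> finite C \<and> card R = card C \<and> nonsing R C Z" if RC: "(R, C) \<in> F" for R C
  proof -
    obtain A where A: "C = insert None (Some ` A)" "R \<subseteq> J" "r0 \<in> R" "A \<subseteq> T" "card R = card A + 1"
      using RC unfolding F_def by auto
    have finA: "finite A" using A(4) T by (rule finite_subset)
    have finR: "finite R" using A(2) finJ by (rule finite_subset)
    have cC: "card C = card A + 1" unfolding A(1) using finA by (simp add: card_image)
    have cau: "nonsing (R - {r0}) A (\<lambda>r k. 1 / (\<xi> r + \<eta> k))"
    proof (rule cauchy_nonsing)
      show "card A \<le> card (R - {r0})" using A(3,5) finR by simp
      show "inj_on \<xi> (R - {r0})" using \<xi>(1) A(2) by (auto intro: inj_on_subset)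
      show "inj_on \<eta> A" using \<eta>(1) A(4) by (rule inj_on_subset)
      show "\<xi> r + \<eta> k \<noteq> 0" for r k using pos(1)[of r k] by simp
    qed (use finA finR in auto)
    have sumC: "(\<Sum>k\<in>C. Z r k * c k) = Z r None * c None + (\<Sum>k\<in>A. Z r (Some k) * c (Some k))" for r c
      unfolding A(1) using finA by (subst sum.insert) (auto simp: sum.reindex)
    have "nonsing R C Z"
      unfolding nonsing_def
    proof (intro allI impI)
      fix c assume c: "\<forall>r\<in>R. (\<Sum>k\<in>C. Z r k * c k) = 0"
      have "Z r0 None * c None + (\<Sum>k\<in>A. Z r0 (Some k) * c (Some k)) = 0" using c A(3) unfolding sumC by blast
      then have c0: "c None = 0" using r0(2) by (simp add: Z_def)
      have "(\<Sum>k\<in>A. 1 / (\<xi> r + \<eta> k) * c (Some k)) = 0" if "r \<in> R - {r0}" for r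
      proof -
        have "Z r None * c None + (\<Sum>k\<in>A. Z r (Some k) * c (Some k)) = 0" using c that unfolding sumC by blast
        then show ?thesis using that by (simp add: c0 Z_def)
      qed
      then have "c (Some k) = 0" if "k \<in> A" for k using nonsingD[OF cau, of "\<lambda>k. c (Some k)"] that by presburger
      then show "\<forall>k\<in>C. c k = 0" using c0 by (simp add: A(1))
    qed
    then show ?thesis using finA finR cC A(5) by (simp add: A(1))
  qed
  define e' where "e' = e / (real DIM('a) + 1)"
  have e': "e' > 0" using e by (simp add: e'_def add_pos_pos)
  obtain t where t: "0 < t" "t < e'" "\<And>R C. (R, C) \<in> F \<Longrightarrow> nonsing R C (\<lambda>r k. V r k + of_real t * Z r k)"
    by (rule generic_perturbation[where F = F and Z = Z and V = V, OF cF _ e'], rule FZ, assumption, rule that, assumption+)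
  define w where "w = (\<lambda>k j. v k j + t *\<^sub>R (\<Sum>b\<in>Basis. Z (j, b) (Some k) *\<^sub>R b))"
  have wV: "inner (w k j) b = V (j, b) (Some k) + t * Z (j, b) (Some k)" if b: "b \<in> Basis" for k j b
  proof -
    have "inner (\<Sum>b\<in>Basis. Z (j, b) (Some k) *\<^sub>R b) b = Z (j, b) (Some k)"
      using b by (rule inner_sum_left_Basis)
    then show ?thesis by (simp add: w_def V_def inner_add_left)
  qed
  show ?thesis
  proof (rule that[of w])
    fix k j assume "j < d"
    have Z1: "\<bar>Z (j, b) (Some k)\<bar> \<le> 1" for b using pos[of "(j, b)" k] by (simp add: Z_def)
    have "norm (\<Sum>b\<in>Basis. Z (j, b) (Some k) *\<^sub>R b) \<le> (\<Sum>b\<in>(Basis :: 'a set). norm (Z (j, b) (Some k) *\<^sub>R b))" by (rule norm_sum)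
    also have "\<dots> \<le> (\<Sum>b\<in>(Basis :: 'a set). 1)" using Z1 by (intro sum_mono) simp
    finally have le: "norm (\<Sum>b\<in>(Basis :: 'a set). Z (j, b) (Some k) *\<^sub>R b) \<le> real DIM('a)" by simp
    have "norm (w k j - v k j) = t * norm (\<Sum>b\<in>(Basis :: 'a set). Z (j, b) (Some k) *\<^sub>R b)" using t(1) by (simp add: w_def)
    also have "\<dots> \<le> e' * (real DIM('a) + 1)" using t le by (intro mult_mono) auto
    also have "\<dots> = e" by (simp add: e'_def add_pos_pos less_imp_neq[symmetric])
    finally show "norm (w k j - v k j) \<le> e" .
  next
    fix A c and c0 :: real
    assume A: "A \<subseteq> T" "card A \<le> q + 1" and rel: "\<forall>j<d. c0 *\<^sub>R x j + (\<Sum>k\<in>A. c k *\<^sub>R w k j) = 0"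
    have finA: "finite A" using A(1) T by (rule finite_subset)
    have "card A \<le> card (J - {r0})" using cardJ A(2) r0(1) finJ by simp
    then obtain R' where R': "R' \<subseteq> J - {r0}" "card R' = card A" using obtain_subset_with_card_n by metis
    define R where "R = insert r0 R'"
    have R: "R \<subseteq> J" "r0 \<in> R" "card R = card A + 1"
    proof -
      have "finite R'" using R'(1) finJ by (meson finite_Diff finite_subset)
      moreover have "r0 \<notin> R'" using R'(1) by blast
      ultimately show "card R = card A + 1" using R'(2) by (simp add: R_def)
    qed (use R' r0 in \<open>auto simp: R_def\<close>)
    define C where "C = insert None (Some ` A)"
    have "(R, C) \<in> F" unfolding F_def C_def using R A(1) by (intro image_eqI[of _ _ "(R, A)"]) auto
    from t(3)[OF this] have ns: "nonsing R C (\<lambda>r k. V r k + t * Z r k)" by simp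
    define cc where "cc = (\<lambda>None \<Rightarrow> c0 / t | Some k \<Rightarrow> c k)"
    have "(\<Sum>k\<in>C. (V r k + t * Z r k) * cc k) = 0" if r: "r \<in> R" for r
    proof -
      obtain j b where jb: "r = (j, b)" "j < d" "b \<in> Basis" using r R(1) by (auto simp: J_def)
      have "(\<Sum>k\<in>C. (V r k + t * Z r k) * cc k) = (V r None + t * Z r None) * cc None + (\<Sum>k\<in>A. (V r (Some k) + t * Z r (Some k)) * cc (Some k))"
        unfolding C_def using finA by (subst sum.insert) (auto simp: sum.reindex)
      also have "(V r None + t * Z r None) * cc None = c0 * inner (x j) b" using t(1) by (simp add: V_def Z_def cc_def jb)
      also have "(\<Sum>k\<in>A. (V r (Some k) + t * Z r (Some k)) * cc (Some k)) = (\<Sum>k\<in>A. c k * inner (w k j) b)"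
        unfolding wV[OF jb(3)] by (simp add: cc_def jb mult.commute)
      also have "c0 * inner (x j) b + (\<Sum>k\<in>A. c k * inner (w k j) b) = inner (c0 *\<^sub>R x j + (\<Sum>k\<in>A. c k *\<^sub>R w k j)) b"
        by (simp add: inner_add_left inner_sum_left)
      also have "\<dots> = 0" unfolding rel[rule_format, OF jb(2)] by simp
      finally show ?thesis .
    qed
    then have "cc None = 0" using nonsingD[OF ns, of cc None] by (simp add: C_def)
    then show "c0 = 0" using t(1) by (simp add: cc_def)
  qed
qed

text \<open>Let \<open>G\<close> interpolate \<open>f\<close> on a fine grid, with node values \<open>x\<close> on the boundary and in general position with
  respect to \<open>x\<close> inside.  Go linearly from \<open>f\<close> to \<open>G\<close>, which are so close that zero is avoided, and then
  from \<open>G\<close> to \<open>x\<close>.  A zero on the second segment would express a positive multiple of \<open>x\<close> by at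
  most \<open>q + 1\<close> active node values.  Normalising gives the homotopy.\<close>
lemma sphere_null_homotopy:
  fixes f :: "(nat \<Rightarrow> real) \<Rightarrow> nat \<Rightarrow> 'a::euclidean_space"
  assumes dim: "q + 2 \<le> DIM('a) * d"
    and cont: "\<And>a. a < d \<Longrightarrow> continuous_on (cubeset q) (\<lambda>t. f t a)"
    and unit: "\<And>t. t \<in> cubeset q \<Longrightarrow> nsq d (f t) = 1" and x: "nsq d x = 1"
    and bd: "\<And>t a. t \<in> cube_boundary q \<Longrightarrow> a < d \<Longrightarrow> f t a = x a"
  obtains H :: "real \<Rightarrow> (nat \<Rightarrow> real) \<Rightarrow> nat \<Rightarrow> 'a" where
    "\<And>a. a < d \<Longrightarrow> continuous_on ({0..1} \<times> cubeset q) (\<lambda>p. H (fst p) (snd p) a)"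
    "\<And>t a. t \<in> cubeset q \<Longrightarrow> a < d \<Longrightarrow> H 0 t a = f t a"
    "\<And>t a. t \<in> cubeset q \<Longrightarrow> a < d \<Longrightarrow> H 1 t a = x a"
    "\<And>s t a. s \<in> {0..1} \<Longrightarrow> t \<in> cube_boundary q \<Longrightarrow> a < d \<Longrightarrow> H s t a = x a"
    "\<And>s t. s \<in> {0..1} \<Longrightarrow> t \<in> cubeset q \<Longrightarrow> nsq d (H s t) = 1"
proof -
  \<comment> \<open>A change of every coordinate by at most this cannot make a unit vector vanish.\<close>
  define \<epsilon> where "\<epsilon> = 1 / real (d + 1)"
  have \<epsilon>: "\<epsilon> / 2 > 0" by (simp add: \<epsilon>_def)
  have "\<exists>\<delta>>0. \<forall>a\<in>{..<d}. \<forall>t\<in>cubeset q. \<forall>y\<in>cubeset q. (\<forall>i<q. \<bar>t i - y i\<bar> \<le> \<delta>) \<longrightarrow> norm (f t a - f y a) < \<epsilon> / 2"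
  proof (rule cube_uniform_continuity_finite[OF finite_lessThan _ \<epsilon>])
    show "continuous_on (cubeset q) (\<lambda>t. f t a)" if "a \<in> {..<d}" for a using cont that by simp
  qed
  then obtain \<delta> where \<delta>: "\<delta> > 0" "\<forall>a\<in>{..<d}. \<forall>t\<in>cubeset q. \<forall>y\<in>cubeset q. (\<forall>i<q. \<bar>t i - y i\<bar> \<le> \<delta>) \<longrightarrow> norm (f t a - f y a) < \<epsilon> / 2"
    by (elim exE conjE) (rule that)
  obtain T :: "(nat \<Rightarrow> nat) set" and pt and lam :: "(nat \<Rightarrow> nat) \<Rightarrow> (nat \<Rightarrow> real) \<Rightarrow> real" where P: "finite T" "\<And>k. k \<in> T \<Longrightarrow> pt k \<in> cubeset q"
    "\<And>k. k \<in> T \<Longrightarrow> continuous_on (cubeset q) (lam k)" "\<And>k t. lam k t \<ge> 0"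
    "\<And>t. t \<in> cubeset q \<Longrightarrow> (\<Sum>k\<in>T. lam k t) = 1"
    "\<And>t. t \<in> cubeset q \<Longrightarrow> card {k \<in> T. lam k t \<noteq> 0} \<le> q + 1"
    "\<And>t k i. t \<in> cubeset q \<Longrightarrow> k \<in> T \<Longrightarrow> lam k t \<noteq> 0 \<Longrightarrow> i < q \<Longrightarrow>
       \<bar>t i - pt k i\<bar> \<le> \<delta> \<and> (t i = 0 \<longrightarrow> pt k i = 0) \<and> (t i = 1 \<longrightarrow> pt k i = 1)"
    by (rule fine_partition_of_unity[OF \<delta>(1), of q], rule that, assumption+)
  obtain w' where w': "\<And>k j. j < d \<Longrightarrow> norm (w' k j - f (pt k) j) \<le> \<epsilon> / 2"
    "\<And>A c c0. A \<subseteq> T \<Longrightarrow> card A \<le> q + 1 \<Longrightarrow> \<forall>j<d. c0 *\<^sub>R x j + (\<Sum>k\<in>A. c k *\<^sub>R w' k j) = 0 \<Longrightarrow> c0 = (0 :: real)"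
    by (rule sphere_general_position[OF P(1) x dim \<epsilon>, of "\<lambda>k. f (pt k)"], rule that, assumption+)
  define B where "B = {k \<in> T. pt k \<in> cube_boundary q}"
  define w where "w = (\<lambda>k. if k \<in> B then x else w' k)"
  have wf: "norm (w k j - f (pt k) j) \<le> \<epsilon> / 2" if "j < d" for k j
    using w'(1)[OF that] bd[of "pt k" j] that \<epsilon> by (auto simp: w_def B_def)
  define G where "G = (\<lambda>t j. \<Sum>k\<in>T. lam k t *\<^sub>R w k j)"
  have Gf: "norm (G t j - f t j) \<le> \<epsilon>" if t: "t \<in> cubeset q" and j: "j < d" for t j
    unfolding G_def
  proof (rule convex_combination_close)
    fix k assume k: "k \<in> T" "lam k t \<noteq> 0"
    have "norm (f t j - f (pt k) j) < \<epsilon> / 2" using \<delta>(2)[rule_format, of j t "pt k"] j t P(2)[OF k(1)] P(7)[OF t k] by auto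
    then have "norm (f (pt k) j - f t j) < \<epsilon> / 2" by (simp only: norm_minus_commute)
    then show "norm (w k j - f t j) \<le> \<epsilon>"
      using wf[OF j, of k] norm_triangle_ineq[of "w k j - f (pt k) j" "f (pt k) j - f t j"] by simp
  qed (use P(4,5) t in auto)
  have Gb: "G t j = x j" if t: "t \<in> cube_boundary q" for t j
  proof -
    have tc: "t \<in> cubeset q" using t by (simp add: cube_boundary_def topspace_cube)
    have "lam k t *\<^sub>R w k j = lam k t *\<^sub>R x j" if k: "k \<in> T" for k
    proof (cases "lam k t = 0")
      case False
      obtain i where i: "i < q" "t i = 0 \<or> t i = 1" using t by (auto simp: cube_boundary_def)
      have "pt k i = 0 \<or> pt k i = 1" using P(7)[OF tc k False i(1)] i(2) by auto
      then have "k \<in> B" using k P(2)[OF k] i(1) by (auto simp: B_def cube_boundary_def topspace_cube)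
      then show ?thesis by (simp add: w_def)
    qed simp
    then have "G t j = (\<Sum>k\<in>T. lam k t *\<^sub>R x j)" unfolding G_def by (rule sum.cong[OF refl])
    then show ?thesis using P(5)[OF tc] by (simp add: scaleR_sum_left[symmetric])
  qed
  define H0 where "H0 = (\<lambda>(s :: real) t j. max 0 (1 - 2 * s) *\<^sub>R f t j + (1 - \<bar>2 * s - 1\<bar>) *\<^sub>R G t j + max 0 (2 * s - 1) *\<^sub>R x j)"
  have H0b: "H0 s t j = x j" if "t \<in> cube_boundary q" "j < d" for s t j
  proof -
    have "max 0 (1 - 2 * s) + (1 - \<bar>2 * s - 1\<bar>) + max 0 (2 * s - 1) = 1" by (simp add: max_def)
    then have "(max 0 (1 - 2 * s) + (1 - \<bar>2 * s - 1\<bar>) + max 0 (2 * s - 1)) *\<^sub>R x j = x j" by (simp only: scaleR_one)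
    then show ?thesis unfolding H0_def Gb[OF that(1)] bd[OF that] by (simp only: scaleR_add_left)
  qed
  have ne: "nsq d (H0 s t) \<noteq> 0" if s: "s \<in> {0..1}" and t: "t \<in> cubeset q" for s t
  proof (cases "s \<le> 1 / 2")
    case True
    show ?thesis
    proof (rule nsq_nonzero_of_close[OF unit[OF t]])
      fix a assume a: "a < d"
      have "H0 s t a - f t a = (2 * s) *\<^sub>R (G t a - f t a)"
        using True s by (simp add: H0_def max_def algebra_simps)
      then have "norm (H0 s t a - f t a) = (2 * s) * norm (G t a - f t a)" using s by simp
      also have "\<dots> \<le> 1 * norm (G t a - f t a)" using True by (intro mult_right_mono) auto
      also have "\<dots> \<le> 1 / real (d + 1)" using Gf[OF t a] by (simp add: \<epsilon>_def)
      finally show "norm (H0 s t a - f t a) \<le> 1 / real (d + 1)" .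
    qed
  next
    case False
    show ?thesis
    proof
      assume "nsq d (H0 s t) = 0"
      then have z: "H0 s t j = 0" if "j < d" for j using that by (simp add: nsq_eq_0_iff)
      define u where "u = 2 * s - 1"
      have u: "0 < u" "u \<le> 1" using False s by (auto simp: u_def)
      define A where "A = {k \<in> T. lam k t \<noteq> 0} - B"
      have "card A \<le> card {k \<in> T. lam k t \<noteq> 0}" unfolding A_def using P(1) by (intro card_mono) auto
      then have A: "A \<subseteq> T" "card A \<le> q + 1" using P(6)[OF t] by (auto simp: A_def)
      define \<beta> where "\<beta> = (\<Sum>k\<in>B. lam k t)"
      have \<beta>: "\<beta> \<ge> 0" unfolding \<beta>_def using P(4) by (simp add: sum_nonneg)
      have BT: "B \<subseteq> T" by (auto simp: B_def)
      have Gs: "G t j = \<beta> *\<^sub>R x j + (\<Sum>k\<in>A. lam k t *\<^sub>R w' k j)" for j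
      proof -
        have "G t j = (\<Sum>k\<in>T - B. lam k t *\<^sub>R w k j) + (\<Sum>k\<in>B. lam k t *\<^sub>R w k j)"
          unfolding G_def using BT P(1) by (rule sum.subset_diff)
        also have "(\<Sum>k\<in>B. lam k t *\<^sub>R w k j) = \<beta> *\<^sub>R x j" by (simp add: w_def \<beta>_def scaleR_sum_left)
        also have "(\<Sum>k\<in>T - B. lam k t *\<^sub>R w k j) = (\<Sum>k\<in>A. lam k t *\<^sub>R w k j)"
          using P(1) by (intro sum.mono_neutral_right) (auto simp: A_def)
        also have "\<dots> = (\<Sum>k\<in>A. lam k t *\<^sub>R w' k j)" by (intro sum.cong) (auto simp: A_def w_def)
        finally show ?thesis by simp
      qed
      have "((1 - u) * \<beta> + u) *\<^sub>R x j + (\<Sum>k\<in>A. ((1 - u) * lam k t) *\<^sub>R w' k j) = 0" if j: "j < d" for j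
      proof -
        have "H0 s t j = (1 - u) *\<^sub>R G t j + u *\<^sub>R x j" using False by (simp add: H0_def u_def max_def)
        also have "\<dots> = ((1 - u) * \<beta> + u) *\<^sub>R x j + (\<Sum>k\<in>A. ((1 - u) * lam k t) *\<^sub>R w' k j)"
          unfolding Gs scaleR_add_right scaleR_sum_right scaleR_scaleR scaleR_add_left by (simp only: add_ac)
        finally show ?thesis using z[OF j] by simp
      qed
      then have "(1 - u) * \<beta> + u = 0" using w'(2)[OF A, of "(1 - u) * \<beta> + u" "\<lambda>k. (1 - u) * lam k t"] by blast
      moreover have "(1 - u) * \<beta> \<ge> 0" using u \<beta> by simp
      ultimately show False using u by simp
    qed
  qed
  show ?thesis
  proof (rule that[of "\<lambda>s t. normalised d (H0 s t)"])
    fix a assume a: "a < d"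
    have cH: "continuous_on ({0..1} \<times> cubeset q) (\<lambda>p. H0 (fst p) (snd p) j)" if j: "j < d" for j
    proof -
      have sub: "snd ` ({0..1::real} \<times> cubeset q) \<subseteq> cubeset q" by auto
      have cf: "continuous_on ({0..1::real} \<times> cubeset q) (\<lambda>p. f (snd p) j)"
        by (rule continuous_on_compose2[OF cont[OF j] continuous_on_snd[OF continuous_on_id] sub])
      have cl: "continuous_on ({0..1::real} \<times> cubeset q) (\<lambda>p. lam k (snd p))" if "k \<in> T" for k
        by (rule continuous_on_compose2[OF P(3)[OF that] continuous_on_snd[OF continuous_on_id] sub])
      have cs: "continuous_on ({0..1::real} \<times> cubeset q) (\<lambda>p. fst p)" by (rule continuous_on_fst[OF continuous_on_id])
      show ?thesis unfolding H0_def G_def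
        by (intro continuous_on_add continuous_on_scaleR continuous_on_max continuous_on_diff continuous_on_mult
            continuous_on_const continuous_on_sum continuous_on_rabs cf cl cs)
    qed
    show "continuous_on ({0..1} \<times> cubeset q) (\<lambda>p. normalised d (H0 (fst p) (snd p)) a)"
      by (rule continuous_normalised[OF cH _ a]) (use ne in auto)
  next
    fix t a assume t: "t \<in> cubeset q" and a: "a < d"
    have "nsq d (H0 0 t) = nsq d (f t)" by (rule nsq_cong) (simp add: H0_def)
    then have "normalised d (H0 0 t) = H0 0 t" using unit[OF t] by (intro normalised_unit) simp
    then show "normalised d (H0 0 t) a = f t a" by (simp add: H0_def)
    have "nsq d (H0 1 t) = nsq d x" by (rule nsq_cong) (simp add: H0_def)
    then have "normalised d (H0 1 t) = H0 1 t" using x by (intro normalised_unit) simp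
    then show "normalised d (H0 1 t) a = x a" by (simp add: H0_def)
  next
    fix s t a assume "s \<in> {0..1::real}" and t: "t \<in> cube_boundary q" and a: "a < d"
    have "nsq d (H0 s t) = nsq d x" by (rule nsq_cong) (rule H0b[OF t])
    then have "normalised d (H0 s t) = H0 s t" using x by (intro normalised_unit) simp
    then show "normalised d (H0 s t) a = x a" by (simp add: H0b[OF t a])
  next
    fix s t assume "s \<in> {0..1::real}" "t \<in> cubeset q"
    then show "nsq d (normalised d (H0 s t)) = 1" by (intro nsq_normalised ne)
  qed
qed

section \<open>Extension over the cube by stable tuples\<close>

definition tent :: "real \<Rightarrow> nat \<Rightarrow> real" where
  "tent \<tau> l = max 0 (1 - \<bar>\<tau> - real l\<bar>)"

lemma tent_support: "tent \<tau> l \<noteq> 0 \<Longrightarrow> \<tau> \<ge> 0 \<Longrightarrow> l = nat \<lfloor>\<tau>\<rfloor> \<or> l = Suc (nat \<lfloor>\<tau>\<rfloor>)"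
proof -
  assume "tent \<tau> l \<noteq> 0" "\<tau> \<ge> 0"
  then have "\<bar>\<tau> - real l\<bar> < 1" by (simp add: tent_def max_def split: if_splits)
  then show ?thesis using \<open>\<tau> \<ge> 0\<close> by linarith
qed

lemma sum_tent: "\<tau> \<ge> 0 \<Longrightarrow> \<tau> + 1 \<le> real L \<Longrightarrow> (\<Sum>l\<le>L. tent \<tau> l) = 1"
proof -
  assume t: "\<tau> \<ge> 0" "\<tau> + 1 \<le> real L"
  define m where "m = nat \<lfloor>\<tau>\<rfloor>"
  have m: "real m \<le> \<tau>" "\<tau> < real m + 1" using t(1) by (simp_all add: m_def)
  have mL: "Suc m \<le> L" using m t(2) by linarith
  have "(\<Sum>l\<le>L. tent \<tau> l) = (\<Sum>l\<in>{m, Suc m}. tent \<tau> l)"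
  proof (rule sum.mono_neutral_right)
    show "\<forall>l\<in>{..L} - {m, Suc m}. tent \<tau> l = 0" using tent_support[of \<tau>] t(1) by (auto simp: m_def)
  qed (use mL in auto)
  also have "\<dots> = tent \<tau> m + tent \<tau> (Suc m)" by simp
  also have "\<dots> = 1" using m by (simp add: tent_def)
  finally show ?thesis .
qed

lemma stable_scaled:
  assumes "\<And>i. i < n \<Longrightarrow> r i \<noteq> 0" "\<And>i a. i < n \<Longrightarrow> a < d \<Longrightarrow> v i a = r i *\<^sub>R w i a"
    and s: "stable d n w"
  shows "stable d n v"
proof -
  have "hp d f (v i) = r i *\<^sub>R hp d f (w i)" if "i < n" for f i
    unfolding hp_def using assms(2)[OF that] by (simp add: conj_scaleR scaleR_sum_right)
  then have "{i. i < n \<and> hp d f (v i) = 0} = {i. i < n \<and> hp d f (w i) = 0}" for f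
    using assms(1) by auto
  then show ?thesis using s unfolding stable_def by simp
qed

text \<open>Up to the factor \<open>c k\<close>, the perturbation is along a single Cauchy matrix with rows \<open>i < n\<close> and
  columns \<open>(k, j)\<close>, so one parameter makes all of its countably many square submatrices of the form \<open>(R, A \<times> {..<d})\<close>
  nonsingular.  A functional \<open>f\<close> that vanishes on the interpolated vectors with index in \<open>R\<close> gives a
  relation between the \<open>d * card A\<close> columns over \<open>A\<close> on the rows \<open>R\<close>, with coefficients
  \<open>lam k * c k\<close> times the conjugate of \<open>f j\<close>; so \<open>R\<close> has fewer than \<open>d * card A\<close> elements.\<close>
lemma interpolated_family_general_position:
  fixes h :: "'k \<Rightarrow> nat \<Rightarrow> nat \<Rightarrow> 'a::rc_scalar" and c :: "'k \<Rightarrow> real"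
  assumes K: "countable K" and c: "\<And>k. k \<in> K \<Longrightarrow> c k > 0"
  obtains w where "\<And>k i j. k \<in> K \<Longrightarrow> norm (w k i j - h k i j) \<le> c k"
    "\<And>A lam. finite A \<Longrightarrow> A \<noteq> {} \<Longrightarrow> A \<subseteq> K \<Longrightarrow> (\<forall>k\<in>A. lam k \<noteq> 0) \<Longrightarrow> d * (d * card A) \<le> n \<Longrightarrow>
        0 < d \<Longrightarrow> stable d n (\<lambda>i j. \<Sum>k\<in>A. lam k *\<^sub>R w k i j)"
proof -
  have cK: "countable (K \<times> {..<d})" using K by simp
  obtain y :: "'k \<times> nat \<Rightarrow> real" where y: "inj_on y (K \<times> {..<d})" "\<And>k. y k \<ge> 1"
    by (rule countable_injective_positive[OF cK], rule that, assumption+)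
  define Z where "Z = (\<lambda>(i::nat) kj. 1 / (of_real (real i) + of_real (y kj)) :: 'a)"
  define V where "V = (\<lambda>i kj. h (fst kj) i (snd kj) /\<^sub>R c (fst kj))"
  define F where "F = (\<lambda>(R, A). (R, A \<times> {..<d})) ` (Pow {..<n} \<times> {A. A \<subseteq> K \<and> finite A}) \<inter> {(R, C). card R = card C}"
  have "countable (Pow {..<n} \<times> {A. A \<subseteq> K \<and> finite A})"
    using countable_Collect_finite_subset[OF K] by (intro countable_SIGMA) (auto intro: countable_finite simp: conj_commute)
  then have cF: "countable F" unfolding F_def by (intro countable_Int1 countable_image)
  have FZ: "finite R \<and> finite C \<and> card R = card C \<and> nonsing R C Z" if RC: "(R, C) \<in> F" for R C
  proof -
    obtain A where A: "C = A \<times> {..<d}" "R \<subseteq> {..<n}" "A \<subseteq> K" "finite A" "card R = card C"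
      using RC unfolding F_def by auto
    have fin: "finite R" "finite C" using A by (auto intro: finite_subset)
    have "nonsing R C Z"
      unfolding Z_def
    proof (rule cauchy_nonsing[OF fin])
      show "card C \<le> card R" using A(5) by simp
      show "inj_on (\<lambda>i. of_real (real i) :: 'a) R" by (auto simp: inj_on_def)
      have "inj_on y C" using y(1) A(1,3) by (auto intro: inj_on_subset)
      then show "inj_on (\<lambda>kj. of_real (y kj) :: 'a) C" by (auto simp: inj_on_def)
      fix r k
      have "real r + y k \<noteq> 0" using y(2)[of k] by simp
      then show "of_real (real r) + of_real (y k) \<noteq> (0 :: 'a)" by (metis of_real_add of_real_eq_0_iff)
    qed
    then show ?thesis using fin A(5) by blast
  qed
  have one: "(0::real) < 1" by simp
  obtain t where t: "0 < t" "t < 1" "\<And>R C. (R, C) \<in> F \<Longrightarrow> nonsing R C (\<lambda>r k. V r k + of_real t * Z r k)"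
    by (rule generic_perturbation[where F = F and Z = Z and V = V, OF cF _ one], rule FZ, assumption, rule that, assumption+)
  define w where "w = (\<lambda>k i j. h k i j + c k *\<^sub>R (of_real t * Z i (k, j)))"
  have wV: "w k i j = c k *\<^sub>R (V i (k, j) + of_real t * Z i (k, j))" if "k \<in> K" for k i j
    using c[OF that] by (simp add: w_def V_def scaleR_add_right)
  show ?thesis
  proof (rule that[of w])
    fix k i j assume k: "k \<in> K"
    have "norm (Z i (k, j)) = 1 / (real i + y (k, j))"
    proof -
      have "norm (of_real (real i) + of_real (y (k, j)) :: 'a) = \<bar>real i + y (k, j)\<bar>" by (metis norm_of_real of_real_add)
      then show ?thesis using y(2)[of "(k, j)"] unfolding Z_def norm_divide by simp
    qed
    also have "\<dots> \<le> 1" using y(2)[of "(k, j)"] by simp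
    finally have "norm (Z i (k, j)) \<le> 1" .
    then have "t * norm (Z i (k, j)) \<le> 1 * 1" using t by (intro mult_mono) auto
    then have "c k * (t * norm (Z i (k, j))) \<le> c k * 1" using c[OF k] by (intro mult_left_mono) auto
    then show "norm (w k i j - h k i j) \<le> c k" using t c[OF k] by (simp add: w_def norm_mult)
  next
    fix A and lam :: "'k \<Rightarrow> real"
    assume A: "finite A" "A \<noteq> {}" "A \<subseteq> K" "\<forall>k\<in>A. lam k \<noteq> 0" "d * (d * card A) \<le> n" and d: "0 < d"
    define u where "u = (\<lambda>i j. \<Sum>k\<in>A. lam k *\<^sub>R w k i j)"
    show "stable d n (\<lambda>i j. \<Sum>k\<in>A. lam k *\<^sub>R w k i j)"
      unfolding stable_def u_def[symmetric]
    proof (intro allI impI)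
      fix f :: "nat \<Rightarrow> 'a" assume "\<exists>a<d. f a \<noteq> 0"
      then obtain a0 where a0: "a0 < d" "f a0 \<noteq> 0" by blast
      define I where "I = {i. i < n \<and> hp d f (u i) = 0}"
      have "card I < d * card A"
      proof (rule ccontr)
        assume "\<not> card I < d * card A"
        then have "d * card A \<le> card I" by simp
        then obtain R where R: "R \<subseteq> I" "card R = d * card A" using obtain_subset_with_card_n by metis
        define C where "C = A \<times> {..<d}"
        have "card R = card C" using R(2) by (simp add: C_def card_cartesian_product mult.commute)
        moreover have "R \<subseteq> {..<n}" using R(1) by (auto simp: I_def)
        ultimately have "(R, C) \<in> F" unfolding F_def C_def using A(1,3) by (intro IntI image_eqI[of _ _ "(R, A)"]) auto
        from t(3)[OF this] have ns: "nonsing R C (\<lambda>r k. V r k + of_real t * Z r k)" .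
        define cc where "cc = (\<lambda>kj. (lam (fst kj) * c (fst kj)) *\<^sub>R conjugate (f (snd kj)))"
        have sum0: "(\<Sum>kj\<in>C. (V r kj + of_real t * Z r kj) * cc kj) = 0" if r: "r \<in> R" for r
        proof -
          have "hp d f (u r) = 0" using r R(1) by (auto simp: I_def)
          then have z: "conjugate (hp d f (u r)) = 0" by simp
          have "conjugate (hp d f (u r)) = (\<Sum>j<d. conjugate (f j) * u r j)"
            by (simp add: hp_def conj_sum conjugate_dist_mul)
          also have "\<dots> = (\<Sum>j<d. \<Sum>k\<in>A. (V r (k, j) + of_real t * Z r (k, j)) * cc (k, j))"
          proof (rule sum.cong[OF refl])
            fix j assume "j \<in> {..<d}"
            have "conjugate (f j) * u r j = (\<Sum>k\<in>A. lam k *\<^sub>R (conjugate (f j) * w k r j))"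
              by (simp add: u_def sum_distrib_left)
            also have "\<dots> = (\<Sum>k\<in>A. (V r (k, j) + of_real t * Z r (k, j)) * cc (k, j))"
            proof (rule sum.cong[OF refl])
              fix k assume "k \<in> A"
              then have "k \<in> K" using A(3) by blast
              show "lam k *\<^sub>R (conjugate (f j) * w k r j) = (V r (k, j) + of_real t * Z r (k, j)) * cc (k, j)"
                unfolding wV[OF \<open>k \<in> K\<close>] cc_def by (simp add: mult.commute)
            qed
            finally show "conjugate (f j) * u r j = (\<Sum>k\<in>A. (V r (k, j) + of_real t * Z r (k, j)) * cc (k, j))" .
          qed
          also have "\<dots> = (\<Sum>k\<in>A. \<Sum>j<d. (V r (k, j) + of_real t * Z r (k, j)) * cc (k, j))" by (rule sum.swap)
          also have "\<dots> = (\<Sum>kj\<in>C. (V r kj + of_real t * Z r kj) * cc kj)"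
            unfolding C_def by (simp add: sum.cartesian_product case_prod_beta)
          finally show ?thesis using z by simp
        qed
        have cc0: "cc kj = 0" if "kj \<in> C" for kj by (rule nonsingD[OF ns sum0 that])
        obtain k where k: "k \<in> A" using A(2) by blast
        have "cc (k, a0) = 0" by (rule cc0) (use k a0 in \<open>simp add: C_def\<close>)
        moreover have "lam k * c k \<noteq> 0" using A(3,4) k c[of k] by auto
        ultimately show False using a0(2) by (simp add: cc_def)
      qed
      then have "d * card I < d * (d * card A)" using d by simp
      then show "d * card {i. i < n \<and> hp d f (u i) = 0} < n" using A(5) unfolding I_def by linarith
    qed
  qed
qed

text \<open>Vanishes exactly on the boundary of the cube; its reciprocal measures how fine the interpolation
  has to be at a point.\<close>
definition boundary_weight :: "nat \<Rightarrow> (nat \<Rightarrow> real) \<Rightarrow> real" where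
  "boundary_weight N p = (\<Prod>i<N. p i * (1 - p i))"

lemma boundary_weight_bounds:
  assumes "p \<in> cubeset N"
  shows "0 \<le> boundary_weight N p" "boundary_weight N p \<le> 1" "boundary_weight N p = 0 \<longleftrightarrow> p \<in> cube_boundary N"
proof -
  have b: "0 \<le> p i" "p i \<le> 1" if "i < N" for i using assms that by (auto simp: PiE_iff)
  show "0 \<le> boundary_weight N p" unfolding boundary_weight_def using b by (intro prod_nonneg) auto
  show "boundary_weight N p \<le> 1" unfolding boundary_weight_def using b by (intro prod_le_1) (auto simp: mult_le_one)
  show "boundary_weight N p = 0 \<longleftrightarrow> p \<in> cube_boundary N"
    using assms by (auto simp: boundary_weight_def cube_boundary_def topspace_cube)
qed

lemma continuous_boundary_weight: "continuous_on S (boundary_weight N)"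
  unfolding boundary_weight_def by (intro continuous_on_prod continuous_on_mult continuous_on_diff continuous_on_const continuous_on_coordinate)

text \<open>At level \<open>l\<close> the family \<open>H\<close> is interpolated on a grid with error of order \<open>1/l\<close>, and a tent function
  of \<open>1 / boundary_weight\<close> blends two consecutive levels.  The error then tends to zero at the boundary,
  where \<open>H\<close> itself is kept, and at an interior point at most \<open>N + 1\<close> nodes on each of two
  levels are active, so \<open>interpolated_family_general_position\<close> applies with \<open>card A \<le> 2 (N + 1)\<close>.\<close>
lemma stable_extension:
  fixes H :: "(nat \<Rightarrow> real) \<Rightarrow> nat \<Rightarrow> nat \<Rightarrow> 'a::rc_scalar"
  assumes d: "d > 0" and n: "d * (d * (2 * (N + 1))) \<le> n"
    and cont: "\<And>i j. i < n \<Longrightarrow> j < d \<Longrightarrow> continuous_on (cubeset N) (\<lambda>p. H p i j)"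
    and unit: "\<And>p. p \<in> cubeset N \<Longrightarrow> unit_tuple d n (H p)"
  obtains V where "\<And>i j. i < n \<Longrightarrow> j < d \<Longrightarrow> continuous_on (cubeset N) (\<lambda>p. V p i j)"
    "\<And>p. p \<in> cubeset N \<Longrightarrow> unit_tuple d n (V p)"
    "\<And>p i j. p \<in> cube_boundary N \<Longrightarrow> i < n \<Longrightarrow> j < d \<Longrightarrow> V p i j = H p i j"
    "\<And>p. p \<in> cubeset N \<Longrightarrow> p \<notin> cube_boundary N \<Longrightarrow> stable d n (V p)"
proof -
  \<comment> \<open>A change of every coordinate by at most \<open>2 \<eta>\<close> cannot make a unit vector vanish.\<close>
  define \<eta> where "\<eta> = 1 / (2 * real (d + 1))"
  have \<eta>: "\<eta> > 0" by (simp add: \<eta>_def)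
  define \<epsilon> where "\<epsilon> = (\<lambda>l. \<eta> / (real l + 1))"
  have \<epsilon>: "\<epsilon> l > 0" for l using \<eta> by (simp add: \<epsilon>_def add_nonneg_pos)
  have "\<exists>(T :: (nat \<Rightarrow> nat) set) pt (lam :: (nat \<Rightarrow> nat) \<Rightarrow> (nat \<Rightarrow> real) \<Rightarrow> real). finite T \<and> (\<forall>k\<in>T. pt k \<in> cubeset N) \<and> (\<forall>k\<in>T. continuous_on (cubeset N) (lam k)) \<and>
     (\<forall>k p. lam k p \<ge> 0) \<and> (\<forall>p\<in>cubeset N. (\<Sum>k\<in>T. lam k p) = 1) \<and>
     (\<forall>p\<in>cubeset N. card {k \<in> T. lam k p \<noteq> 0} \<le> N + 1) \<and>
     (\<forall>p\<in>cubeset N. \<forall>k\<in>T. lam k p \<noteq> 0 \<longrightarrow> (\<forall>i<n. \<forall>j<d. norm (H (pt k) i j - H p i j) \<le> \<epsilon> l))"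
    (is "\<exists>T pt lam. ?Q l T pt lam") for l
  proof -
    have "\<exists>\<delta>>0. \<forall>a\<in>{..<n} \<times> {..<d}. \<forall>x\<in>cubeset N. \<forall>y\<in>cubeset N. (\<forall>i<N. \<bar>x i - y i\<bar> \<le> \<delta>) \<longrightarrow>
        norm (H x (fst a) (snd a) - H y (fst a) (snd a)) < \<epsilon> l"
    proof (rule cube_uniform_continuity_finite[OF _ _ \<epsilon>])
      show "finite ({..<n} \<times> {..<d})" by simp
      show "continuous_on (cubeset N) (\<lambda>p. H p (fst a) (snd a))" if "a \<in> {..<n} \<times> {..<d}" for a using cont that by auto
    qed
    then obtain \<delta> where \<delta>: "\<delta> > 0" "\<forall>a\<in>{..<n} \<times> {..<d}. \<forall>x\<in>cubeset N. \<forall>y\<in>cubeset N. (\<forall>i<N. \<bar>x i - y i\<bar> \<le> \<delta>) \<longrightarrow>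
        norm (H x (fst a) (snd a) - H y (fst a) (snd a)) < \<epsilon> l" by (elim exE conjE) (rule that)
    obtain T :: "(nat \<Rightarrow> nat) set" and pt and lam :: "(nat \<Rightarrow> nat) \<Rightarrow> (nat \<Rightarrow> real) \<Rightarrow> real" where P: "finite T" "\<And>k. k \<in> T \<Longrightarrow> pt k \<in> cubeset N"
      "\<And>k. k \<in> T \<Longrightarrow> continuous_on (cubeset N) (lam k)" "\<And>k t. lam k t \<ge> 0"
      "\<And>t. t \<in> cubeset N \<Longrightarrow> (\<Sum>k\<in>T. lam k t) = 1"
      "\<And>t. t \<in> cubeset N \<Longrightarrow> card {k \<in> T. lam k t \<noteq> 0} \<le> N + 1"
      "\<And>t k i. t \<in> cubeset N \<Longrightarrow> k \<in> T \<Longrightarrow> lam k t \<noteq> 0 \<Longrightarrow> i < N \<Longrightarrow>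
         \<bar>t i - pt k i\<bar> \<le> \<delta> \<and> (t i = 0 \<longrightarrow> pt k i = 0) \<and> (t i = 1 \<longrightarrow> pt k i = 1)"
      by (rule fine_partition_of_unity[OF \<delta>(1), of N], rule that, assumption+)
    have "norm (H (pt k) i j - H p i j) \<le> \<epsilon> l" if p: "p \<in> cubeset N" and k: "k \<in> T" "lam k p \<noteq> 0" and ij: "i < n" "j < d" for p k i j
    proof -
      have a: "(i, j) \<in> {..<n} \<times> {..<d}" using ij by simp
      have "\<forall>m<N. \<bar>pt k m - p m\<bar> \<le> \<delta>" using P(7)[OF p k] by (simp add: abs_minus_commute)
      from \<delta>(2)[rule_format, OF a P(2)[OF k(1)] p, OF this[rule_format]] show ?thesis by simp
    qed
    then have "?Q l T pt lam" using P(1-6) by (intro conjI ballI allI impI) simp_all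
    then show ?thesis by (intro exI)
  qed
  then have "\<forall>l. \<exists>T pt lam. ?Q l T pt lam" by blast
  then obtain T :: "nat \<Rightarrow> (nat \<Rightarrow> nat) set" and pt and lam :: "nat \<Rightarrow> (nat \<Rightarrow> nat) \<Rightarrow> (nat \<Rightarrow> real) \<Rightarrow> real"
    where Q: "\<forall>l. ?Q l (T l) (pt l) (lam l)"
    unfolding choice_iff by (elim exE) (rule that)
  have P: "finite (T l)" "\<And>k. k \<in> T l \<Longrightarrow> continuous_on (cubeset N) (lam l k)" "\<And>k p. lam l k p \<ge> 0"
    "\<And>p. p \<in> cubeset N \<Longrightarrow> (\<Sum>k\<in>T l. lam l k p) = 1" "\<And>p. p \<in> cubeset N \<Longrightarrow> card {k \<in> T l. lam l k p \<noteq> 0} \<le> N + 1"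
    "\<And>p k i j. p \<in> cubeset N \<Longrightarrow> k \<in> T l \<Longrightarrow> lam l k p \<noteq> 0 \<Longrightarrow> i < n \<Longrightarrow> j < d \<Longrightarrow> norm (H (pt l k) i j - H p i j) \<le> \<epsilon> l" for l
  proof -
    have Ql: "?Q l (T l) (pt l) (lam l)" using Q by (rule spec)
    show "finite (T l)" using Ql by (elim conjE)
    have Q2: "\<forall>k\<in>T l. continuous_on (cubeset N) (lam l k)" using Ql by (elim conjE)
    then show "continuous_on (cubeset N) (lam l k)" if "k \<in> T l" for k using that by (rule bspec)
    have Q3: "\<forall>k p. lam l k p \<ge> 0" using Ql by (elim conjE)
    then show "lam l k p \<ge> 0" for k p by simp
    have Q4: "\<forall>p\<in>cubeset N. (\<Sum>k\<in>T l. lam l k p) = 1" using Ql by (elim conjE)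
    then show "(\<Sum>k\<in>T l. lam l k p) = 1" if "p \<in> cubeset N" for p using that by (rule bspec)
    have Q5: "\<forall>p\<in>cubeset N. card {k \<in> T l. lam l k p \<noteq> 0} \<le> N + 1" using Ql by (elim conjE)
    then show "card {k \<in> T l. lam l k p \<noteq> 0} \<le> N + 1" if "p \<in> cubeset N" for p using that by (rule bspec)
    have Q6: "\<forall>p\<in>cubeset N. \<forall>k\<in>T l. lam l k p \<noteq> 0 \<longrightarrow> (\<forall>i<n. \<forall>j<d. norm (H (pt l k) i j - H p i j) \<le> \<epsilon> l)"
      using Ql by (elim conjE)
    show "norm (H (pt l k) i j - H p i j) \<le> \<epsilon> l" if "p \<in> cubeset N" "k \<in> T l" "lam l k p \<noteq> 0" "i < n" "j < d" for p k i j
      using Q6[rule_format, OF that] .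
  qed
  define K where "K = Sigma UNIV T"
  have cK: "countable K" unfolding K_def using P(1) by (intro countable_SIGMA) (auto intro: countable_finite)
  obtain w where w: "\<And>k i j. k \<in> K \<Longrightarrow> norm (w k i j - H (pt (fst k) (snd k)) i j) \<le> \<epsilon> (fst k)"
    "\<And>A lam. finite A \<Longrightarrow> A \<noteq> {} \<Longrightarrow> A \<subseteq> K \<Longrightarrow> (\<forall>k\<in>A. lam k \<noteq> 0) \<Longrightarrow> d * (d * card A) \<le> n \<Longrightarrow>
        0 < d \<Longrightarrow> stable d n (\<lambda>i j. \<Sum>k\<in>A. lam k *\<^sub>R w k i j)"
    by (rule interpolated_family_general_position[OF cK, of "\<lambda>k. \<epsilon> (fst k)" "\<lambda>k. H (pt (fst k) (snd k))" d n], rule \<epsilon>, rule that, assumption+)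
  define G where "G = (\<lambda>l p i j. \<Sum>k\<in>T l. lam l k p *\<^sub>R w (l, k) i j)"
  have GH: "norm (G l p i j - H p i j) \<le> 2 * \<epsilon> l" if p: "p \<in> cubeset N" and ij: "i < n" "j < d" for l p i j
    unfolding G_def
  proof (rule convex_combination_close)
    fix k assume k: "k \<in> T l" "lam l k p \<noteq> 0"
    have "norm (w (l, k) i j - H (pt l k) i j) \<le> \<epsilon> l" using w(1)[of "(l, k)" i j] k by (simp add: K_def)
    then show "norm (w (l, k) i j - H p i j) \<le> 2 * \<epsilon> l"
      using P(6)[OF p k ij] norm_triangle_ineq[of "w (l, k) i j - H (pt l k) i j" "H (pt l k) i j - H p i j"] by simp
  qed (use P p in auto)
  have Gc: "continuous_on (cubeset N) (\<lambda>p. G l p i j)" for l i j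
    unfolding G_def using P(2) by (intro continuous_on_sum continuous_on_scaleR continuous_on_const) auto
  define \<tau> where "\<tau> = (\<lambda>p. 1 / boundary_weight N p)"
  define W where "W = (\<lambda>p i j. if p \<in> cube_boundary N then H p i j else \<Sum>l\<le>nat \<lceil>\<tau> p + 1\<rceil>. tent (\<tau> p) l *\<^sub>R G l p i j)"
  have int: "boundary_weight N p > 0" "\<tau> p \<ge> 1" if "p \<in> cubeset N" "p \<notin> cube_boundary N" for p
  proof -
    show b: "boundary_weight N p > 0" using boundary_weight_bounds[OF that(1)] that(2) by (simp add: less_le)
    show "\<tau> p \<ge> 1" using b boundary_weight_bounds(2)[OF that(1)] by (simp add: \<tau>_def)
  qed
  have WL: "W p i j = (\<Sum>l\<le>L. tent (\<tau> p) l *\<^sub>R G l p i j)"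
    if p: "p \<in> cubeset N" "p \<notin> cube_boundary N" and L: "\<tau> p + 1 \<le> real L" for p i j L
  proof -
    have t0: "\<tau> p \<ge> 0" using int(2)[OF p] by simp
    define L0 where "L0 = nat \<lceil>\<tau> p + 1\<rceil>"
    have L0: "L0 \<le> L" "\<tau> p + 1 \<le> real L0" using L t0 unfolding L0_def by linarith+
    have "(\<Sum>l\<le>L0. tent (\<tau> p) l *\<^sub>R G l p i j) = (\<Sum>l\<le>L. tent (\<tau> p) l *\<^sub>R G l p i j)"
    proof (rule sum.mono_neutral_left)
      show "\<forall>l\<in>{..L} - {..L0}. tent (\<tau> p) l *\<^sub>R G l p i j = 0"
      proof
        fix l assume "l \<in> {..L} - {..L0}"
        then have "real l > \<tau> p + 1" using L0(2) by auto
        then show "tent (\<tau> p) l *\<^sub>R G l p i j = 0" by (simp add: tent_def)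
      qed
    qed (use L0 in auto)
    then show ?thesis using p by (simp add: W_def L0_def)
  qed
  have WH: "norm (W p i j - H p i j) \<le> 2 * (\<eta> * boundary_weight N p)" if p: "p \<in> cubeset N" and ij: "i < n" "j < d" for p i j
  proof (cases "p \<in> cube_boundary N")
    case True
    then show ?thesis using \<eta> boundary_weight_bounds(1)[OF p] by (simp add: W_def)
  next
    case False
    define L where "L = nat \<lceil>\<tau> p + 1\<rceil>"
    have t0: "\<tau> p \<ge> 1" by (rule int(2)[OF p False])
    have L: "\<tau> p + 1 \<le> real L" using t0 unfolding L_def by linarith
    have "norm ((\<Sum>l\<le>L. tent (\<tau> p) l *\<^sub>R G l p i j) - H p i j) \<le> 2 * (\<eta> * boundary_weight N p)"
    proof (rule convex_combination_close)
      show "(\<Sum>l\<le>L. tent (\<tau> p) l) = 1" using t0 L by (intro sum_tent) auto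
      fix l assume "l \<in> {..L}" and l: "tent (\<tau> p) l \<noteq> 0"
      have "real l + 1 > \<tau> p" using l by (simp add: tent_def max_def split: if_splits)
      then have "\<epsilon> l \<le> \<eta> / \<tau> p" unfolding \<epsilon>_def using \<eta> t0 by (intro divide_left_mono) auto
      then have "\<epsilon> l \<le> \<eta> * boundary_weight N p" by (simp add: \<tau>_def)
      then show "norm (G l p i j - H p i j) \<le> 2 * (\<eta> * boundary_weight N p)" using GH[OF p ij, of l] by linarith
    qed (simp add: tent_def)
    then show ?thesis by (simp add: WL[OF p False L])
  qed
  have Wne: "nsq d (W p i) \<noteq> 0" if p: "p \<in> cubeset N" and i: "i < n" for p i
  proof (rule nsq_nonzero_of_close)
    show "nsq d (H p i) = 1" using unit[OF p] i unfolding unit_tuple_def by blast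
    fix a assume a: "a < d"
    have "2 * (\<eta> * boundary_weight N p) \<le> 2 * (\<eta> * 1)" using \<eta> boundary_weight_bounds(2)[OF p] by (intro mult_left_mono) auto
    also have "\<dots> = 1 / real (d + 1)" by (simp add: \<eta>_def field_simps)
    finally show "norm (W p i a - H p i a) \<le> 1 / real (d + 1)" using WH[OF p i a] by linarith
  qed
  have Wc: "continuous_on (cubeset N) (\<lambda>p. W p i j)" if ij: "i < n" "j < d" for i j
    unfolding continuous_on_sequentially
  proof (intro allI ballI impI)
    fix x p assume p: "p \<in> cubeset N" and x: "(\<forall>m. x m \<in> cubeset N) \<and> x \<longlonglongrightarrow> p"
    have bw: "(\<lambda>m. boundary_weight N (x m)) \<longlonglongrightarrow> boundary_weight N p"
      using continuous_boundary_weight[of "cubeset N" N] p x unfolding continuous_on_sequentially comp_def by blast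
    have Hc: "(\<lambda>m. H (x m) i j) \<longlonglongrightarrow> H p i j"
      using cont[OF ij] p x unfolding continuous_on_sequentially comp_def by blast
    show "((\<lambda>p. W p i j) \<circ> x) \<longlonglongrightarrow> W p i j"
    proof (cases "p \<in> cube_boundary N")
      case True
      have "(\<lambda>m. 2 * (\<eta> * boundary_weight N (x m))) \<longlonglongrightarrow> 2 * (\<eta> * boundary_weight N p)" by (intro tendsto_mult tendsto_const bw)
      then have "(\<lambda>m. 2 * (\<eta> * boundary_weight N (x m))) \<longlonglongrightarrow> 0" using boundary_weight_bounds(3)[OF p] True by simp
      then have "(\<lambda>m. W (x m) i j - H (x m) i j) \<longlonglongrightarrow> 0"
        by (rule Lim_null_comparison[rotated]) (use WH ij x in auto)
      from tendsto_add[OF this Hc] have "(\<lambda>m. W (x m) i j) \<longlonglongrightarrow> H p i j" by simp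
      then show ?thesis using True by (simp add: W_def[of ] comp_def)
    next
      case False
      have bp: "boundary_weight N p > 0" by (rule int(1)[OF p False])
      define L where "L = nat \<lceil>\<tau> p + 2\<rceil>"
      have L: "\<tau> p + 2 \<le> real L" using int(2)[OF p False] unfolding L_def by linarith
      have tc: "(\<lambda>m. \<tau> (x m)) \<longlonglongrightarrow> \<tau> p" unfolding \<tau>_def using bp by (intro tendsto_divide tendsto_const bw) simp
      have "\<forall>\<^sub>F m in sequentially. \<tau> (x m) < \<tau> p + 1" using order_tendstoD(2)[OF tc] by simp
      moreover have "\<forall>\<^sub>F m in sequentially. boundary_weight N (x m) > 0" using order_tendstoD(1)[OF bw bp] .
      ultimately have ev: "\<forall>\<^sub>F m in sequentially. (\<Sum>l\<le>L. tent (\<tau> (x m)) l *\<^sub>R G l (x m) i j) = W (x m) i j"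
      proof eventually_elim
        case (elim m)
        have xm: "x m \<in> cubeset N" using x by blast
        then have "x m \<notin> cube_boundary N" using boundary_weight_bounds(3)[OF xm] elim(2) by simp
        then show ?case using WL[OF xm, of L i j] elim(1) L by simp
      qed
      have Gx: "(\<lambda>m. G l (x m) i j) \<longlonglongrightarrow> G l p i j" for l
        using Gc[of l i j] p x unfolding continuous_on_sequentially comp_def by blast
      have "(\<lambda>m. \<Sum>l\<le>L. tent (\<tau> (x m)) l *\<^sub>R G l (x m) i j) \<longlonglongrightarrow> (\<Sum>l\<le>L. tent (\<tau> p) l *\<^sub>R G l p i j)"
        unfolding tent_def by (intro tendsto_sum tendsto_scaleR tendsto_max tendsto_const tendsto_diff tendsto_rabs tc Gx)
      then have "(\<lambda>m. W (x m) i j) \<longlonglongrightarrow> (\<Sum>l\<le>L. tent (\<tau> p) l *\<^sub>R G l p i j)"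
        by (rule Lim_transform_eventually[OF _ ev])
      then show ?thesis using WL[OF p False, of L i j] L by (simp add: comp_def)
    qed
  qed
  have Wst: "stable d n (W p)" if p: "p \<in> cubeset N" "p \<notin> cube_boundary N" for p
  proof -
    define L where "L = nat \<lceil>\<tau> p + 1\<rceil>"
    have t0: "\<tau> p \<ge> 1" by (rule int(2)[OF p])
    have L: "\<tau> p + 1 \<le> real L" using t0 unfolding L_def by linarith
    define lm where "lm = (\<lambda>(l, k). tent (\<tau> p) l * lam l k p)"
    define S where "S = Sigma {..L} T"
    have finS: "finite S" unfolding S_def using P(1) by (intro finite_SigmaI) auto
    define A where "A = {k \<in> S. lm k \<noteq> 0}"
    have finA: "finite A" using finS by (simp add: A_def)
    have Ws: "W p i j = (\<Sum>k\<in>A. lm k *\<^sub>R w k i j)" for i j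
    proof -
      have "W p i j = (\<Sum>l\<le>L. \<Sum>k\<in>T l. lm (l, k) *\<^sub>R w (l, k) i j)"
        unfolding WL[OF p L] G_def by (simp add: scaleR_sum_right lm_def)
      also have "\<dots> = (\<Sum>k\<in>S. lm k *\<^sub>R w k i j)"
        unfolding S_def using P(1) by (subst sum.Sigma) (auto simp: case_prod_beta)
      also have "\<dots> = (\<Sum>k\<in>A. lm k *\<^sub>R w k i j)" using finS by (intro sum.mono_neutral_right) (auto simp: A_def)
      finally show ?thesis .
    qed
    have "A \<noteq> {}"
    proof
      assume "A = {}"
      then have z: "lm k = 0" if "k \<in> S" for k using that \<open>A = {}\<close> unfolding A_def by blast
      have "(\<Sum>l\<le>L. tent (\<tau> p) l * (\<Sum>k\<in>T l. lam l k p)) = 0"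
      proof (rule sum.neutral, rule ballI)
        fix l assume l: "l \<in> {..L}"
        have "tent (\<tau> p) l * (\<Sum>k\<in>T l. lam l k p) = (\<Sum>k\<in>T l. lm (l, k))" by (simp add: sum_distrib_left lm_def)
        also have "\<dots> = 0" using l by (intro sum.neutral ballI z) (simp add: S_def)
        finally show "tent (\<tau> p) l * (\<Sum>k\<in>T l. lam l k p) = 0" .
      qed
      then have "(\<Sum>l\<le>L. tent (\<tau> p) l) = 0" using P(4)[OF p(1)] by simp
      moreover have "(\<Sum>l\<le>L. tent (\<tau> p) l) = 1" using t0 L by (intro sum_tent) auto
      ultimately show False by simp
    qed
    moreover have "card A \<le> 2 * (N + 1)"
    proof -
      define m where "m = nat \<lfloor>\<tau> p\<rfloor>"
      define B where "B = (\<lambda>l. Pair l ` {k \<in> T l. lam l k p \<noteq> 0})"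
      have "A \<subseteq> B m \<union> B (Suc m)"
      proof
        fix a assume a: "a \<in> A"
        obtain l k where lk: "a = (l, k)" by fastforce
        have "tent (\<tau> p) l \<noteq> 0" "lam l k p \<noteq> 0" "k \<in> T l" using a by (auto simp: A_def S_def lm_def lk)
        moreover from this have "l = m \<or> l = Suc m" using tent_support[of "\<tau> p" l] t0 unfolding m_def by simp
        ultimately show "a \<in> B m \<union> B (Suc m)" by (auto simp: B_def lk)
      qed
      moreover have finB: "finite (B l)" for l using P(1) by (simp add: B_def)
      ultimately have "card A \<le> card (B m \<union> B (Suc m))" by (intro card_mono) auto
      also have "\<dots> \<le> card (B m) + card (B (Suc m))" by (rule card_Un_le)
      also have "\<dots> \<le> (N + 1) + (N + 1)"
      proof (rule add_mono)
        have cB: "card (B l) \<le> N + 1" for l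
        proof -
          have "card (B l) \<le> card {k \<in> T l. lam l k p \<noteq> 0}" unfolding B_def using P(1) by (intro card_image_le) simp
          then show ?thesis using P(5)[OF p(1), of l] by linarith
        qed
        show "card (B m) \<le> N + 1" "card (B (Suc m)) \<le> N + 1" by (rule cB)+
      qed
      finally show ?thesis by simp
    qed
    then have "d * (d * card A) \<le> n" using n by (meson mult_le_mono2 order_trans)
    moreover have "A \<subseteq> K" by (auto simp: A_def S_def K_def)
    moreover have "\<forall>k\<in>A. lm k \<noteq> 0" by (simp add: A_def)
    ultimately have "stable d n (\<lambda>i j. \<Sum>k\<in>A. lm k *\<^sub>R w k i j)" using w(2)[OF finA, of lm] d by blast
    then show ?thesis unfolding Ws[abs_def] .
  qed
  show ?thesis
  proof (rule that[of "\<lambda>p i. normalised d (W p i)"])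
    show "continuous_on (cubeset N) (\<lambda>p. normalised d (W p i) j)" if "i < n" "j < d" for i j
      using Wc[OF that(1)] Wne that(1) that(2) by (intro continuous_normalised) auto
    show "unit_tuple d n (\<lambda>i. normalised d (W p i))" if "p \<in> cubeset N" for p
      unfolding unit_tuple_def using nsq_normalised[OF Wne[OF that]] by blast
    show "normalised d (W p i) j = H p i j" if p: "p \<in> cube_boundary N" and ij: "i < n" "j < d" for p i j
    proof -
      have pc: "p \<in> cubeset N" using p by (simp add: cube_boundary_def topspace_cube)
      have "W p i = H p i" using p by (simp add: W_def fun_eq_iff)
      moreover have "nsq d (H p i) = 1" using unit[OF pc] ij unfolding unit_tuple_def by blast
      ultimately show ?thesis by (simp add: normalised_unit)
    qed
    show "stable d n (\<lambda>i. normalised d (W p i))" if p: "p \<in> cubeset N" "p \<notin> cube_boundary N" for p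
    proof (rule stable_scaled[OF _ _ Wst[OF p]])
      show "1 / sqrt (nsq d (W p i)) \<noteq> 0" if "i < n" for i using Wne[OF p(1) that] by simp
    qed (simp add: normalised_def)
  qed
qed

section \<open>Equal norm Parseval frames as tight tuples\<close>

lemma continuous_into_mat_topology:
  fixes f :: "'b \<Rightarrow> 'a::topological_space mat"
  assumes "\<And>x. x \<in> topspace X \<Longrightarrow> f x \<in> carrier_mat m n"
    and "\<And>i j. i < m \<Longrightarrow> j < n \<Longrightarrow> continuous_map X euclidean (\<lambda>x. f x $$ (i, j))"
  shows "continuous_map X (mat_topology m n) f"
  unfolding mat_topology_def
proof (rule continuous_map_pullback')
  show "continuous_map X (product_topology (\<lambda>_. euclidean) ({..<m} \<times> {..<n})) ((\<lambda>A. restrict (\<lambda>p. A $$ p) ({..<m} \<times> {..<n})) \<circ> f)"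
    unfolding continuous_map_componentwise
  proof (intro conjI ballI)
    fix k assume k: "k \<in> {..<m} \<times> {..<n}"
    then show "continuous_map X euclidean (\<lambda>x. ((\<lambda>A. restrict (\<lambda>p. A $$ p) ({..<m} \<times> {..<n})) \<circ> f) x k)"
      using assms(2) by auto
  qed auto
  show "topspace X \<subseteq> f -` carrier_mat m n" using assms(1) by auto
qed

lemma continuous_mat_entry:
  assumes "i < m" "j < n"
  shows "continuous_map (mat_topology m n) euclidean (\<lambda>A. A $$ (i, j))"
proof -
  have "continuous_map (product_topology (\<lambda>_. euclidean) ({..<m} \<times> {..<n})) euclidean (\<lambda>g. g (i, j) :: 'a)"
    using continuous_map_product_projection[of "(i, j)" "{..<m} \<times> {..<n}" "\<lambda>_. euclidean :: 'a topology"] assms by simp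
  from continuous_map_pullback[OF this, of "carrier_mat m n" "\<lambda>A. restrict (\<lambda>p. A $$ p) ({..<m} \<times> {..<n})"]
  have "continuous_map (mat_topology m n) euclidean ((\<lambda>g. g (i, j) :: 'a) \<circ> (\<lambda>A. restrict (\<lambda>p. A $$ p) ({..<m} \<times> {..<n})))"
    unfolding mat_topology_def .
  moreover have "(\<lambda>g. g (i, j) :: 'a) \<circ> (\<lambda>A. restrict (\<lambda>p. A $$ p) ({..<m} \<times> {..<n})) = (\<lambda>A. A $$ (i, j))"
    using assms by (simp add: fun_eq_iff)
  ultimately show ?thesis by simp
qed

lemma topspace_mat_topology: "topspace (mat_topology m n) = carrier_mat m n"
  by (auto simp: mat_topology_def topspace_pullback_topology)

lemma topspace_frames: "topspace (enp_frame_space d n) = enp_frames d n"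
  unfolding enp_frame_space_def topspace_subtopology topspace_mat_topology enp_frames_def by blast

text \<open>The columns of an equal norm Parseval frame have norm \<open>sqrt (d / n)\<close>; this factor is removed here
  and put back in \<open>frame_of\<close>.\<close>
definition frame_vectors :: "nat \<Rightarrow> nat \<Rightarrow> 'a mat \<Rightarrow> nat \<Rightarrow> nat \<Rightarrow> 'a::rc_scalar" where
  "frame_vectors d n F = (\<lambda>i j. sqrt (real n / real d) *\<^sub>R F $$ (j, i))"

definition frame_of :: "nat \<Rightarrow> nat \<Rightarrow> (nat \<Rightarrow> nat \<Rightarrow> 'a::rc_scalar) \<Rightarrow> 'a mat" where
  "frame_of d n v = mat d n (\<lambda>(j, i). sqrt (real d / real n) *\<^sub>R v i j)"

lemma mult_adjoint_entry:
  assumes "F \<in> carrier_mat d n" "a < d" "b < d"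
  shows "(F * mat_adjoint F) $$ (a, b) = (\<Sum>i<n. F $$ (a, i) * conjugate (F $$ (b, i) :: 'a::rc_scalar))"
proof -
  have r: "dim_row F = d" and c: "dim_col F = n" using assms(1) by auto
  have m: "mat_adjoint F \<in> carrier_mat n d" using assms(1) unfolding mat_adjoint_def carrier_mat_def by simp
  have e: "mat_adjoint F $$ (i, b) = conjugate (F $$ (b, i))" if "i < n" for i
    using that assms(3) r c by (simp add: mat_adjoint_def mat_of_rows_def conjugate_vec_def)
  show ?thesis
    using m assms(2,3) r c e by (simp add: scalar_prod_def lessThan_atLeast0)
qed

text \<open>The trace of \<open>F F\<^sup>* = I\<close> is the sum of the squared column norms, so equal norms are determined by
  \<open>d\<close> and \<open>n\<close>.\<close>
lemma frame_vectors_tight: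
  fixes F :: "'a::rc_scalar mat"
  assumes d: "d > 0" and n: "n > 0" and F: "F \<in> enp_frames d n"
  shows "tight d n (frame_vectors d n F)" "unit_tuple d n (frame_vectors d n F)"
proof -
  have C: "F \<in> carrier_mat d n" and P: "F * mat_adjoint F = 1\<^sub>m d" and E: "\<And>j k. j < n \<Longrightarrow> k < n \<Longrightarrow> col_norm F j = col_norm F k"
    using F unfolding enp_frames_def by blast+
  have s: "(sqrt (real n / real d))\<^sup>2 = real n / real d" by simp
  have g: "gram n (frame_vectors d n F) a b = (real n / real d) *\<^sub>R (F * mat_adjoint F) $$ (a, b)" if "a < d" "b < d" for a b
  proof -
    have "gram n (frame_vectors d n F) a b = (\<Sum>i<n. (sqrt (real n / real d))\<^sup>2 *\<^sub>R (F $$ (a, i) * conjugate (F $$ (b, i))))"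
      by (simp add: gram_def frame_vectors_def conj_scaleR power2_eq_square)
    then show ?thesis unfolding mult_adjoint_entry[OF C that] scaleR_sum_right s .
  qed
  show t: "tight d n (frame_vectors d n F)"
    unfolding tight_def
  proof (intro allI impI)
    fix a b assume "a < d" "b < d"
    then show "gram n (frame_vectors d n F) a b = (if a = b then of_real (real n / real d) else 0)"
      unfolding g[OF \<open>a < d\<close> \<open>b < d\<close>] P by (simp add: of_real_def)
  qed
  have cn: "nsq d (frame_vectors d n F i) = real n / real d * (col_norm F i)\<^sup>2" for i
  proof -
    have "dim_row F = d" using C by auto
    then have "(col_norm F i)\<^sup>2 = (\<Sum>j<d. (norm (F $$ (j, i)))\<^sup>2)"
      unfolding col_norm_def L2_set_def by (simp add: sum_nonneg)
    then show ?thesis by (simp add: nsq_def frame_vectors_def power_mult_distrib sum_distrib_left)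
  qed
  have sumn: "(\<Sum>i<n. nsq d (frame_vectors d n F i)) = real n"
  proof -
    have "of_real (\<Sum>i<n. nsq d (frame_vectors d n F i)) = (\<Sum>a<d. gram n (frame_vectors d n F) a a)"
      unfolding gram_def nsq_def mult_conj_self of_real_sum by (rule sum.swap)
    also have "\<dots> = (\<Sum>a<d. of_real (real n / real d))" by (rule sum.cong[OF refl]) (use tightD[OF t] in simp)
    also have "\<dots> = of_real (real n)" using d by simp
    finally show ?thesis unfolding of_real_eq_iff .
  qed
  show "unit_tuple d n (frame_vectors d n F)"
    unfolding unit_tuple_def
  proof (intro allI impI)
    fix i assume i: "i < n"
    have "nsq d (frame_vectors d n F k) = nsq d (frame_vectors d n F i)" if "k < n" for k
      unfolding cn using E[OF that i] by (rule arg_cong[where f = "\<lambda>z. real n / real d * z\<^sup>2"])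
    then have "(\<Sum>k<n. nsq d (frame_vectors d n F k)) = (\<Sum>k<n. nsq d (frame_vectors d n F i))"
      by (intro sum.cong[OF refl]) (simp only: lessThan_iff)
    then have "(\<Sum>k<n. nsq d (frame_vectors d n F k)) = real n * nsq d (frame_vectors d n F i)" by simp
    then show "nsq d (frame_vectors d n F i) = 1" using sumn n by simp
  qed
qed

lemma frame_of_enp:
  fixes v :: "nat \<Rightarrow> nat \<Rightarrow> 'a::rc_scalar"
  assumes d: "d > 0" and n: "n > 0" and t: "tight d n v" and u: "unit_tuple d n v"
  shows "frame_of d n v \<in> enp_frames d n"
proof -
  let ?F = "frame_of d n v"
  have C: "?F \<in> carrier_mat d n" by (simp add: frame_of_def)
  have e: "?F $$ (j, i) = sqrt (real d / real n) *\<^sub>R v i j" if "j < d" "i < n" for i j using that by (simp add: frame_of_def)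
  have s: "(sqrt (real d / real n))\<^sup>2 = real d / real n" by simp
  have "?F * mat_adjoint ?F = 1\<^sub>m d"
  proof (rule eq_matI)
    fix a b assume "a < dim_row (1\<^sub>m d :: 'a mat)" "b < dim_col (1\<^sub>m d :: 'a mat)"
    then have ab: "a < d" "b < d" by auto
    have "(?F * mat_adjoint ?F) $$ (a, b) = (\<Sum>i<n. (sqrt (real d / real n))\<^sup>2 *\<^sub>R (v i a * conjugate (v i b)))"
      unfolding mult_adjoint_entry[OF C ab] using ab by (intro sum.cong refl) (simp add: e conj_scaleR power2_eq_square)
    also have "\<dots> = (real d / real n) *\<^sub>R gram n v a b" unfolding gram_def scaleR_sum_right s ..
    also have "\<dots> = 1\<^sub>m d $$ (a, b)" unfolding tightD[OF t ab] using ab d n by (simp add: scaleR_conv_of_real)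
    finally show "(?F * mat_adjoint ?F) $$ (a, b) = 1\<^sub>m d $$ (a, b)" .
  qed (use C in \<open>auto simp: mat_adjoint_def\<close>)
  moreover have "col_norm ?F i = sqrt (real d / real n)" if i: "i < n" for i
  proof -
    have "(\<Sum>j<d. (norm (?F $$ (j, i)))\<^sup>2) = (\<Sum>j<d. real d / real n * (norm (v i j))\<^sup>2)"
      using i by (intro sum.cong refl) (simp add: e power_mult_distrib)
    also have "\<dots> = real d / real n * nsq d (v i)" by (simp add: nsq_def sum_distrib_left)
    also have "\<dots> = real d / real n" using u i unfolding unit_tuple_def by simp
    finally show ?thesis using C by (simp add: col_norm_def L2_set_def)
  qed
  ultimately show ?thesis unfolding enp_frames_def using C by simp
qed

lemma frame_of_frame_vectors:
  assumes "F \<in> carrier_mat d n" "d > 0" "n > 0" and "\<And>i j. i < n \<Longrightarrow> j < d \<Longrightarrow> v i j = frame_vectors d n F i j"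
  shows "frame_of d n v = F"
proof (rule eq_matI)
  fix j i assume "j < dim_row F" "i < dim_col F"
  then have ij: "j < d" "i < n" using assms(1) by auto
  have "sqrt (real d / real n) * sqrt (real n / real d) = 1"
    using assms(2,3) by (simp add: real_sqrt_mult[symmetric])
  then show "frame_of d n v $$ (j, i) = F $$ (j, i)"
    using ij by (simp add: frame_of_def assms(4) frame_vectors_def)
qed (use assms(1) in \<open>auto simp: frame_of_def\<close>)

section \<open>Homotopy groups of the frame space\<close>

lemma cylinder_eq_top_of_set: "prod_topology (top_of_set {0..1::real}) (cube q) = top_of_set ({0..1} \<times> cubeset q)"
  unfolding cube_eq_top_of_set subtopology_Times[symmetric] prod_topology_euclidean ..

text \<open>The null homotopies of the single vectors in the sphere combine to a family \<open>HH\<close> of unit tuples on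
  the \<open>(q + 1)\<close>-cube, whose last coordinate is the homotopy parameter.  On the boundary it is tight.
  Making it stable inside and applying \<open>tighten\<close> does not change it there and yields frames.\<close>
lemma frame_null_homotopy:
  fixes f :: "(nat \<Rightarrow> real) \<Rightarrow> 'a::rc_scalar mat"
  assumes q: "q + 2 \<le> DIM('a) * d" and d: "d \<ge> 2" and n: "d * (d * (2 * (q + 2))) \<le> n"
    and f: "f \<in> cube_maps q (enp_frame_space d n) x" and x: "x \<in> enp_frames d n"
  shows "homotopic_with (\<lambda>h. \<forall>t\<in>cube_boundary q. h t = x) (cube q) (enp_frame_space d n) f (\<lambda>_. x)"
proof -
  have d0: "d > 0" using d by simp
  have n0: "n > 0" using n d by (cases n) auto
  have fc: "continuous_map (cube q) (enp_frame_space d n) f" and fb: "\<And>t. t \<in> cube_boundary q \<Longrightarrow> f t = x"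
    using f unfolding cube_maps_def by auto
  have fE: "f t \<in> enp_frames d n" if "t \<in> cubeset q" for t
    using continuous_map_funspace[OF fc] that unfolding topspace_cube topspace_frames by auto
  have EC: "F \<in> carrier_mat d n" if "F \<in> enp_frames d n" for F :: "'a mat" using that unfolding enp_frames_def by blast
  have fcont: "continuous_on (cubeset q) (\<lambda>t. frame_vectors d n (f t) i j)" if "i < n" "j < d" for i j
  proof -
    have "continuous_map (cube q) (mat_topology d n) f"
      using fc unfolding enp_frame_space_def by (rule continuous_map_into_fulltopology)
    from continuous_map_compose[OF this continuous_mat_entry[OF that(2,1)]]
    have "continuous_on (cubeset q) (\<lambda>t. f t $$ (j, i))" unfolding cube_eq_top_of_set by (simp add: comp_def)
    then show ?thesis unfolding frame_vectors_def by (intro continuous_on_scaleR continuous_on_const)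
  qed
  have unit: "nsq d (frame_vectors d n F i) = 1" if "F \<in> enp_frames d n" "i < n" for F :: "'a mat" and i
    using frame_vectors_tight(2)[OF d0 n0 that(1)] that(2) unfolding unit_tuple_def by blast
  have exH: "\<exists>H :: real \<Rightarrow> (nat \<Rightarrow> real) \<Rightarrow> nat \<Rightarrow> 'a. (\<forall>j<d. continuous_on ({0..1} \<times> cubeset q) (\<lambda>p. H (fst p) (snd p) j)) \<and>
     (\<forall>t\<in>cubeset q. \<forall>j<d. H 0 t j = frame_vectors d n (f t) i j) \<and> (\<forall>t\<in>cubeset q. \<forall>j<d. H 1 t j = frame_vectors d n x i j) \<and>
     (\<forall>s\<in>{0..1}. \<forall>t\<in>cube_boundary q. \<forall>j<d. H s t j = frame_vectors d n x i j) \<and>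
     (\<forall>s\<in>{0..1}. \<forall>t\<in>cubeset q. nsq d (H s t) = 1)" (is "\<exists>H. ?H i H") if i: "i < n" for i
  proof -
    obtain H :: "real \<Rightarrow> (nat \<Rightarrow> real) \<Rightarrow> nat \<Rightarrow> 'a" where H:
      "\<And>a. a < d \<Longrightarrow> continuous_on ({0..1} \<times> cubeset q) (\<lambda>p. H (fst p) (snd p) a)"
      "\<And>t a. t \<in> cubeset q \<Longrightarrow> a < d \<Longrightarrow> H 0 t a = frame_vectors d n (f t) i a"
      "\<And>t a. t \<in> cubeset q \<Longrightarrow> a < d \<Longrightarrow> H 1 t a = frame_vectors d n x i a"
      "\<And>s t a. s \<in> {0..1} \<Longrightarrow> t \<in> cube_boundary q \<Longrightarrow> a < d \<Longrightarrow> H s t a = frame_vectors d n x i a"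
      "\<And>s t. s \<in> {0..1} \<Longrightarrow> t \<in> cubeset q \<Longrightarrow> nsq d (H s t) = 1"
    proof (rule sphere_null_homotopy[OF q, of "\<lambda>t. frame_vectors d n (f t) i" "frame_vectors d n x i"])
      show "nsq d (frame_vectors d n (f t) i) = 1" if "t \<in> cubeset q" for t by (rule unit[OF fE[OF that] i])
      show "nsq d (frame_vectors d n x i) = 1" by (rule unit[OF x i])
      show "continuous_on (cubeset q) (\<lambda>t. frame_vectors d n (f t) i a)" if "a < d" for a by (rule fcont[OF i that])
      show "frame_vectors d n (f t) i a = frame_vectors d n x i a" if "t \<in> cube_boundary q" for t a unfolding fb[OF that] ..
    qed (rule that, assumption+)
    show ?thesis
    proof (intro exI[of _ H] conjI allI ballI impI)
    qed (use H in simp_all)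
  qed
  define H where "H = (\<lambda>i. SOME H. ?H i H)"
  have Hall: "?H i (H i)" if "i < n" for i
    unfolding H_def by (rule someI_ex[OF exH[OF that]])
  have H: "\<forall>j<d. continuous_on ({0..1} \<times> cubeset q) (\<lambda>p. H i (fst p) (snd p) j)"
    "\<forall>t\<in>cubeset q. \<forall>j<d. H i 0 t j = frame_vectors d n (f t) i j"
    "\<forall>t\<in>cubeset q. \<forall>j<d. H i 1 t j = frame_vectors d n x i j"
    "\<forall>s\<in>{0..1}. \<forall>t\<in>cube_boundary q. \<forall>j<d. H i s t j = frame_vectors d n x i j"
    "\<forall>s\<in>{0..1}. \<forall>t\<in>cubeset q. nsq d (H i s t) = 1" if "i < n" for i
  proof -
    have h: "?H i (H i)" by (rule Hall[OF that])
    show "\<forall>j<d. continuous_on ({0..1} \<times> cubeset q) (\<lambda>p. H i (fst p) (snd p) j)" by (rule h[THEN conjunct1])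
    show "\<forall>t\<in>cubeset q. \<forall>j<d. H i 0 t j = frame_vectors d n (f t) i j" by (rule h[THEN conjunct2, THEN conjunct1])
    show "\<forall>t\<in>cubeset q. \<forall>j<d. H i 1 t j = frame_vectors d n x i j" by (rule h[THEN conjunct2, THEN conjunct2, THEN conjunct1])
    show "\<forall>s\<in>{0..1}. \<forall>t\<in>cube_boundary q. \<forall>j<d. H i s t j = frame_vectors d n x i j"
      by (rule h[THEN conjunct2, THEN conjunct2, THEN conjunct2, THEN conjunct1])
    show "\<forall>s\<in>{0..1}. \<forall>t\<in>cubeset q. nsq d (H i s t) = 1"
      by (rule h[THEN conjunct2, THEN conjunct2, THEN conjunct2, THEN conjunct2])
  qed
  let ?N = "q + 1"
  define base where "base = (\<lambda>p :: nat \<Rightarrow> real. restrict p {..<q})"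
  have base: "p q \<in> {0..1}" "base p \<in> cubeset q" if "p \<in> cubeset ?N" for p
  proof -
    have c: "p i \<in> {0..1}" if "i < q + 1" for i using PiE_mem[OF \<open>p \<in> cubeset ?N\<close>, of i] that by simp
    then show "p q \<in> {0..1}" by simp
    show "base p \<in> cubeset q" unfolding base_def restrict_PiE_iff using c by simp
  qed
  define HH where "HH = (\<lambda>p i. H i (p q) (base p))"
  have base_cont: "continuous_on (cubeset ?N) (\<lambda>p. (p q, base p))"
  proof (intro continuous_on_Pair continuous_on_coordinate)
    have "continuous_map (top_of_set (cubeset ?N)) (top_of_set (cubeset q)) base"
      unfolding cube_eq_top_of_set[symmetric, of q] cube_def continuous_map_componentwise
    proof (intro conjI ballI)
      fix k assume k: "k \<in> {..<q}"
      have "continuous_on (cubeset ?N) (\<lambda>p. p k)" by (rule continuous_on_coordinate)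
      then have "continuous_on (cubeset ?N) (\<lambda>p. base p k)" using k by (simp add: base_def)
      moreover have "(\<lambda>p. base p k) \<in> cubeset ?N \<rightarrow> {0..1}"
        using PiE_mem[OF base(2)] k by (intro Pi_I) blast
      ultimately show "continuous_map (top_of_set (cubeset ?N)) (top_of_set {0..1}) (\<lambda>p. base p k)"
        unfolding continuous_map_in_subtopology continuous_map_iff_continuous topspace_euclidean_subtopology by blast
    next
      show "base ` topspace (top_of_set (cubeset ?N)) \<subseteq> extensional {..<q}" unfolding base_def by blast
    qed
    then show "continuous_on (cubeset ?N) base"
      unfolding continuous_map_in_subtopology continuous_map_iff_continuous by blast
  qed
  have HHc: "continuous_on (cubeset ?N) (\<lambda>p. HH p i j)" if ij: "i < n" "j < d" for i j
  proof -
    have "continuous_on ({0..1} \<times> cubeset q) (\<lambda>p. H i (fst p) (snd p) j)" using H(1)[OF ij(1)] ij(2) by blast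
    then have "continuous_on (cubeset ?N) (\<lambda>p. H i (fst (p q, base p)) (snd (p q, base p)) j)"
      by (rule continuous_on_compose2[OF _ base_cont]) (use base in auto)
    then show ?thesis by (simp add: HH_def)
  qed
  have HHu: "unit_tuple d n (HH p)" if p: "p \<in> cubeset ?N" for p
    unfolding unit_tuple_def HH_def using H(5) base[OF p] by blast
  have n': "d * (d * (2 * (?N + 1))) \<le> n" using n by simp
  obtain V where V: "\<And>i j. i < n \<Longrightarrow> j < d \<Longrightarrow> continuous_on (cubeset ?N) (\<lambda>p. V p i j)"
    "\<And>p. p \<in> cubeset ?N \<Longrightarrow> unit_tuple d n (V p)"
    "\<And>p i j. p \<in> cube_boundary ?N \<Longrightarrow> i < n \<Longrightarrow> j < d \<Longrightarrow> V p i j = HH p i j"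
    "\<And>p. p \<in> cubeset ?N \<Longrightarrow> p \<notin> cube_boundary ?N \<Longrightarrow> stable d n (V p)"
    by (rule stable_extension[OF d0 n' HHc HHu], assumption, assumption, assumption, rule that, assumption+)
  have bdry: "\<exists>F\<in>enp_frames d n. \<forall>i<n. \<forall>j<d. HH p i j = frame_vectors d n F i j" if p: "p \<in> cube_boundary ?N" for p
  proof -
    have pc: "p \<in> cubeset ?N" using p by (simp add: cube_boundary_def topspace_cube)
    obtain k where k: "k < q + 1" "p k = 0 \<or> p k = 1" using p by (auto simp: cube_boundary_def)
    show ?thesis
    proof (cases "k = q")
      case True
      from k(2) show ?thesis
      proof
        assume "p k = 0"
        then show ?thesis using H(2) base(2)[OF pc] True by (intro bexI[OF _ fE[OF base(2)[OF pc]]]) (simp add: HH_def)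
      next
        assume "p k = 1"
        then show ?thesis using H(3) base(2)[OF pc] True by (intro bexI[OF _ x]) (simp add: HH_def)
      qed
    next
      case False
      then have "k < q" using k(1) by simp
      then have "base p \<in> cube_boundary q" using k(2) base(2)[OF pc] by (auto simp: cube_boundary_def topspace_cube base_def)
      then show ?thesis using H(4) base(1)[OF pc] by (intro bexI[OF _ x]) (simp add: HH_def)
    qed
  qed
  have Vt: "stable d n (V p) \<or> tight d n (V p)" if p: "p \<in> cubeset ?N" for p
  proof (cases "p \<in> cube_boundary ?N")
    case True
    from bdry[OF True] obtain F where F: "F \<in> enp_frames d n" "\<forall>i<n. \<forall>j<d. HH p i j = frame_vectors d n F i j" by blast
    have "tight d n (V p) = tight d n (frame_vectors d n F)"
      by (rule tight_cong) (simp add: V(3)[OF True] F(2))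
    then show ?thesis using frame_vectors_tight(1)[OF d0 n0 F(1)] by blast
  qed (use V(4)[OF p] in blast)
  define U where "U = (\<lambda>p. tighten d n (V p))"
  have Uc: "continuous_on (cubeset ?N) (\<lambda>p. U p i j)" if ij: "i < n" "j < d" for i j
    unfolding continuous_on_sequentially
  proof (intro allI ballI impI)
    fix y p assume p: "p \<in> cubeset ?N" and y: "(\<forall>m. y m \<in> cubeset ?N) \<and> y \<longlonglongrightarrow> p"
    have "(\<lambda>m. tighten d n (V (y m)) i j) \<longlonglongrightarrow> tighten d n (V p) i j"
    proof (rule tighten_continuous[OF d V(2)[OF p] Vt[OF p] _ _ _ ij])
      show "unit_tuple d n (V (y m))" "stable d n (V (y m)) \<or> tight d n (V (y m))" for m using V(2) Vt y by blast+
      show "(\<lambda>m. V (y m) i j) \<longlonglongrightarrow> V p i j" if "i < n" "j < d" for i j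
        using V(1)[OF that] p y unfolding continuous_on_sequentially comp_def by blast
    qed
    then show "((\<lambda>p. U p i j) \<circ> y) \<longlonglongrightarrow> U p i j" by (simp add: U_def comp_def)
  qed
  have UE: "frame_of d n (U p) \<in> enp_frames d n" if p: "p \<in> cubeset ?N" for p
    unfolding U_def by (rule frame_of_enp[OF d0 n0 tighten_tight[OF d0 V(2)[OF p] Vt[OF p]] tighten_unit[OF d0 V(2)[OF p] Vt[OF p]]])
  have Ub: "frame_of d n (U p) = F" if p: "p \<in> cube_boundary ?N" and F: "F \<in> enp_frames d n" "\<And>i j. i < n \<Longrightarrow> j < d \<Longrightarrow> HH p i j = frame_vectors d n F i j" for p F
  proof -
    have "tight d n (V p) = tight d n (frame_vectors d n F)" by (rule tight_cong) (simp add: V(3)[OF p] F(2))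
    then have "U p = V p" unfolding U_def using frame_vectors_tight(1)[OF d0 n0 F(1)] by (intro tighten_id) simp
    then show ?thesis by (intro frame_of_frame_vectors[OF EC[OF F(1)] d0 n0]) (simp add: V(3)[OF p] F(2))
  qed
  \<comment> \<open>The inverse of \<open>p \<mapsto> (p q, base p)\<close>.\<close>
  define glue where "glue = (\<lambda>(s :: real, t :: nat \<Rightarrow> real). \<lambda>i\<in>{..<q + 1}. if i < q then t i else s)"
  have glue: "glue (s, t) \<in> cubeset ?N" "glue (s, t) q = s" "base (glue (s, t)) = t" if "s \<in> {0..1}" "t \<in> cubeset q" for s t
  proof -
    have "t i \<in> {0..1}" if "i < q" for i using PiE_mem[OF \<open>t \<in> cubeset q\<close>, of i] that by simp
    then show "glue (s, t) \<in> cubeset ?N" using \<open>s \<in> {0..1}\<close> unfolding glue_def prod.case restrict_PiE_iff by simp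
    show "glue (s, t) q = s" by (simp add: glue_def)
    show "base (glue (s, t)) = t"
    proof (rule extensionalityI[of _ "{..<q}"])
      show "t \<in> extensional {..<q}" using that(2) unfolding PiE_iff by blast
      show "base (glue (s, t)) \<in> extensional {..<q}" unfolding base_def by (rule restrict_extensional)
      show "base (glue (s, t)) i = t i" if "i \<in> {..<q}" for i using that by (simp add: base_def glue_def)
    qed
  qed
  have gi: "glue p \<in> cubeset ?N" if "p \<in> {0..1} \<times> cubeset q" for p
    using glue(1)[of "fst p" "snd p"] that unfolding mem_Times_iff prod.collapse by blast
  have glue_cont: "continuous_on ({0..1} \<times> cubeset q) glue"
  proof -
    have "continuous_on ({0..1} \<times> cubeset q) (\<lambda>p. glue p i)" for i
    proof (cases "i < q")
      case True
      have "continuous_on ({0..1::real} \<times> cubeset q) (\<lambda>p. snd p i)"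
        by (rule continuous_on_compose2[OF continuous_on_coordinate[of UNIV i] continuous_on_snd[OF continuous_on_id]]) simp
      then show ?thesis using True by (simp add: glue_def case_prod_beta)
    next
      case False
      have "continuous_on ({0..1::real} \<times> cubeset q) (\<lambda>p. fst p)" by (rule continuous_on_fst[OF continuous_on_id])
      then show ?thesis using False by (cases "i = q") (simp_all add: glue_def case_prod_beta)
    qed
    then show ?thesis using continuous_map_to_fun[of "top_of_set ({0..1} \<times> cubeset q)" glue] by simp
  qed
  define h where "h = (\<lambda>p. frame_of d n (U (glue p)))"
  have hc: "continuous_map (prod_topology (top_of_set {0..1}) (cube q)) (enp_frame_space d n) h"
    unfolding enp_frame_space_def continuous_map_in_subtopology cylinder_eq_top_of_set
  proof (intro conjI continuous_into_mat_topology)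
    show "h p \<in> carrier_mat d n" for p by (simp add: h_def frame_of_def)
    fix j i assume ij: "j < d" "i < n"
    have "continuous_on ({0..1} \<times> cubeset q) (\<lambda>p. U (glue p) i j)"
      by (rule continuous_on_compose2[OF Uc[OF ij(2,1)] glue_cont image_subsetI[OF gi]])
    then have "continuous_on ({0..1} \<times> cubeset q) (\<lambda>p. sqrt (real d / real n) *\<^sub>R U (glue p) i j)"
      by (intro continuous_on_scaleR continuous_on_const)
    then show "continuous_map (top_of_set ({0..1} \<times> cubeset q)) euclidean (\<lambda>p. h p $$ (j, i))"
      using ij by (simp add: h_def frame_of_def)
  next
    show "h \<in> topspace (top_of_set ({0..1} \<times> cubeset q)) \<rightarrow> enp_frames d n"
      unfolding h_def topspace_euclidean_subtopology by (intro Pi_I UE gi)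
  qed
  have h0: "h (0, t) = f t" if t: "t \<in> cubeset q" for t
    unfolding h_def
  proof (rule Ub[OF _ fE[OF t]])
    have g: "glue (0, t) \<in> cubeset ?N" "glue (0, t) q = 0" "base (glue (0, t)) = t" by (rule glue[OF _ t], simp)+
    show "glue (0, t) \<in> cube_boundary ?N" unfolding cube_boundary_def topspace_cube using g(1,2) by (intro CollectI conjI exI[of _ q]) simp_all
    show "HH (glue (0, t)) i j = frame_vectors d n (f t) i j" if "i < n" "j < d" for i j
      unfolding HH_def g(2,3) using H(2)[OF that(1)] t that(2) by blast
  qed
  have h1: "h (1, t) = x" if t: "t \<in> cubeset q" for t
    unfolding h_def
  proof (rule Ub[OF _ x])
    have g: "glue (1, t) \<in> cubeset ?N" "glue (1, t) q = 1" "base (glue (1, t)) = t" by (rule glue[OF _ t], simp)+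
    show "glue (1, t) \<in> cube_boundary ?N" unfolding cube_boundary_def topspace_cube using g(1,2) by (intro CollectI conjI exI[of _ q]) simp_all
    show "HH (glue (1, t)) i j = frame_vectors d n x i j" if "i < n" "j < d" for i j
      unfolding HH_def g(2,3) using H(3)[OF that(1)] t that(2) by blast
  qed
  have hb: "h (s, t) = x" if s: "s \<in> {0..1}" and t: "t \<in> cube_boundary q" for s t
    unfolding h_def
  proof (rule Ub[OF _ x])
    have tc: "t \<in> cubeset q" using t by (simp add: cube_boundary_def topspace_cube)
    have g: "glue (s, t) \<in> cubeset ?N" "glue (s, t) q = s" "base (glue (s, t)) = t" by (rule glue[OF s tc])+
    obtain k where k: "k < q" "t k = 0 \<or> t k = 1" using t by (auto simp: cube_boundary_def)
    have "glue (s, t) k = t k" using k(1) by (simp add: glue_def)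
    then show "glue (s, t) \<in> cube_boundary ?N" unfolding cube_boundary_def topspace_cube using g(1) k by (intro CollectI conjI exI[of _ k]) simp_all
    show "HH (glue (s, t)) i j = frame_vectors d n x i j" if "i < n" "j < d" for i j
      unfolding HH_def g(2,3) using H(4)[OF that(1)] s t that(2) by blast
  qed
  show ?thesis
  proof (subst homotopic_with)
    show "(\<forall>t\<in>cube_boundary q. h t = x) = (\<forall>t\<in>cube_boundary q. k t = x)"
      if "\<And>t. t \<in> topspace (cube q) \<Longrightarrow> h t = k t" for h k :: "(nat \<Rightarrow> real) \<Rightarrow> 'a mat"
      unfolding cube_boundary_def using that by (intro ball_cong refl) simp
    show "\<exists>h. continuous_map (prod_topology (top_of_set {0..1::real}) (cube q)) (enp_frame_space d n) h \<and>
        (\<forall>t\<in>topspace (cube q). h (0, t) = f t) \<and> (\<forall>t\<in>topspace (cube q). h (1, t) = x) \<and>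
        (\<forall>s\<in>{0..1}. \<forall>t\<in>cube_boundary q. h (s, t) = x)"
      unfolding topspace_cube by (rule exI) (rule conjI[OF hc conjI[OF ballI[OF h0] conjI[OF ballI[OF h1] ballI[OF ballI[OF hb]]]]], assumption+)
  qed
qed

text \<open>All maps are homotopic to each other, so the carrier has a single class.  The product of this
  class with itself is again that class because concatenating two constant maps gives a constant map.\<close>
lemma q_connected_if_null_homotopic:
  assumes null: "\<And>x f. x \<in> topspace X \<Longrightarrow> f \<in> cube_maps q X x \<Longrightarrow>
     homotopic_with (\<lambda>h. \<forall>t\<in>cube_boundary q. h t = x) (cube q) X f (\<lambda>_. x)"
  shows "q_connected q X"
  unfolding q_connected_def
proof
  fix x assume x: "x \<in> topspace X"
  define C where "C = cube_maps q X x"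
  define R where "R = cube_homotopic q X x"
  have c: "(\<lambda>_. x) \<in> C" unfolding C_def cube_maps_def using x by simp
  have R: "(f, g) \<in> R \<longleftrightarrow> f \<in> C \<and> g \<in> C" for f g
  proof
    assume "(f, g) \<in> R" then show "f \<in> C \<and> g \<in> C" unfolding R_def C_def cube_homotopic_def by blast
  next
    assume fg: "f \<in> C \<and> g \<in> C"
    then have f: "f \<in> cube_maps q X x" and g: "g \<in> cube_maps q X x" unfolding C_def by simp_all
    have "homotopic_with (\<lambda>h. \<forall>t\<in>cube_boundary q. h t = x) (cube q) X f g"
      by (rule homotopic_with_trans[OF null[OF x f] homotopic_with_symD[OF null[OF x g]]])
    then show "(f, g) \<in> R" using f g unfolding R_def cube_homotopic_def by simp
  qed
  have img: "R `` S = C" if "f \<in> S" "f \<in> C" for S f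
  proof (intro equalityI subsetI)
    fix g assume "g \<in> R `` S" then show "g \<in> C" by (elim ImageE) (simp only: R)
  next
    fix g assume "g \<in> C" then show "g \<in> R `` S" using that by (intro ImageI[OF _ that(1)]) (simp only: R)
  qed
  have "C // R = (\<Union>g\<in>C. {C})"
    unfolding quotient_def using img[OF singletonI] by simp
  then have quot: "C // R = {C}" using c by blast
  have conc: "(\<lambda>_. x) \<in> {cube_concat f g | f g. f \<in> C \<and> g \<in> C}"
  proof -
    have "cube_concat (\<lambda>_. x) (\<lambda>_. x) = (\<lambda>_. x)" by (simp add: cube_concat_def fun_eq_iff)
    from this[symmetric] c show ?thesis by (intro CollectI exI conjI)
  qed
  have G: "homotopy_group q X x = \<lparr>carrier = {C}, monoid.mult = (\<lambda>A B. R `` {cube_concat f g | f g. f \<in> A \<and> g \<in> B}), one = C\<rparr>"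
    unfolding homotopy_group_def C_def[symmetric] R_def[symmetric] quot img[OF singletonI c] ..
  have CC: "R `` {cube_concat f g | f g. f \<in> C \<and> g \<in> C} = C" by (rule img[OF conc c])
  have "group (homotopy_group q X x)"
    unfolding G by (rule groupI) (simp_all add: CC)
  then show "trivial_group (homotopy_group q X x)" unfolding trivial_group_def by (simp add: G)
qed

lemma enp_frames_eventually_q_connected:
  assumes q: "q + 2 \<le> DIM('a::rc_scalar) * d" and d: "d \<ge> 2"
  shows "\<forall>\<^sub>F n in sequentially. q_connected q (enp_frame_space d n :: 'a mat topology)"
proof (rule eventually_sequentiallyI)
  fix n assume n: "d * (d * (2 * (q + 2))) \<le> n"
  show "q_connected q (enp_frame_space d n :: 'a mat topology)"
    by (rule q_connected_if_null_homotopic) (rule frame_null_homotopy[OF q d n], simp_all add: topspace_frames)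
qed

theorem corollary4p7:
  fixes q d :: nat
  assumes "q > 0"
  shows "(d \<ge> q + 2 \<longrightarrow>
           (\<forall>\<^sub>F n in sequentially. q_connected q (enp_frame_space d n :: real mat topology))) \<and>
         (real d \<ge> (real q + 2) / 2 \<longrightarrow>
           (\<forall>\<^sub>F n in sequentially. q_connected q (enp_frame_space d n :: complex mat topology)))"
proof (intro conjI impI)
  assume "d \<ge> q + 2"
  then have "q + 2 \<le> DIM(real) * d" "d \<ge> 2" by simp_all
  then show "\<forall>\<^sub>F n in sequentially. q_connected q (enp_frame_space d n :: real mat topology)"
    by (rule enp_frames_eventually_q_connected)
next
  assume "real d \<ge> (real q + 2) / 2"
  then have "real (q + 2) \<le> real (2 * d)" by simp
  then have "q + 2 \<le> 2 * d" unfolding of_nat_le_iff .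
  then have "q + 2 \<le> DIM(complex) * d" "d \<ge> 2" using assms by simp_all
  then show "\<forall>\<^sub>F n in sequentially. q_connected q (enp_frame_space d n :: complex mat topology)"
    by (rule enp_frames_eventually_q_connected)
qed

end
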